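(* Let $K$ be an algebraically closed field, let $n,r\in\mathbb{N}$ (positive integers), and let $A$ be the $K$-algebra with involution $(\mathrm{M}_n(K)\times\mathrm{M}_n(K),\ (a,b)\mapsto(b^{\mathrm t},a^{\mathrm t}))$. Let $Z_r\subseteq A^r$ be the set of $r$-tuples which do not generate $A$. For $i\in\{1,\dots,n-1\}$ let $X_i\subseteq A^r$ be the set of tuples $((a_1,b_1),\dots,(a_r,b_r))$ for which there is an $i$-dimensional subspace $V\subseteq K^n$ such that $a_1,\dots,a_r$ stabilize $V$ and $b_1,\dots,b_r$ stabilize $V^\perp$. Let \[Y=\{((a_j,b_j))_{j=1}^r\in A^r : \text{there is a symmetric non-alternating } p\in\mathrm{GL}_n(K)\text{ with } pa_jp^{-1}=b_j\text{ for all } j\},\] \[Y'=\{((a_j,b_j))_{j=1}^r\in A^r : \text{there is an alternating } p\in\mathrm{GL}_n(K)\text{ with } pa_jp^{-1}=b_j\text{ for all } j\},\] and let $\overline{Y},\overline{Y'}$ denote their Zariski closures in $A^r$. Then: (i) If $n$ is odd, or $(n,r)=(2,1)$, or $\mathrm{char}\,K=2$, then the irreducible components of $Z_r$ are $X_1,\dots,X_{n-1}$ and $\overline{Y}$. (ii) If $n$ is even, $(n,r)\neq(2,1)$ and $\mathrm{char}\,K\neq 2$, then the irreducible components of $Z_r$ are $X_1,\dots,X_{n-1},\overline{Y}$ and $\overline{Y'}$.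
   Context: $A$ is viewed as a unital $K$-algebra with involution: subalgebras contain the unity and are stable under the involution, and an $r$-tuple generates $A$ if the smallest such subalgebra containing its entries is $A$. $A^r$ is given the Zariski topology of an affine space, and $Z_r$ is a closed subset of $A^r$. For a subspace $V\subseteq K^n$ (column vectors), $V^\perp=\{x\in K^n : x^{\mathrm t}y=0\text{ for all }y\in V\}$. A matrix $a$ stabilizes $V$ if $aV\subseteq V$. A matrix is alternating if it is skew-symmetric with zero diagonal. *)

theory Defs
  imports "HOL-Analysis.Analysis" "HOL-Computational_Algebra.Computational_Algebra"
begin

section \<open>Zariski topology and irreducible components\<close>

text \<open>Polynomial functions on a set of points with respect to a family \<open>C\<close> of coordinate functions:
  the algebra of functions generated by \<open>C\<close>.\<close>

inductive_set poly_functions :: "('p \<Rightarrow> 'k::field) set \<Rightarrow> ('p \<Rightarrow> 'k) set"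
  for C :: "('p \<Rightarrow> 'k) set" where
  coord: "f \<in> C \<Longrightarrow> f \<in> poly_functions C"
| const: "(\<lambda>_. c) \<in> poly_functions C"
| add: "f \<in> poly_functions C \<Longrightarrow> g \<in> poly_functions C \<Longrightarrow> (\<lambda>x. f x + g x) \<in> poly_functions C"
| mult: "f \<in> poly_functions C \<Longrightarrow> g \<in> poly_functions C \<Longrightarrow> (\<lambda>x. f x * g x) \<in> poly_functions C"

definition zero_locus :: "('p \<Rightarrow> 'k::field) set \<Rightarrow> 'p set" where
  "zero_locus F = {x. \<forall>f\<in>F. f x = 0}"

definition zariski :: "('p \<Rightarrow> 'k::field) set \<Rightarrow> 'p topology" where
  "zariski C = topology (\<lambda>U. \<exists>F \<subseteq> poly_functions C. U = - zero_locus F)"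

lemma istopology_zariski:
  "istopology (\<lambda>U. \<exists>F \<subseteq> poly_functions C. U = - zero_locus F)"
  unfolding istopology_def
proof (intro conjI allI impI)
  fix S T
  assume "\<exists>F \<subseteq> poly_functions C. S = - zero_locus F" "\<exists>F \<subseteq> poly_functions C. T = - zero_locus F"
  then obtain F G where F: "F \<subseteq> poly_functions C" "S = - zero_locus F"
    and G: "G \<subseteq> poly_functions C" "T = - zero_locus G" by blast
  define H where "H = {\<lambda>x. f x * g x | f g. f \<in> F \<and> g \<in> G}"
  have "H \<subseteq> poly_functions C"
    using F(1) G(1) by (auto simp: H_def intro: poly_functions.mult)
  moreover have "S \<inter> T = - zero_locus H"
    unfolding F(2) G(2) zero_locus_def H_def by force
  ultimately show "\<exists>F \<subseteq> poly_functions C. S \<inter> T = - zero_locus F" by blast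
next
  fix \<K> :: "'a set set"
  assume "\<forall>K\<in>\<K>. \<exists>F \<subseteq> poly_functions C. K = - zero_locus F"
  then obtain F where F: "\<And>K. K \<in> \<K> \<Longrightarrow> F K \<subseteq> poly_functions C \<and> K = - zero_locus (F K)"
    by metis
  have "\<Union>\<K> = - zero_locus (\<Union>K\<in>\<K>. F K)"
    using F by (fastforce simp: zero_locus_def)
  moreover have "(\<Union>K\<in>\<K>. F K) \<subseteq> poly_functions C" using F by blast
  ultimately show "\<exists>F \<subseteq> poly_functions C. \<Union>\<K> = - zero_locus F" by blast
qed

lemma openin_zariski:
  "openin (zariski C) U \<longleftrightarrow> (\<exists>F \<subseteq> poly_functions C. U = - zero_locus F)"
  by (simp add: zariski_def topology_inverse' [OF istopology_zariski])

lemma topspace_zariski [simp]: "topspace (zariski C) = UNIV"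
proof -
  have "zero_locus {\<lambda>_. 1} = {}" by (auto simp: zero_locus_def)
  then have "openin (zariski C) UNIV"
    unfolding openin_zariski by (intro exI[of _ "{\<lambda>_. 1}"]) (auto intro: poly_functions.const)
  then show ?thesis using openin_subset by blast
qed

lemma closedin_zariski:
  "closedin (zariski C) Z \<longleftrightarrow> (\<exists>F \<subseteq> poly_functions C. Z = zero_locus F)"
  by (auto simp: closedin_def openin_zariski Compl_eq_Diff_UNIV[symmetric])

definition irreducible_space :: "'p topology \<Rightarrow> bool" where
  "irreducible_space X \<longleftrightarrow> topspace X \<noteq> {} \<and>
     (\<forall>C D. closedin X C \<and> closedin X D \<and> topspace X = C \<union> D \<longrightarrow> C = topspace X \<or> D = topspace X)"

definition irreducible_components :: "'p topology \<Rightarrow> 'p set set" where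
  "irreducible_components X =
     {S. S \<subseteq> topspace X \<and> irreducible_space (subtopology X S) \<and>
         (\<forall>T. S \<subseteq> T \<and> T \<subseteq> topspace X \<and> irreducible_space (subtopology X T) \<longrightarrow> T = S)}"


section \<open>The algebra with involution\<close>

text \<open>The type \<open>'n\<close> indexes rows and columns and \<open>'r\<close> indexes tuples, so that \<open>n = CARD('n)\<close>
  and \<open>r = CARD('r)\<close>. The product of matrices is \<open>**\<close>; the instance of \<open>*\<close> for vectors is
  entrywise and is not used.\<close>

type_synonym ('k, 'n) mat_pair = "('k^'n^'n) \<times> ('k^'n^'n)"

definition pair_one :: "('k::field, 'n::finite) mat_pair" where
  "pair_one = (mat 1, mat 1)"

definition pair_add :: "('k::field, 'n::finite) mat_pair \<Rightarrow> ('k, 'n) mat_pair \<Rightarrow> ('k, 'n) mat_pair" where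
  "pair_add x y = (fst x + fst y, snd x + snd y)"

definition pair_mult :: "('k::field, 'n::finite) mat_pair \<Rightarrow> ('k, 'n) mat_pair \<Rightarrow> ('k, 'n) mat_pair" where
  "pair_mult x y = (fst x ** fst y, snd x ** snd y)"

definition pair_scale :: "'k::field \<Rightarrow> ('k, 'n::finite) mat_pair \<Rightarrow> ('k, 'n) mat_pair" where
  "pair_scale c x = ((\<chi> i j. c * fst x $ i $ j), (\<chi> i j. c * snd x $ i $ j))"

definition pair_star :: "('k::field, 'n::finite) mat_pair \<Rightarrow> ('k, 'n) mat_pair" where
  "pair_star x = (transpose (snd x), transpose (fst x))"

definition star_subalgebra :: "('k::field, 'n::finite) mat_pair set \<Rightarrow> bool" where
  "star_subalgebra S \<longleftrightarrow>
     pair_one \<in> S \<and>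
     (\<forall>x\<in>S. \<forall>y\<in>S. pair_add x y \<in> S) \<and>
     (\<forall>x\<in>S. \<forall>y\<in>S. pair_mult x y \<in> S) \<and>
     (\<forall>c. \<forall>x\<in>S. pair_scale c x \<in> S) \<and>
     (\<forall>x\<in>S. pair_star x \<in> S)"

definition generates :: "('k::field, 'n::finite) mat_pair ^ 'r::finite \<Rightarrow> bool" where
  "generates t \<longleftrightarrow> star_subalgebra hull (range (\<lambda>j. t $ j)) = UNIV"

definition tuple_coords :: "(('k::field, 'n::finite) mat_pair ^ 'r::finite \<Rightarrow> 'k) set" where
  "tuple_coords = {\<lambda>t. fst (t $ j) $ k $ l | j k l. True} \<union> {\<lambda>t. snd (t $ j) $ k $ l | j k l. True}"

abbreviation tuple_zariski :: "(('k::field, 'n::finite) mat_pair ^ 'r::finite) topology" where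
  "tuple_zariski \<equiv> zariski tuple_coords"


section \<open>The subsets of the space of tuples\<close>

definition perp :: "('k::field ^ 'n::finite) set \<Rightarrow> ('k ^ 'n) set" where
  "perp V = {x. \<forall>y\<in>V. (\<Sum>i\<in>UNIV. x $ i * y $ i) = 0}"

definition stabilizes :: "'k::field ^ 'n ^ 'n::finite \<Rightarrow> ('k ^ 'n) set \<Rightarrow> bool" where
  "stabilizes a V \<longleftrightarrow> (\<lambda>x. a *v x) ` V \<subseteq> V"

definition symmetric_matrix :: "'k::field ^ 'n ^ 'n::finite \<Rightarrow> bool" where
  "symmetric_matrix p \<longleftrightarrow> transpose p = p"

definition alternating_matrix :: "'k::field ^ 'n ^ 'n::finite \<Rightarrow> bool" where
  "alternating_matrix p \<longleftrightarrow> transpose p = - p \<and> (\<forall>i. p $ i $ i = 0)"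

definition set_Z :: "(('k::field, 'n::finite) mat_pair ^ 'r::finite) set" where
  "set_Z = {t. \<not> generates t}"

definition set_X :: "nat \<Rightarrow> (('k::field, 'n::finite) mat_pair ^ 'r::finite) set" where
  "set_X i = {t. \<exists>V. vec.subspace V \<and> vec.dim V = i \<and>
     (\<forall>j. stabilizes (fst (t $ j)) V) \<and> (\<forall>j. stabilizes (snd (t $ j)) (perp V))}"

definition set_Y :: "(('k::field, 'n::finite) mat_pair ^ 'r::finite) set" where
  "set_Y = {t. \<exists>p. invertible p \<and> symmetric_matrix p \<and> \<not> alternating_matrix p \<and>
     (\<forall>j. p ** fst (t $ j) ** matrix_inv p = snd (t $ j))}"

definition set_Y' :: "(('k::field, 'n::finite) mat_pair ^ 'r::finite) set" where
  "set_Y' = {t. \<exists>p. invertible p \<and> alternating_matrix p \<and>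
     (\<forall>j. p ** fst (t $ j) ** matrix_inv p = snd (t $ j))}"

end

theory Submission
  imports Defs
begin

no_notation fps_nth (infixl "$" 75)

text \<open>
  If the matrices \<open>a\<^sub>j\<close> and \<open>b\<^sub>j\<^sup>t\<close> have no common invariant subspace, then by Burnside's theorem and Goursat's
  lemma a proper star subalgebra containing the tuple is the graph of an inner automorphism \<open>x \<mapsto> p x p\<^sup>-\<^sup>1\<close>, and stability
  under the involution forces \<open>p\<^sup>t = p\<close> or \<open>p\<^sup>t = - p\<close>. Hence the tuples that do not generate are those in the sets \<open>X\<^sub>i\<close>,
  \<open>Y\<close> and \<open>Y'\<close>. These sets are irreducible because any two of their points lie on a rational curve,
  obtained by moving the conjugating matrix and the conjugated ones along lines.

  Each \<open>X\<^sub>i\<close> is closed, and the closures of \<open>Y\<close> and \<open>Y'\<close> lie in the sets of tuples admitting a nonzero, possibly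
  singular, intertwiner \<open>p\<close> with \<open>p\<^sup>t = p\<close> or \<open>p\<^sup>t = - p\<close>. Both follow from the valuative criterion: a closure point is a
  specialization along a place of an ultrapower of the field, and a subspace or an intertwiner, normalized by an
  entry that divides all the others, specializes to one at the closure point. By Schur's lemma, an irreducible tuple has
  only one intertwiner up to scalars, which separates the closures of \<open>Y\<close> and \<open>Y'\<close>. That no \<open>X\<^sub>i\<close> contains
  another one, \<open>Y\<close> or \<open>Y'\<close> is seen on nilpotent shifts, whose only invariant subspaces are the members of a flag.
  In characteristic 2 an alternating \<open>p\<close> is the limit of the symmetric matrices \<open>p + x\<close>, so \<open>Y'\<close> lies in the closure of
  \<open>Y\<close>; for \<open>(n, r) = (2, 1)\<close> it lies in \<open>X\<^sub>1\<close>.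
\<close>

section \<open>Places of ultrapowers and closure points\<close>

text \<open>Both closedness statements are instances of properness: of the Grassmannian for
  \<open>set_X\<close>, of the projective space of intertwiners for the closures of
  \<open>set_Y\<close> and \<open>set_Y'\<close>. A place stands in for a limit; it can take its
  values in \<open>'k\<close> itself because \<open>'k\<close> is algebraically closed, and no
  equations of the closures are ever computed. The obstacle is that \<open>set_Y\<close> and
  \<open>set_Y'\<close> are not closed in general: invertible conjugating matrices may degenerate to
  a singular one. The set \<open>set_C\<close> admits these degenerations, yet its tuples still lie
  in a proper star subalgebra, and this keeps both closures inside \<open>set_Z\<close>. It also
  keeps every \<open>set_X k\<close> out of them, since a tuple of pairs \<open>(0, mat 1)\<close>
  has no nonzero intertwiner. The components then come from a general principle: finitely many
  closed irreducible sets, none inside another, are the components of their union.\<close>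

lemma ultrafilter_refinement:
  fixes F :: "'a filter"
  assumes "F \<noteq> bot"
  obtains U where "U \<noteq> bot" "U \<le> F" "\<And>P. eventually P U \<or> eventually (\<lambda>x. \<not> P x) U"
proof -
  define A where "A = {U. U \<noteq> bot \<and> U \<le> F}"
  let ?P = "\<lambda>U V :: 'a filter. V \<le> U"
  have "\<exists>m\<in>A. \<forall>a\<in>A. ?P m a \<longrightarrow> a = m"
  proof (rule predicate_Zorn)
    show "partial_order_on A (relation_of ?P A)"
      by (rule partial_order_on_relation_ofI) auto
  next
    fix K assume K: "K \<in> Chains (relation_of ?P A)"
    then have KA: "K \<subseteq> A" and Kc: "\<And>U V. U \<in> K \<Longrightarrow> V \<in> K \<Longrightarrow> U \<le> V \<or> V \<le> U"
      by (auto simp: Chains_def relation_of_def)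
    show "\<exists>u\<in>A. \<forall>a\<in>K. ?P a u"
    proof (cases "K = {}")
      case True then show ?thesis using assms by (auto simp: A_def)
    next
      case False
      \<comment> \<open>An event of the infimum of a chain is already an event of some member, so
        the infimum is \<open>bot\<close> only if a member is.\<close>
      have "eventually (\<lambda>_. False) (Inf K) \<longleftrightarrow> (\<exists>b\<in>K. eventually (\<lambda>_. False) b)"
        using False by (intro eventually_Inf_base) (auto, metis Kc inf.absorb1 inf.absorb2 order_refl)
      then have "Inf K \<noteq> bot" using KA by (auto simp: A_def trivial_limit_def)
      moreover have "Inf K \<le> F" using False KA by (auto simp: A_def intro: Inf_lower2)
      ultimately show ?thesis by (auto simp: A_def intro!: bexI[of _ "Inf K"] Inf_lower)
    qed
  qed
  then obtain U where U: "U \<noteq> bot" "U \<le> F" and max: "\<And>V. V \<noteq> bot \<Longrightarrow> V \<le> U \<Longrightarrow> V = U"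
    by (auto simp: A_def)
  have "eventually P U \<or> eventually (\<lambda>x. \<not> P x) U" for P
  proof (cases "eventually (\<lambda>x. \<not> P x) U")
    case False
    \<comment> \<open>If the complement of \<open>P\<close> is not an event, restricting
      \<open>U\<close> to \<open>P\<close> leaves a nontrivial filter, and minimality of
      \<open>U\<close> returns \<open>U\<close> itself.\<close>
    let ?V = "inf U (principal {x. P x})"
    have "?V \<noteq> bot"
      using False by (auto simp: trivial_limit_def eventually_inf_principal)
    then have "?V = U" by (intro max) auto
    moreover have "eventually P ?V" by (simp add: eventually_inf_principal)
    ultimately show ?thesis by simp
  qed simp
  with U that show ?thesis by blast
qed

text \<open>Supplies the filter base behind a closure point: a function that does not vanish at
  \<open>t\<close> is nonzero somewhere on \<open>S\<close>. Single equations suffice because a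
  closed set is an intersection of zero loci of single functions.\<close>

lemma in_closure_zariski:
  "t \<in> zariski C closure_of S \<longleftrightarrow> (\<forall>f\<in>poly_functions C. (\<forall>s\<in>S. f s = 0) \<longrightarrow> f t = 0)"
proof
  assume t: "t \<in> zariski C closure_of S"
  show "\<forall>f\<in>poly_functions C. (\<forall>s\<in>S. f s = 0) \<longrightarrow> f t = 0"
  proof (intro ballI impI)
    fix f assume f: "f \<in> poly_functions C" "\<forall>s\<in>S. f s = 0"
    then have "closedin (zariski C) (zero_locus {f})" "S \<subseteq> zero_locus {f}"
      by (auto simp: closedin_zariski zero_locus_def)
    then have "zariski C closure_of S \<subseteq> zero_locus {f}" by (rule closure_of_minimal[rotated])
    with t show "f t = 0" by (auto simp: zero_locus_def)
  qed
next
  assume h: "\<forall>f\<in>poly_functions C. (\<forall>s\<in>S. f s = 0) \<longrightarrow> f t = 0"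
  obtain E where E: "E \<subseteq> poly_functions C" "zariski C closure_of S = zero_locus E"
    using closedin_closure_of[of "zariski C" S] unfolding closedin_zariski by blast
  have "S \<subseteq> zariski C closure_of S" by (simp add: closure_of_subset)
  with E h show "t \<in> zariski C closure_of S" by (fastforce simp: zero_locus_def)
qed

text \<open>A relation \<open>G\<close> as below is the graph of a ring homomorphism to \<open>'k\<close> from a subring of the
  ultrapower of \<open>'k\<close> along \<open>F\<close>, with elements of the ultrapower represented by functions.\<close>

locale specialization =
  fixes F :: "'p filter" and G :: "(('p \<Rightarrow> 'k::field) \<times> 'k) set"
  assumes const: "(\<lambda>_. c, c) \<in> G"
    and add: "(f, a) \<in> G \<Longrightarrow> (h, b) \<in> G \<Longrightarrow> (\<lambda>s. f s + h s, a + b) \<in> G"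
    and mult: "(f, a) \<in> G \<Longrightarrow> (h, b) \<in> G \<Longrightarrow> (\<lambda>s. f s * h s, a * b) \<in> G"
    and cong: "(f, a) \<in> G \<Longrightarrow> eventually (\<lambda>s. f s = h s) F \<Longrightarrow> (h, a) \<in> G"
    and zero: "(f, a) \<in> G \<Longrightarrow> eventually (\<lambda>s. f s = 0) F \<Longrightarrow> a = 0"
begin

lemma uminus: "(f, a) \<in> G \<Longrightarrow> (\<lambda>s. - f s, - a) \<in> G"
  using mult[OF const[of "-1"], of f a] by simp

lemma diff: "(f, a) \<in> G \<Longrightarrow> (h, b) \<in> G \<Longrightarrow> (\<lambda>s. f s - h s, a - b) \<in> G"
  using add[OF _ uminus, of f a h b] by simp

lemma sum: "(\<And>i. i \<in> I \<Longrightarrow> (f i, a i) \<in> G) \<Longrightarrow> (\<lambda>s. \<Sum>i\<in>I. f i s, \<Sum>i\<in>I. a i) \<in> G"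
  by (induction I rule: infinite_finite_induct) (auto intro: const add)

lemma unique:
  assumes "(f, a) \<in> G" "(h, b) \<in> G" "eventually (\<lambda>s. f s = h s) F"
  shows "a = b"
  using zero[OF diff[OF assms(1,2)]] assms(3) by simp

text \<open>The uniform degree bound makes such a family a genuine polynomial over the domain of
  \<open>G\<close>, rather than an internal polynomial of unbounded degree over the ultrapower. The
  second component is its reduction.\<close>

definition poly_graph :: "(('p \<Rightarrow> 'k poly) \<times> 'k poly) set" where
  "poly_graph = {(q, a). (\<forall>i. (\<lambda>s. coeff (q s) i, coeff a i) \<in> G) \<and> (\<exists>N. \<forall>s. degree (q s) \<le> N)}"

lemma poly_graph_add:
  "(q, a) \<in> poly_graph \<Longrightarrow> (r, b) \<in> poly_graph \<Longrightarrow> (\<lambda>s. q s + r s, a + b) \<in> poly_graph"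
  unfolding poly_graph_def
  apply (auto intro: add)
  subgoal for N M by (meson degree_add_le le_max_iff_disj)
  done

lemma poly_graph_mult:
  "(q, a) \<in> poly_graph \<Longrightarrow> (r, b) \<in> poly_graph \<Longrightarrow> (\<lambda>s. q s * r s, a * b) \<in> poly_graph"
  unfolding poly_graph_def
  apply (auto simp: coeff_mult intro!: sum mult)
  subgoal for N M by (intro exI[of _ "N + M"] allI order.trans[OF degree_mult_le] add_mono) auto
  done

lemma poly_graph_const: "(f, a) \<in> G \<Longrightarrow> (\<lambda>s. [:f s:], [:a:]) \<in> poly_graph"
  unfolding poly_graph_def using const[of 0] by (auto simp: coeff_pCons split: nat.splits)

lemma poly_graph_poly: "(\<lambda>_. a, a) \<in> poly_graph"
  unfolding poly_graph_def by (auto intro: const)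

text \<open>The reductions of the polynomials that vanish at \<open>x\<close>: any value assigned to
  \<open>x\<close> by a larger specialization has to be a common root of them.\<close>

definition relation_ideal :: "('p \<Rightarrow> 'k) \<Rightarrow> 'k poly set" where
  "relation_ideal x = {a. \<exists>q. (q, a) \<in> poly_graph \<and> eventually (\<lambda>s. poly (q s) (x s) = 0) F}"

lemma relation_ideal_add: "a \<in> relation_ideal x \<Longrightarrow> b \<in> relation_ideal x \<Longrightarrow> a + b \<in> relation_ideal x"
  unfolding relation_ideal_def
  by (fastforce intro: poly_graph_add elim: eventually_elim2)

lemma relation_ideal_mult: "a \<in> relation_ideal x \<Longrightarrow> b * a \<in> relation_ideal x"
  unfolding relation_ideal_def
  by (fastforce intro: poly_graph_mult[OF poly_graph_poly] elim: eventually_mono)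

text \<open>Adjoins \<open>x\<close> with value \<open>\<xi>\<close>. In general this is only a
  relation; it is the graph of a function once \<open>\<xi>\<close> is a root of the relation
  ideal.\<close>

definition extension :: "('p \<Rightarrow> 'k) \<Rightarrow> 'k \<Rightarrow> (('p \<Rightarrow> 'k) \<times> 'k) set" where
  "extension x \<xi> = {(h, c). \<exists>q a. (q, a) \<in> poly_graph \<and> eventually (\<lambda>s. h s = poly (q s) (x s)) F \<and> c = poly a \<xi>}"

lemma subset_extension: "G \<subseteq> extension x \<xi>"
  unfolding extension_def
  by (clarsimp, rename_tac f a, rule_tac x="\<lambda>s. [:f s:]" in exI, rule_tac x="[:a:]" in exI)
     (auto intro: poly_graph_const)

lemma in_extension: "(x, \<xi>) \<in> extension x \<xi>"
  unfolding extension_def using poly_graph_poly[of "[:0, 1:]"]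
  by (force intro!: exI[of _ "\<lambda>_. [:0, 1:]"] exI[of _ "[:0, 1:]"])

text \<open>The root hypothesis enters in the axiom \<open>zero\<close> alone: an element that
  vanishes along \<open>F\<close> is given by a polynomial whose reduction lies in
  \<open>relation_ideal x\<close>. The other axioms are arithmetic of polynomials.\<close>

lemma specialization_extension:
  assumes root: "\<And>a. a \<in> relation_ideal x \<Longrightarrow> poly a \<xi> = 0"
  shows "specialization F (extension x \<xi>)"
proof
  show "(\<lambda>_. c, c) \<in> extension x \<xi>" for c using const subset_extension by blast
next
  fix f a h b assume "(f, a) \<in> extension x \<xi>" "(h, b) \<in> extension x \<xi>"
  then obtain q p r p' where q: "(q, p) \<in> poly_graph" "eventually (\<lambda>s. f s = poly (q s) (x s)) F" "a = poly p \<xi>"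
    and r: "(r, p') \<in> poly_graph" "eventually (\<lambda>s. h s = poly (r s) (x s)) F" "b = poly p' \<xi>"
    unfolding extension_def by auto
  have "eventually (\<lambda>s. f s + h s = poly (q s + r s) (x s)) F"
    and "eventually (\<lambda>s. f s * h s = poly (q s * r s) (x s)) F"
    using q(2) r(2) by (eventually_elim, simp)+
  moreover have "a + b = poly (p + p') \<xi>" "a * b = poly (p * p') \<xi>" using q(3) r(3) by simp_all
  ultimately show "(\<lambda>s. f s + h s, a + b) \<in> extension x \<xi>" "(\<lambda>s. f s * h s, a * b) \<in> extension x \<xi>"
    using poly_graph_add[OF q(1) r(1)] poly_graph_mult[OF q(1) r(1)] unfolding extension_def by blast+
next
  fix f a h assume "(f, a) \<in> extension x \<xi>" and e: "eventually (\<lambda>s. f s = h s) F"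
  then obtain q p where q: "(q, p) \<in> poly_graph" "eventually (\<lambda>s. f s = poly (q s) (x s)) F" "a = poly p \<xi>"
    unfolding extension_def by auto
  have "eventually (\<lambda>s. h s = poly (q s) (x s)) F" using q(2) e by eventually_elim simp
  then show "(h, a) \<in> extension x \<xi>" using q unfolding extension_def by blast
next
  fix f a assume "(f, a) \<in> extension x \<xi>" and e: "eventually (\<lambda>s. f s = 0) F"
  then obtain q p where q: "(q, p) \<in> poly_graph" "eventually (\<lambda>s. f s = poly (q s) (x s)) F" "a = poly p \<xi>"
    unfolding extension_def by auto
  have "eventually (\<lambda>s. poly (q s) (x s) = 0) F" using q(2) e by eventually_elim simp
  then show "a = 0" using q root unfolding relation_ideal_def by blast
qed

text \<open>A unit ideal relation for \<open>x\<close> and one for \<open>1/x\<close> of degrees \<open>N \<ge> M\<close> combine to one of degree less than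
  \<open>N\<close> for \<open>x\<close>: multiply the former by the constant coefficient of the latter and cancel the top term.\<close>

lemma no_unit_relations:
  assumes "F \<noteq> bot"
    and "(q, 1) \<in> poly_graph" "eventually (\<lambda>s. poly (q s) (x s) = 0) F" "\<And>s. degree (q s) \<le> N"
    and "(r, 1) \<in> poly_graph" "eventually (\<lambda>s. poly (r s) (y s) = 0) F" "\<And>s. degree (r s) \<le> M"
    and "eventually (\<lambda>s. x s * y s = 1) F"
  shows False
  using assms(2-)
proof (induction "N + M" arbitrary: N M q r x y rule: less_induct)
  case less
  \<comment> \<open>Isolated so that it applies in both orders of the degrees; when
    \<open>N < M\<close> the roles of \<open>x\<close> and \<open>y\<close> are exchanged.\<close>
  have step: False
    if IH: "\<And>q' N'. N' < N \<Longrightarrow> (q', 1) \<in> poly_graph \<Longrightarrow> eventually (\<lambda>s. poly (q' s) (x s) = 0) F \<Longrightarrow>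
        (\<And>s. degree (q' s) \<le> N') \<Longrightarrow> False"
      and q: "(q, 1) \<in> poly_graph" "eventually (\<lambda>s. poly (q s) (x s) = 0) F" "\<And>s. degree (q s) \<le> N"
      and r: "(r, 1) \<in> poly_graph" "eventually (\<lambda>s. poly (r s) (y s) = 0) F" "\<And>s. degree (r s) \<le> M"
      and xy: "eventually (\<lambda>s. x s * y s = 1) F" and NM: "M \<le> N"
    for N M q r x y
  proof (cases "N = 0")
    case True
    have "(\<lambda>s. coeff (q s) 0, coeff 1 0) \<in> G" using q(1) unfolding poly_graph_def by blast
    moreover have "eventually (\<lambda>s. coeff (q s) 0 = 0) F"
      using q(2)
    proof eventually_elim
      case (elim s)
      have "q s = [:coeff (q s) 0:]" using q(3)[of s] True degree_eq_zeroE[of "q s"] by fastforce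
      then show ?case using elim by (metis poly_const_conv)
    qed
    ultimately have "coeff (1 :: 'k poly) 0 = 0" by (rule zero)
    then show False by simp
  next
    case False
    \<comment> \<open>The reversed polynomial: \<open>u ^ N * poly (r s) (1 / u)\<close>. It turns
      the relation for \<open>y\<close> into one for \<open>x\<close>.\<close>
    define R where "R s = (\<Sum>j\<le>M. monom (coeff (r s) j) (N - j))" for s
    have coeff_R: "coeff (R s) i = (if i \<le> N then coeff (r s) (N - i) else 0)" for s i
    proof -
      have "coeff (R s) i = (\<Sum>j\<le>M. if j = N - i \<and> i \<le> N then coeff (r s) j else 0)"
        unfolding R_def coeff_sum coeff_monom using NM by (intro sum.cong) auto
      also have "\<dots> = (if i \<le> N \<and> N - i \<le> M then coeff (r s) (N - i) else 0)"
        by (cases "i \<le> N") (auto simp: sum.delta)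
      also have "\<dots> = (if i \<le> N then coeff (r s) (N - i) else 0)"
        using r(3)[of s] coeff_eq_0[of "r s" "N - i"] by auto
      finally show ?thesis .
    qed
    have poly_R: "poly (R s) u = u ^ N * poly (r s) v" if "u * v = 1" for s u v
    proof -
      have "poly (r s) v = (\<Sum>j\<le>M. coeff (r s) j * v ^ j)"
        unfolding poly_altdef by (rule sum.mono_neutral_left) (use r(3)[of s] in \<open>auto simp: coeff_eq_0\<close>)
      moreover have "u ^ (N - j) = u ^ N * v ^ j" if "j \<le> M" for j
      proof -
        have "u ^ N * v ^ j = u ^ (N - j) * (u * v) ^ j"
          using that NM by (simp add: power_mult_distrib mult.assoc[symmetric] power_add[symmetric])
        then show ?thesis using \<open>u * v = 1\<close> by simp
      qed
      ultimately show ?thesis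
        unfolding R_def poly_sum poly_monom by (simp add: sum_distrib_left mult.left_commute)
    qed
    \<comment> \<open>The terms of degree \<open>N\<close> cancel, as \<open>R s\<close> has the
      coefficient \<open>coeff (r s) 0\<close> there. The reduction is still 1:
      \<open>coeff (r s) 0\<close> specializes to 1, and \<open>coeff (q s) N\<close> to 0 because
      \<open>N\<close> is not 0.\<close>
    define q' where "q' s = smult (coeff (r s) 0) (q s) - smult (coeff (q s) N) (R s)" for s
    have qG: "(\<lambda>s. coeff (q s) i, coeff 1 i) \<in> G" and rG: "(\<lambda>s. coeff (r s) i, coeff 1 i) \<in> G" for i
      using q(1) r(1) unfolding poly_graph_def by blast+
    have deg: "degree (q' s) \<le> N - 1" for s
    proof (rule degree_le, intro allI impI)
      fix i assume "N - 1 < i"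
      then consider "i = N" | "i > N" by linarith
      then show "coeff (q' s) i = 0"
        using q(3)[of s] by cases (auto simp: q'_def coeff_R coeff_eq_0)
    qed
    have "(\<lambda>s. coeff (q' s) i, coeff 1 i) \<in> G" for i
    proof -
      have RG: "(\<lambda>s. coeff (R s) i, if i \<le> N then coeff 1 (N - i) else 0) \<in> G"
        unfolding coeff_R using rG[of "N - i"] const[of 0] by auto
      have "(\<lambda>s. coeff (r s) 0 * coeff (q s) i - coeff (q s) N * coeff (R s) i,
          coeff 1 0 * coeff 1 i - coeff 1 N * (if i \<le> N then coeff 1 (N - i) else 0)) \<in> G"
        by (rule diff[OF mult[OF rG qG] mult[OF qG RG]])
      then show ?thesis using False by (simp add: q'_def)
    qed
    then have "(q', 1) \<in> poly_graph" unfolding poly_graph_def using deg by auto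
    moreover have "eventually (\<lambda>s. poly (q' s) (x s) = 0) F"
      using q(2) r(2) xy by eventually_elim (simp add: q'_def poly_R)
    ultimately show False using IH[of "N - 1" q'] deg False by simp
  qed
  show False
  proof (cases "M \<le> N")
    case True
    show ?thesis
      by (rule step[OF _ less.prems True]) (rule less.hyps[OF _ _ _ _ less.prems(4-7)], auto)
  next
    case False
    have yx: "eventually (\<lambda>s. y s * x s = 1) F" using less.prems(7) by (simp add: mult.commute)
    show ?thesis
      by (rule step[OF _ less.prems(4-6) less.prems(1-3) yx])
         (rule less.hyps[OF _ _ _ _ less.prems(1-3) yx], use False in auto)
  qed
qed

end

text \<open>A nonzero element of least degree divides all the others by division with remainder. It
  is not constant, the ideal being proper, so it has a root, and every other element inherits
  it.\<close>

lemma poly_ideal_common_root: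
  fixes I :: "'k::alg_closed_field poly set"
  assumes add: "\<And>a b. a \<in> I \<Longrightarrow> b \<in> I \<Longrightarrow> a + b \<in> I" and mult: "\<And>a b. a \<in> I \<Longrightarrow> b * a \<in> I"
    and proper: "1 \<notin> I"
  shows "\<exists>\<xi>. \<forall>a\<in>I. poly a \<xi> = 0"
proof (cases "I \<subseteq> {0}")
  case True
  then show ?thesis by (intro exI[of _ 0]) auto
next
  case False
  then have "\<exists>a. a \<in> I \<and> a \<noteq> 0" by auto
  from ex_has_least_nat[of "\<lambda>a. a \<in> I \<and> a \<noteq> 0" _ degree] this obtain p where p: "p \<in> I" "p \<noteq> 0"
    and min: "\<And>a. a \<in> I \<Longrightarrow> a \<noteq> 0 \<Longrightarrow> degree p \<le> degree a" by blast
  have "degree p > 0"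
  proof (rule ccontr)
    assume "\<not> degree p > 0"
    then obtain c where c: "p = [:c:]" using degree_eq_zeroE[of p] by auto
    then have "[:inverse c:] * p = 1" using p(2) by (simp add: one_pCons)
    with mult[OF p(1)] proper show False by metis
  qed
  then obtain \<xi> where \<xi>: "poly p \<xi> = 0" using alg_closed_imp_poly_has_root by blast
  have "poly a \<xi> = 0" if a: "a \<in> I" for a
  proof -
    have "a mod p = a + (- (a div p)) * p" by (simp add: minus_div_mult_eq_mod[symmetric])
    then have "a mod p \<in> I" using add[OF a mult[OF p(1)]] by metis
    then have "a mod p = 0"
      using min[of "a mod p"] degree_mod_less[of p a] p(2) by fastforce
    then show ?thesis using \<xi> by (metis dvd_def mod_eq_0_iff_dvd mult_zero_left poly_mult)
  qed
  then show ?thesis by blast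
qed

text \<open>\<open>nontrivial\<close> and \<open>ultra\<close> make the ultrapower a field, and
  \<open>total\<close> makes the domain of \<open>G\<close> a valuation ring in it. With
  \<open>inverse 0 = 0\<close> the zero element needs no exception.\<close>

locale place = specialization F G for F :: "'p filter" and G :: "(('p \<Rightarrow> 'k::field) \<times> 'k) set" +
  assumes nontrivial: "F \<noteq> bot"
    and ultra: "eventually P F \<or> eventually (\<lambda>s. \<not> P s) F"
    and total: "(\<exists>a. (x, a) \<in> G) \<or> (\<exists>a. (\<lambda>s. inverse (x s), a) \<in> G)"

text \<open>In a maximal specialization, \<open>x\<close> or \<open>1/x\<close> has a proper relation ideal, whose common root is an
  admissible value.\<close>

lemma specialization_extends_to_place:
  fixes G0 :: "(('p \<Rightarrow> 'k::alg_closed_field) \<times> 'k) set"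
  assumes G0: "specialization F G0" and F: "F \<noteq> bot" "\<And>P. eventually P F \<or> eventually (\<lambda>s. \<not> P s) F"
  obtains G where "G0 \<subseteq> G" "place F G"
proof -
  define A where "A = {G. specialization F G \<and> G0 \<subseteq> G}"
  have "\<exists>M\<in>A. \<forall>X\<in>A. M \<subseteq> X \<longrightarrow> X = M"
  proof (rule subset_Zorn_nonempty)
    show "A \<noteq> {}" using G0 by (auto simp: A_def)
  next
    fix K assume K: "K \<noteq> {}" "subset.chain A K"
    then have KA: "\<And>G. G \<in> K \<Longrightarrow> specialization F G \<and> G0 \<subseteq> G"
      and Kc: "\<And>G H. G \<in> K \<Longrightarrow> H \<in> K \<Longrightarrow> G \<subseteq> H \<or> H \<subseteq> G"
      by (auto simp: A_def subset_chain_def)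
    have pair: "\<exists>G\<in>K. u \<in> G \<and> v \<in> G" if "u \<in> \<Union>K" "v \<in> \<Union>K" for u v
      using that Kc by blast
    have "specialization F (\<Union>K)"
    proof
      show "(\<lambda>_. c, c) \<in> \<Union>K" for c
        using K(1) KA specialization.const by blast
      show "(\<lambda>s. f s + h s, a + b) \<in> \<Union>K" if "(f, a) \<in> \<Union>K" "(h, b) \<in> \<Union>K" for f a h b
        using pair[OF that] KA specialization.add by blast
      show "(\<lambda>s. f s * h s, a * b) \<in> \<Union>K" if "(f, a) \<in> \<Union>K" "(h, b) \<in> \<Union>K" for f a h b
        using pair[OF that] KA specialization.mult by blast
      show "(h, a) \<in> \<Union>K" if "(f, a) \<in> \<Union>K" "eventually (\<lambda>s. f s = h s) F" for f a h
        using that KA specialization.cong by blast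
      show "a = 0" if "(f, a) \<in> \<Union>K" "eventually (\<lambda>s. f s = 0) F" for f a
        using that KA specialization.zero by blast
    qed
    then show "\<Union>K \<in> A" using K(1) KA by (auto simp: A_def)
  qed
  then obtain G where G: "specialization F G" "G0 \<subseteq> G"
    and max: "\<And>H. specialization F H \<Longrightarrow> G \<subseteq> H \<Longrightarrow> H = G"
    by (auto simp: A_def)
  interpret specialization F G by fact
  have ext: "\<exists>a. (x, a) \<in> G" if proper: "1 \<notin> relation_ideal x" for x
  proof -
    have "\<exists>\<xi>. \<forall>a\<in>relation_ideal x. poly a \<xi> = 0"
      by (rule poly_ideal_common_root) (fact relation_ideal_add relation_ideal_mult proper)+
    then obtain \<xi> where \<xi>: "\<And>a. a \<in> relation_ideal x \<Longrightarrow> poly a \<xi> = 0" by blast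
    have "extension x \<xi> = G"
      by (intro max specialization_extension subset_extension \<xi>)
    then show ?thesis using in_extension[of x \<xi>] by auto
  qed
  have "(\<exists>a. (x, a) \<in> G) \<or> (\<exists>a. (\<lambda>s. inverse (x s), a) \<in> G)" for x
  proof (cases "eventually (\<lambda>s. x s = 0) F")
    case True
    then have "eventually (\<lambda>s. 0 = x s) F" by eventually_elim simp
    then have "(x, 0) \<in> G" by (rule cong[OF const])
    then show ?thesis by blast
  next
    case False
    with F(2) have "eventually (\<lambda>s. x s \<noteq> 0) F" by blast
    then have xy: "eventually (\<lambda>s. x s * inverse (x s) = 1) F" by eventually_elim simp
    have "1 \<notin> relation_ideal x \<or> 1 \<notin> relation_ideal (\<lambda>s. inverse (x s))"
    proof (rule ccontr)
      assume "\<not> ?thesis"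
      then obtain q r where q: "(q, 1) \<in> poly_graph" "eventually (\<lambda>s. poly (q s) (x s) = 0) F"
        and r: "(r, 1) \<in> poly_graph" "eventually (\<lambda>s. poly (r s) (inverse (x s)) = 0) F"
        unfolding relation_ideal_def by auto
      obtain N M where "\<And>s. degree (q s) \<le> N" "\<And>s. degree (r s) \<le> M"
        using q(1) r(1) unfolding poly_graph_def by auto
      then show False using no_unit_relations[OF F(1) q _ r _ xy] by blast
    qed
    then show ?thesis using ext by blast
  qed
  then have "place F G" using F by unfold_locales
  with G(2) show ?thesis using that by blast
qed

text \<open>The filter is generated by the nonvanishing sets in \<open>S\<close> of functions that
  are nonzero at \<open>t\<close>. None of them is empty, because \<open>t\<close> is a closure
  point, and products make them a filter base. A function that vanishes along the filter therefore
  vanishes at \<open>t\<close>, so evaluation at \<open>t\<close> is a specialization, to be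
  extended to a place.\<close>

theorem place_at_closure_point:
  fixes C :: "('p \<Rightarrow> 'k::alg_closed_field) set"
  assumes t: "t \<in> zariski C closure_of S"
  shows "\<exists>F G. place F G \<and> eventually (\<lambda>s. s \<in> S) F \<and> (\<forall>f\<in>poly_functions C. (f, f t) \<in> G)"
proof -
  define N where "N = {f \<in> poly_functions C. f t \<noteq> 0}"
  define F0 where "F0 = (INF f\<in>N. principal {s \<in> S. f s \<noteq> 0})"
  have one: "(\<lambda>_. 1) \<in> N" by (auto simp: N_def intro: poly_functions.const)
  have ev: "eventually P F0 \<longleftrightarrow> (\<exists>f\<in>N. eventually P (principal {s \<in> S. f s \<noteq> 0}))" for P
    unfolding F0_def
  proof (rule eventually_INF_base)
    show "N \<noteq> {}" using one by blast
    fix f h assume "f \<in> N" "h \<in> N"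
    then show "\<exists>x\<in>N. principal {s \<in> S. x s \<noteq> 0} \<le> inf (principal {s \<in> S. f s \<noteq> 0}) (principal {s \<in> S. h s \<noteq> 0})"
      by (intro bexI[of _ "\<lambda>s. f s * h s"]) (auto simp: N_def intro: poly_functions.mult)
  qed
  have "F0 \<noteq> bot"
    using t unfolding trivial_limit_def ev in_closure_zariski by (auto simp: eventually_principal N_def)
  then obtain F where F: "F \<noteq> bot" "F \<le> F0" "\<And>P. eventually P F \<or> eventually (\<lambda>x. \<not> P x) F"
    using ultrafilter_refinement by blast
  have evN: "eventually (\<lambda>s. f s \<noteq> 0) F" if "f \<in> poly_functions C" "f t \<noteq> 0" for f
    using that by (intro filter_leD[OF F(2)]) (auto simp: ev eventually_principal N_def)
  define G0 where "G0 = {(h, a). \<exists>f\<in>poly_functions C. eventually (\<lambda>s. f s = h s) F \<and> a = f t}"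
  have "specialization F G0"
  proof
    show "(\<lambda>_. c, c) \<in> G0" for c
      unfolding G0_def by (auto intro!: bexI[of _ "\<lambda>_. c"] poly_functions.const)
  next
    fix f a h b assume "(f, a) \<in> G0" "(h, b) \<in> G0"
    then obtain p q where p: "p \<in> poly_functions C" "eventually (\<lambda>s. p s = f s) F" "a = p t"
      and q: "q \<in> poly_functions C" "eventually (\<lambda>s. q s = h s) F" "b = q t" by (auto simp: G0_def)
    have "eventually (\<lambda>s. p s + q s = f s + h s) F" "eventually (\<lambda>s. p s * q s = f s * h s) F"
      using p(2) q(2) by (eventually_elim, simp)+
    then have "\<exists>r\<in>poly_functions C. eventually (\<lambda>s. r s = f s + h s) F \<and> a + b = r t"
      "\<exists>r\<in>poly_functions C. eventually (\<lambda>s. r s = f s * h s) F \<and> a * b = r t"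
      using p q by - (rule bexI[of _ "\<lambda>s. p s + q s"], simp_all add: poly_functions.add,
        rule bexI[of _ "\<lambda>s. p s * q s"], simp_all add: poly_functions.mult)
    then show "(\<lambda>s. f s + h s, a + b) \<in> G0" "(\<lambda>s. f s * h s, a * b) \<in> G0"
      unfolding G0_def mem_Collect_eq case_prod_conv by blast+
next
    fix f a h assume "(f, a) \<in> G0" and e: "eventually (\<lambda>s. f s = h s) F"
    then obtain p where p: "p \<in> poly_functions C" "eventually (\<lambda>s. p s = f s) F" "a = p t" by (auto simp: G0_def)
    have "eventually (\<lambda>s. p s = h s) F" using p(2) e by eventually_elim simp
    with p show "(h, a) \<in> G0" by (auto simp: G0_def)
  next
    fix f a assume "(f, a) \<in> G0" and e: "eventually (\<lambda>s. f s = 0) F"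
    then obtain p where p: "p \<in> poly_functions C" "eventually (\<lambda>s. p s = f s) F" "a = p t" by (auto simp: G0_def)
    have "eventually (\<lambda>s. p s = 0) F" using p(2) e by eventually_elim simp
    then show "a = 0" using evN[OF p(1)] p(3) F(1) eventually_conj[of "\<lambda>s. p s = 0" F "\<lambda>s. p s \<noteq> 0"]
      by (auto simp: trivial_limit_def)
  qed
  then obtain G where G: "G0 \<subseteq> G" "place F G"
    using specialization_extends_to_place F by blast
  moreover have "eventually (\<lambda>s. s \<in> S) F"
    using one by (intro filter_leD[OF F(2)]) (auto simp: ev eventually_principal)
  moreover have "(f, f t) \<in> G" if "f \<in> poly_functions C" for f
    using that G(1) by (force simp: G0_def)
  ultimately show ?thesis by blast
qed

section \<open>Irreducible sets and rational curves\<close>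

lemma irreducible_subtopology_iff:
  assumes "S \<subseteq> topspace X"
  shows "irreducible_space (subtopology X S) \<longleftrightarrow>
    S \<noteq> {} \<and> (\<forall>C D. closedin X C \<longrightarrow> closedin X D \<longrightarrow> S \<subseteq> C \<union> D \<longrightarrow> S \<subseteq> C \<or> S \<subseteq> D)"
proof -
  have top: "topspace (subtopology X S) = S" using assms by auto
  show ?thesis
  proof (intro iffI conjI allI impI)
    assume irr: "irreducible_space (subtopology X S)"
    then show "S \<noteq> {}" unfolding irreducible_space_def top by simp
    fix C D assume "closedin X C" "closedin X D" "S \<subseteq> C \<union> D"
    then have "closedin (subtopology X S) (C \<inter> S)" "closedin (subtopology X S) (D \<inter> S)" "S = (C \<inter> S) \<union> (D \<inter> S)"
      by (auto simp: closedin_subtopology)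
    then have "C \<inter> S = S \<or> D \<inter> S = S" using irr unfolding irreducible_space_def top by blast
    then show "S \<subseteq> C \<or> S \<subseteq> D" by blast
  next
    assume h: "S \<noteq> {} \<and> (\<forall>C D. closedin X C \<longrightarrow> closedin X D \<longrightarrow> S \<subseteq> C \<union> D \<longrightarrow> S \<subseteq> C \<or> S \<subseteq> D)"
    show "irreducible_space (subtopology X S)"
      unfolding irreducible_space_def top closedin_subtopology
    proof (intro conjI allI impI)
      show "S \<noteq> {}" using h by simp
      fix C D assume "(\<exists>T. closedin X T \<and> C = T \<inter> S) \<and> (\<exists>T. closedin X T \<and> D = T \<inter> S) \<and> S = C \<union> D"
      then obtain T U where "closedin X T" "C = T \<inter> S" "closedin X U" "D = U \<inter> S" "S \<subseteq> T \<union> U" by blast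
      then show "C = S \<or> D = S" using h by blast
    qed
  qed
qed

lemma irreducible_closure_of:
  assumes "S \<subseteq> topspace X" "irreducible_space (subtopology X S)"
  shows "irreducible_space (subtopology X (X closure_of S))"
proof -
  have S: "S \<noteq> {}" "\<And>C D. closedin X C \<Longrightarrow> closedin X D \<Longrightarrow> S \<subseteq> C \<union> D \<Longrightarrow> S \<subseteq> C \<or> S \<subseteq> D"
    using assms(2) unfolding irreducible_subtopology_iff[OF assms(1)] by auto
  have sub: "S \<subseteq> X closure_of S" using assms(1) by (rule closure_of_subset)
  show ?thesis
    unfolding irreducible_subtopology_iff[OF closure_of_subset_topspace]
  proof (intro conjI allI impI)
    show "X closure_of S \<noteq> {}" using S(1) sub by blast
    fix C D assume C: "closedin X C" and D: "closedin X D" and "X closure_of S \<subseteq> C \<union> D"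
    then have "S \<subseteq> C \<or> S \<subseteq> D" using S(2)[OF C D] sub by blast
    then show "X closure_of S \<subseteq> C \<or> X closure_of S \<subseteq> D"
      using closure_of_minimal C D by metis
  qed
qed

lemma irreducible_subset_Union:
  assumes irr: "irreducible_space (subtopology X S)" and S: "S \<subseteq> topspace X"
    and fin: "finite \<F>" "\<And>T. T \<in> \<F> \<Longrightarrow> closedin X T" and sub: "S \<subseteq> \<Union>\<F>"
  shows "\<exists>T\<in>\<F>. S \<subseteq> T"
  using fin sub
proof (induction \<F>)
  case empty
  then show ?case using irr unfolding irreducible_subtopology_iff[OF S] by auto
next
  case (insert T \<F>)
  then have "closedin X T" "closedin X (\<Union>\<F>)" "S \<subseteq> T \<union> \<Union>\<F>"
    by (auto intro: closedin_Union)
  then have "S \<subseteq> T \<or> S \<subseteq> \<Union>\<F>" using irr unfolding irreducible_subtopology_iff[OF S] by blast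
  then show ?case using insert by blast
qed

text \<open>An irreducible subset of a finite union of closed sets lies in one of them, so a maximal
  one is a member. Conversely the antichain condition makes each member maximal.\<close>

lemma irreducible_components_eq:
  assumes fin: "finite \<F>" and closed: "\<And>T. T \<in> \<F> \<Longrightarrow> closedin X T"
    and irr: "\<And>T. T \<in> \<F> \<Longrightarrow> irreducible_space (subtopology X T)"
    and antichain: "\<And>S T. S \<in> \<F> \<Longrightarrow> T \<in> \<F> \<Longrightarrow> S \<subseteq> T \<Longrightarrow> S = T"
  shows "irreducible_components (subtopology X (\<Union>\<F>)) = \<F>"
proof -
  have top: "topspace (subtopology X (\<Union>\<F>)) = \<Union>\<F>" using closed closedin_subset by fastforce
  have sub: "subtopology (subtopology X (\<Union>\<F>)) S = subtopology X S" if "S \<subseteq> \<Union>\<F>" for S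
    using that by (simp add: subtopology_subtopology Int_absorb1)
  have contained: "\<exists>T\<in>\<F>. S \<subseteq> T" if "S \<subseteq> \<Union>\<F>" "irreducible_space (subtopology X S)" for S
  proof (rule irreducible_subset_Union[OF that(2) _ fin closed that(1)])
    show "S \<subseteq> topspace X" using that(1) closed closedin_subset by fastforce
  qed
  show ?thesis
  proof (intro equalityI subsetI)
    fix S assume "S \<in> irreducible_components (subtopology X (\<Union>\<F>))"
    then have S: "S \<subseteq> \<Union>\<F>" "irreducible_space (subtopology X S)"
      "\<And>T. S \<subseteq> T \<Longrightarrow> T \<subseteq> \<Union>\<F> \<Longrightarrow> irreducible_space (subtopology X T) \<Longrightarrow> T = S"
      unfolding irreducible_components_def top using sub by auto
    obtain T where "T \<in> \<F>" "S \<subseteq> T" using contained[OF S(1,2)] by blast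
    then show "S \<in> \<F>" using S(3)[of T] irr by blast
  next
    fix S assume S: "S \<in> \<F>"
    have "T = S" if T: "S \<subseteq> T" "T \<subseteq> \<Union>\<F>" "irreducible_space (subtopology X T)" for T
      using contained[OF T(2,3)] T(1) antichain[OF S] by blast
    then show "S \<in> irreducible_components (subtopology X (\<Union>\<F>))"
      unfolding irreducible_components_def top mem_Collect_eq
    proof (intro conjI allI impI)
      show "S \<subseteq> \<Union>\<F>" using S by blast
      then show "irreducible_space (subtopology (subtopology X (\<Union>\<F>)) S)" using irr[OF S] by (simp only: sub)
      fix T assume "S \<subseteq> T \<and> T \<subseteq> \<Union>\<F> \<and> irreducible_space (subtopology (subtopology X (\<Union>\<F>)) T)"
      then show "T = S" using \<open>\<And>T. S \<subseteq> T \<Longrightarrow> T \<subseteq> \<Union>\<F> \<Longrightarrow> irreducible_space (subtopology X T) \<Longrightarrow> T = S\<close>[of T]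
        by (metis sub)
    qed
  qed
qed

lemma infinite_alg_closed: "infinite (UNIV :: 'k::alg_closed_field set)"
proof
  assume fin: "finite (UNIV :: 'k set)"
  define p where "p = (\<Prod>a\<in>(UNIV :: 'k set). [:- a, 1:])"
  have "degree p = (\<Sum>a\<in>(UNIV :: 'k set). 1)" unfolding p_def by (subst degree_prod_eq_sum_degree) auto
  also have "\<dots> > 0" using fin by (simp add: card_gt_0_iff)
  finally have "degree p > 0" .
  then have "degree (p + 1) > 0" by (simp add: degree_add_eq_left)
  then obtain x where "poly (p + 1) x = 0" using alg_closed_imp_poly_has_root by blast
  moreover have "poly p x = 0" unfolding p_def poly_prod using fin by (intro prod_zero) auto
  ultimately show False by simp
qed

lemma poly_eq_0_cofinite:
  fixes q :: "'k::alg_closed_field poly"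
  assumes "finite {x. poly q x \<noteq> 0}"
  shows "q = 0"
proof (rule ccontr)
  assume "q \<noteq> 0"
  then have "finite {x. poly q x = 0}" by (rule poly_roots_finite)
  with assms have "finite ({x. poly q x \<noteq> 0} \<union> {x. poly q x = 0})" by blast
  moreover have "{x. poly q x \<noteq> 0} \<union> {x. poly q x = 0} = UNIV" by blast
  ultimately show False using infinite_alg_closed by metis
qed

section \<open>Rational curves and the Zariski topology\<close>

text \<open>Nothing is required at the roots of \<open>d\<close>, where matrix inverses and
  quotients take meaningless default values.\<close>

definition rational_off :: "'k::field poly \<Rightarrow> ('k \<Rightarrow> 'k) \<Rightarrow> bool" where
  "rational_off d f \<longleftrightarrow> (\<exists>q k. \<forall>x. poly d x \<noteq> 0 \<longrightarrow> f x = poly q x / poly d x ^ k)"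

lemma rational_off_poly: "rational_off d (poly q)"
  unfolding rational_off_def by (intro exI[of _ q] exI[of _ 0]) simp

lemma rational_off_const [intro]: "rational_off d (\<lambda>_. c)"
  unfolding rational_off_def by (intro exI[of _ "[:c:]"] exI[of _ 0]) simp

lemma rational_off_add [intro]:
  assumes "rational_off d f" "rational_off d g"
  shows "rational_off d (\<lambda>x. f x + g x)"
proof -
  obtain p k q l where "\<And>x. poly d x \<noteq> 0 \<Longrightarrow> f x = poly p x / poly d x ^ k" "\<And>x. poly d x \<noteq> 0 \<Longrightarrow> g x = poly q x / poly d x ^ l"
    using assms unfolding rational_off_def by metis
  then show ?thesis
    unfolding rational_off_def
    by (intro exI[of _ "p * d ^ l + q * d ^ k"] exI[of _ "k + l"]) (simp add: add_divide_distrib power_add)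
qed

lemma rational_off_mult [intro]:
  assumes "rational_off d f" "rational_off d g"
  shows "rational_off d (\<lambda>x. f x * g x)"
proof -
  obtain p k q l where "\<And>x. poly d x \<noteq> 0 \<Longrightarrow> f x = poly p x / poly d x ^ k" "\<And>x. poly d x \<noteq> 0 \<Longrightarrow> g x = poly q x / poly d x ^ l"
    using assms unfolding rational_off_def by metis
  then show ?thesis
    unfolding rational_off_def by (intro exI[of _ "p * q"] exI[of _ "k + l"]) (simp add: power_add)
qed

lemma rational_off_sum [intro]: "(\<And>i. i \<in> I \<Longrightarrow> rational_off d (f i)) \<Longrightarrow> rational_off d (\<lambda>x. \<Sum>i\<in>I. f i x)"
  by (induction I rule: infinite_finite_induct) auto

lemma rational_off_prod [intro]: "(\<And>i. i \<in> I \<Longrightarrow> rational_off d (f i)) \<Longrightarrow> rational_off d (\<lambda>x. \<Prod>i\<in>I. f i x)"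
  by (induction I rule: infinite_finite_induct) auto

lemma rational_off_poly_functions:
  assumes "f \<in> poly_functions C" "\<And>c. c \<in> C \<Longrightarrow> rational_off d (\<lambda>x. c (\<gamma> x))"
  shows "rational_off d (\<lambda>x. f (\<gamma> x))"
  using assms by (induction rule: poly_functions.induct) auto

text \<open>An equation of the closure pulls back to a quotient with numerator \<open>q\<close>. The
  factor \<open>d\<close> absorbs the excluded points, so \<open>q * d\<close> vanishes at all but
  finitely many elements of an infinite field; hence \<open>q\<close> is 0 and the equation holds at
  \<open>x0\<close> too.\<close>

lemma curve_in_closure:
  fixes \<gamma> :: "'k::alg_closed_field \<Rightarrow> 'p"
  assumes \<gamma>: "\<And>c. c \<in> C \<Longrightarrow> rational_off d (\<lambda>x. c (\<gamma> x))" and d: "poly d x0 \<noteq> 0"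
    and fin: "finite {x. \<gamma> x \<notin> S}"
  shows "\<gamma> x0 \<in> zariski C closure_of S"
proof -
  obtain E where E: "E \<subseteq> poly_functions C" "zariski C closure_of S = zero_locus E"
    using closedin_closure_of[of "zariski C" S] unfolding closedin_zariski by blast
  have "f (\<gamma> x0) = 0" if f: "f \<in> E" for f
  proof -
    have vanish: "f (\<gamma> x) = 0" if "\<gamma> x \<in> S" for x
      using that f E closure_of_subset[of S "zariski C"] by (auto simp: zero_locus_def)
    obtain q k where q: "\<And>x. poly d x \<noteq> 0 \<Longrightarrow> f (\<gamma> x) = poly q x / poly d x ^ k"
      using rational_off_poly_functions[of f C d \<gamma>] \<gamma> f E(1) unfolding rational_off_def by blast
    have "poly (q * d) x = 0" if "\<gamma> x \<in> S" for x
      using q[of x] vanish[OF that] by (cases "poly d x = 0") auto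
    then have "{x. poly (q * d) x \<noteq> 0} \<subseteq> {x. \<gamma> x \<notin> S}" by blast
    then have "q * d = 0" using fin by (intro poly_eq_0_cofinite) (rule finite_subset)
    then have "q = 0" using d by auto
    then show ?thesis using q[OF d] by simp
  qed
  then show ?thesis unfolding E(2) zero_locus_def by blast
qed

text \<open>Suppose that \<open>s\<close> is outside \<open>A\<close> and \<open>t\<close> outside
  \<open>B\<close>, witnessed by equations \<open>f\<close> and \<open>g\<close>. Along a curve from
  \<open>s\<close> to \<open>t\<close> the product of \<open>f\<close> and \<open>g\<close> vanishes
  almost everywhere, and the polynomial ring is a domain, so one of them vanishes identically,
  against its value at an end point.\<close>

lemma irreducible_by_curves:
  fixes S :: "'p set" and C :: "('p \<Rightarrow> 'k::alg_closed_field) set"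
  assumes "S \<noteq> {}"
    and curves: "\<And>s t. s \<in> S \<Longrightarrow> t \<in> S \<Longrightarrow> \<exists>\<gamma> d. \<gamma> 0 = s \<and> \<gamma> 1 = t \<and> poly d 0 \<noteq> 0 \<and> poly d 1 \<noteq> 0 \<and>
      (\<forall>c\<in>C. rational_off d (\<lambda>x. c (\<gamma> x))) \<and> finite {x. \<gamma> x \<notin> S}"
  shows "irreducible_space (subtopology (zariski C) S)"
proof -
  have "S \<subseteq> A \<or> S \<subseteq> B" if A: "closedin (zariski C) A" and B: "closedin (zariski C) B" and AB: "S \<subseteq> A \<union> B" for A B
  proof (rule ccontr)
    assume "\<not> ?thesis"
    then obtain s t where s: "s \<in> S" "s \<notin> A" and t: "t \<in> S" "t \<notin> B" by blast
    obtain f g where f: "f \<in> poly_functions C" "f s \<noteq> 0" "\<And>u. u \<in> A \<Longrightarrow> f u = 0"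
      and g: "g \<in> poly_functions C" "g t \<noteq> 0" "\<And>u. u \<in> B \<Longrightarrow> g u = 0"
      using A B s(2) t(2) unfolding closedin_zariski zero_locus_def by blast
    obtain \<gamma> d where \<gamma>: "\<gamma> 0 = s" "\<gamma> 1 = t" "poly d 0 \<noteq> 0" "poly d 1 \<noteq> 0" "\<And>c. c \<in> C \<Longrightarrow> rational_off d (\<lambda>x. c (\<gamma> x))"
      "finite {x. \<gamma> x \<notin> S}" using curves[OF s(1) t(1)] by blast
    obtain p k where p: "\<And>x. poly d x \<noteq> 0 \<Longrightarrow> f (\<gamma> x) = poly p x / poly d x ^ k"
      using rational_off_poly_functions[OF f(1), of d \<gamma>] \<gamma>(5) unfolding rational_off_def by blast
    obtain q l where q: "\<And>x. poly d x \<noteq> 0 \<Longrightarrow> g (\<gamma> x) = poly q x / poly d x ^ l"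
      using rational_off_poly_functions[OF g(1), of d \<gamma>] \<gamma>(5) unfolding rational_off_def by blast
    have "poly (p * q * d) x = 0" if "\<gamma> x \<in> S" for x
      using p[of x] q[of x] f(3)[of "\<gamma> x"] g(3)[of "\<gamma> x"] that AB by (cases "poly d x = 0") auto
    then have "{x. poly (p * q * d) x \<noteq> 0} \<subseteq> {x. \<gamma> x \<notin> S}" by blast
    then have "p * q * d = 0" using \<gamma>(6) by (intro poly_eq_0_cofinite) (rule finite_subset)
    then have "p = 0 \<or> q = 0" using \<gamma>(3) by auto
    then show False using p[OF \<gamma>(3)] q[OF \<gamma>(4)] \<gamma>(1,2) f(2) g(2) by auto
  qed
  then show ?thesis using assms(1) by (subst irreducible_subtopology_iff) auto
qed

section \<open>Matrices depending rationally on a parameter\<close>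

definition matrix_rational_off :: "'k::field poly \<Rightarrow> ('k \<Rightarrow> 'k^'m^'n) \<Rightarrow> bool" where
  "matrix_rational_off d M \<longleftrightarrow> (\<forall>i j. rational_off d (\<lambda>x. M x $ i $ j))"

lemma matrix_rational_off_mult:
  "matrix_rational_off d M \<Longrightarrow> matrix_rational_off d N \<Longrightarrow> matrix_rational_off d (\<lambda>x. M x ** N x)"
  unfolding matrix_rational_off_def matrix_matrix_mult_def
  by (simp, intro allI rational_off_sum rational_off_mult, auto)

lemma matrix_rational_off_transpose:
  "matrix_rational_off d M \<Longrightarrow> matrix_rational_off d (\<lambda>x. transpose (M x))"
  unfolding matrix_rational_off_def transpose_def by auto

definition matrix_line :: "'k::field^'m^'n \<Rightarrow> 'k^'m^'n \<Rightarrow> 'k \<Rightarrow> 'k^'m^'n" where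
  "matrix_line A B x = (\<chi> i j. (1 - x) * A $ i $ j + x * B $ i $ j)"

lemma matrix_line_0 [simp]: "matrix_line A B 0 = A" and matrix_line_1 [simp]: "matrix_line A B 1 = B"
  by (simp_all add: matrix_line_def vec_eq_iff)

lemma matrix_line_entry: "matrix_line A B x $ i $ j = poly [:A $ i $ j, B $ i $ j - A $ i $ j:] x"
  by (simp add: matrix_line_def algebra_simps)

lemma matrix_rational_off_line: "matrix_rational_off d (matrix_line A B)"
  unfolding matrix_rational_off_def matrix_line_entry using rational_off_poly by blast

lemma rational_off_det: "matrix_rational_off d M \<Longrightarrow> rational_off d (\<lambda>x. det (M x))"
  unfolding matrix_rational_off_def det_def by (intro rational_off_sum rational_off_mult rational_off_prod) auto

lemma rational_off_1: "rational_off 1 f \<longleftrightarrow> (\<exists>q. f = poly q)"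
  unfolding rational_off_def by (auto simp: fun_eq_iff)

lemma poly_det_line: "\<exists>d. \<forall>x. poly d x = det (matrix_line A B x)"
  using rational_off_det[OF matrix_rational_off_line, of 1 A B] unfolding rational_off_1 by metis

lemma matrix_inv_mult:
  fixes A :: "'k::field^'n^'n"
  assumes "invertible A"
  shows "A ** matrix_inv A = mat 1" "matrix_inv A ** A = mat 1"
  using someI_ex[OF assms[unfolded invertible_def]] unfolding matrix_inv_def by auto

lemma matrix_inv_cramer:
  fixes A :: "'k::field^'n^'n"
  assumes "det A \<noteq> 0"
  shows "matrix_inv A $ k $ l = det (\<chi> i j. if j = k then mat 1 $ i $ l else A $ i $ j) / det A"
proof -
  have "A ** matrix_inv A = mat 1" using assms by (simp add: matrix_inv_mult invertible_det_nz)
  then have "A *v column l (matrix_inv A) = column l (mat 1)"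
    by (simp add: vec_eq_iff matrix_vector_mult_def matrix_matrix_mult_def column_def)
  then have "column l (matrix_inv A) = (\<chi> k. det (\<chi> i j. if j = k then column l (mat 1) $ i else A $ i $ j) / det A)"
    using cramer[OF assms] by blast
  then have "column l (matrix_inv A) $ k = det (\<chi> i j. if j = k then column l (mat 1) $ i else A $ i $ j) / det A"
    by simp
  then show ?thesis by (simp add: column_def cong: if_cong)
qed

text \<open>By Cramer's rule the numerators are determinants of matrices with polynomial entries, so
  the determinant of the line is the only denominator.\<close>

lemma matrix_rational_off_inv_line:
  assumes d: "\<And>x. poly d x = det (matrix_line A B x)"
  shows "matrix_rational_off d (\<lambda>x. matrix_inv (matrix_line A B x))"
  unfolding matrix_rational_off_def
proof (intro allI)
  fix k l
  have "matrix_rational_off 1 (\<lambda>x. \<chi> i j. if j = k then mat 1 $ i $ l else matrix_line A B x $ i $ j)"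
    using matrix_rational_off_line[of 1 A B] unfolding matrix_rational_off_def
    by (simp, intro allI, rename_tac i j, case_tac "j = k") (simp_all add: rational_off_const)
  from rational_off_det[OF this] obtain q
    where "(\<lambda>x. det (\<chi> i j. if j = k then mat 1 $ i $ l else matrix_line A B x $ i $ j)) = poly q"
    unfolding rational_off_1 by blast
  then have q: "det (\<chi> i j. if j = k then mat 1 $ i $ l else matrix_line A B x $ i $ j) = poly q x" for x
    by (rule fun_cong)
  show "rational_off d (\<lambda>x. matrix_inv (matrix_line A B x) $ k $ l)"
    unfolding rational_off_def by (intro exI[of _ q] exI[of _ 1]) (simp add: d matrix_inv_cramer q)
qed

section \<open>Irreducible matrix algebras\<close>

abbreviation dot :: "'k::field^'n \<Rightarrow> 'k^'n \<Rightarrow> 'k" where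
  "dot x y \<equiv> (\<Sum>i\<in>UNIV. x $ i * y $ i)"

lemma dot_matrix_vector: "dot (a *v x) y = dot x (transpose a *v y)"
proof -
  have "dot (a *v x) y = (\<Sum>i\<in>UNIV. \<Sum>j\<in>UNIV. a $ i $ j * x $ j * y $ i)"
    by (simp add: matrix_vector_mult_def sum_distrib_right)
  also have "\<dots> = (\<Sum>j\<in>UNIV. \<Sum>i\<in>UNIV. a $ i $ j * x $ j * y $ i)" by (rule sum.swap)
  also have "\<dots> = dot x (transpose a *v y)"
    by (simp add: matrix_vector_mult_def sum_distrib_left transpose_def mult_ac)
  finally show ?thesis .
qed

lemma subspace_separation:
  fixes V :: "('k::field^'n) set"
  assumes V: "vec.subspace V" and x: "x \<notin> V"
  shows "\<exists>f\<in>perp V. dot f x \<noteq> 0"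
proof -
  obtain B where B: "B \<subseteq> V" "vec.independent B" "V \<subseteq> vec.span B"
    using vec.basis_exists by metis
  then have span: "vec.span B = V" using V vec.span_minimal by blast
  have ind: "vec.independent (insert x B)" using B(2) x span by (intro vec.independent_insertI) auto
  obtain g where g: "Vector_Spaces.linear (*s) (*s) g" "\<forall>b\<in>insert x B. g b = (if b = x then x else 0)"
    using vec.linear_independent_extend[OF ind, of "\<lambda>b. if b = x then x else 0"] by blast
  have gx: "g x = x" using g(2) by simp
  have gB: "g b = 0" if "b \<in> B" for b using g(2) that x B(1) by auto
  have g0: "g v = 0" if "v \<in> V" for v
  proof -
    have "v \<in> vec.span B" using that span by simp
    then show ?thesis
    proof (induction rule: vec.span_induct_alt)
      case base
      then show ?case using g(1) by (simp add: vec.linear_0)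
    next
      case (step c b y)
      then show ?case using gB[of b] g(1) by (simp add: vec.linear_add vec.linear_scale)
    qed
  qed
  have "x \<noteq> 0" using x vec.subspace_0[OF V] by auto
  then obtain k where k: "x $ k \<noteq> 0" by (auto simp: vec_eq_iff)
  define f where "f = row k (matrix g)"
  have f: "dot f v = g v $ k" for v
  proof -
    have "g v = matrix g *v v" using g(1) by (simp add: matrix_works)
    then have "g v $ k = (matrix g *v v) $ k" by simp
    then show ?thesis by (simp add: f_def row_def matrix_vector_mult_def)
  qed
  show ?thesis
    using f g0 gx k by (intro bexI[of _ f]) (auto simp: perp_def)
qed

text \<open>Moves the condition on \<open>b\<close> from \<open>perp V\<close> to \<open>V\<close>
  itself, so that the members of \<open>set_X\<close> become tuples for which one family of
  matrices, the first components and the transposed second ones, has a common invariant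
  subspace.\<close>

lemma stabilizes_perp_iff:
  assumes V: "vec.subspace V"
  shows "stabilizes b (perp V) \<longleftrightarrow> stabilizes (transpose b) V"
proof
  assume b: "stabilizes b (perp V)"
  have "transpose b *v y \<in> V" if y: "y \<in> V" for y
  proof (rule ccontr)
    assume "transpose b *v y \<notin> V"
    then obtain f where f: "f \<in> perp V" "dot f (transpose b *v y) \<noteq> 0" using subspace_separation[OF V] by blast
    then have "b *v f \<in> perp V" using b by (auto simp: stabilizes_def)
    then have "dot (b *v f) y = 0" using y by (simp add: perp_def)
    then show False using f(2) by (simp add: dot_matrix_vector)
  qed
  then show "stabilizes (transpose b) V" by (auto simp: stabilizes_def)
next
  assume "stabilizes (transpose b) V"
  then show "stabilizes b (perp V)" by (auto simp: stabilizes_def perp_def dot_matrix_vector)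
qed

section \<open>Eigenvectors in invariant subspaces\<close>

text \<open>The vector \<open>q(a) v\<close>. The powers are iterates of the map on vectors, because
  the instance \<open>*\<close> on the matrix type is entrywise.\<close>

definition poly_action :: "'k::field^'n^'n \<Rightarrow> 'k poly \<Rightarrow> 'k^'n \<Rightarrow> 'k^'n" where
  "poly_action a q v = (\<Sum>i\<le>degree q. coeff q i *s (((*v) a ^^ i) v))"

lemma poly_action_bound:
  assumes "degree q \<le> N"
  shows "poly_action a q v = (\<Sum>i\<le>N. coeff q i *s (((*v) a ^^ i) v))"
  unfolding poly_action_def
  by (rule sum.mono_neutral_left) (use assms in \<open>auto simp: coeff_eq_0\<close>)

lemma poly_action_linear_factor:
  "poly_action a ([:- \<xi>, 1:] * q) v = a *v poly_action a q v - \<xi> *s poly_action a q v"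
proof -
  let ?N = "Suc (degree q)" and ?w = "\<lambda>i. ((*v) a ^^ i) v"
  have eq: "[:- \<xi>, 1:] * q = pCons 0 q - smult \<xi> q" by simp
  have "degree ([:- \<xi>, 1:] * q) \<le> ?N"
    using degree_mult_le[of "[:- \<xi>, 1:]" q] by simp
  then have "poly_action a ([:- \<xi>, 1:] * q) v = (\<Sum>i\<le>?N. (coeff (pCons 0 q) i - \<xi> * coeff q i) *s ?w i)"
    by (subst poly_action_bound[of _ ?N]) (simp_all add: eq)
  also have "\<dots> = (\<Sum>i\<le>?N. coeff (pCons 0 q) i *s ?w i) - \<xi> *s (\<Sum>i\<le>?N. coeff q i *s ?w i)"
    by (simp add: sum_subtractf[symmetric] vec.scale_sum_right vec.scale_left_diff_distrib del: sum.atMost_Suc)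
  also have "(\<Sum>i\<le>?N. coeff (pCons 0 q) i *s ?w i) = (\<Sum>i\<le>degree q. coeff q i *s ?w (Suc i))"
    by (subst sum.atMost_Suc_shift) simp
  also have "\<dots> = a *v (\<Sum>i\<le>degree q. coeff q i *s ?w i)"
    by (simp add: vec.sum vector_scalar_commute)
  also have "(\<Sum>i\<le>?N. coeff q i *s ?w i) = poly_action a q v" by (subst poly_action_bound[of _ ?N]) simp_all
  finally show ?thesis by (simp add: poly_action_def)
qed

lemma poly_action_in_subspace:
  assumes "vec.subspace V" "stabilizes a V" "v \<in> V"
  shows "poly_action a q v \<in> V"
proof -
  have "((*v) a ^^ i) v \<in> V" for i
    using assms(2,3) by (induction i) (auto simp: stabilizes_def)
  then show ?thesis
    unfolding poly_action_def using assms(1) by (intro vec.subspace_sum vec.subspace_scale) auto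
qed

lemma annihilating_poly_exists:
  fixes a :: "'k::field^'n^'n"
  shows "\<exists>q. q \<noteq> 0 \<and> poly_action a q v = 0"
proof -
  let ?w = "\<lambda>i. ((*v) a ^^ i) v" and ?N = "CARD('n)"
  have ex: "\<exists>q. q \<noteq> 0 \<and> poly_action a q v = 0"
    if c: "(\<Sum>i\<le>?N. c i *s ?w i) = 0" and k: "k \<le> ?N" "c k \<noteq> 0" for c k
  proof -
    define q where "q = (\<Sum>i\<le>?N. monom (c i) i)"
    have coeff: "coeff q i = (if i \<le> ?N then c i else 0)" for i
      by (simp add: q_def coeff_sum coeff_monom)
    then have "degree q \<le> ?N" by (intro degree_le) auto
    then have "poly_action a q v = (\<Sum>i\<le>?N. c i *s ?w i)"
      by (subst poly_action_bound[of _ ?N]) (auto simp: coeff)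
    moreover have "q \<noteq> 0" using coeff[of k] k by auto
    ultimately show ?thesis using c by auto
  qed
  show ?thesis
  \<comment> \<open>Linear dependence of a set does not see repeated vectors, so a repetition among
    the iterates is treated apart; it gives the difference of two monomials.\<close>
  proof (cases "inj_on ?w {..?N}")
    case False
    then obtain i j where ij: "i \<le> ?N" "j \<le> ?N" "i \<noteq> j" "?w i = ?w j" by (auto simp: inj_on_def)
    let ?c = "\<lambda>k. (if k = i then 1 else 0) - (if k = j then 1 else 0) :: 'k"
    have "?c k *s ?w k = (if k = i then ?w k else 0) - (if k = j then ?w k else 0)" for k by auto
    then have "(\<Sum>k\<le>?N. ?c k *s ?w k) = ?w i - ?w j"
      using ij(1,2) by (simp add: sum_subtractf del: if_split)
    then show ?thesis using ij by (intro ex[of ?c i]) auto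
  next
    case True
    let ?S = "?w ` {..?N}"
    have "card ?S = Suc ?N" using True by (simp add: card_image)
    then have "card ?S > vec.dim ?S"
      using vec.dim_subset_UNIV[of ?S] dim_subset_UNIV_cart_gen[of ?S] by linarith
    then have "vec.dependent ?S" by (intro vec.dependent_biggerset_general) simp
    then obtain u x where u: "x \<in> ?S" "u x \<noteq> 0" "(\<Sum>x\<in>?S. u x *s x) = 0"
      using vec.dependent_finite[of ?S] by auto
    then obtain k where k: "k \<le> ?N" "x = ?w k" by auto
    have "(\<Sum>i\<le>?N. u (?w i) *s ?w i) = 0" using u(3) True by (simp add: sum.reindex)
    then show ?thesis using u(2) k by (intro ex[of "\<lambda>i. u (?w i)" k]) auto
  qed
qed

text \<open>Linear factors are split off an annihilating polynomial of \<open>v\<close> one at a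
  time. Before the product becomes the constant that no longer kills \<open>v\<close>, some factor
  maps a nonzero vector of \<open>V\<close> to 0.\<close>

lemma eigenvector_exists:
  fixes a :: "'k::alg_closed_field^'n^'n"
  assumes V: "vec.subspace V" "stabilizes a V" and v: "v \<in> V" "v \<noteq> 0"
  shows "\<exists>w\<in>V. w \<noteq> 0 \<and> (\<exists>\<xi>. a *v w = \<xi> *s w)"
proof -
  obtain q where "q \<noteq> 0" "poly_action a q v = 0" using annihilating_poly_exists by blast
  then show ?thesis
  proof (induction "degree q" arbitrary: q rule: less_induct)
    case less
    show ?case
    proof (cases "degree q = 0")
      case True
      then obtain c where "q = [:c:]" using degree_eq_zeroE by blast
      then show ?thesis using less.prems v(2) by (simp add: poly_action_def)
    next
      case False
      then obtain \<xi> where "poly q \<xi> = 0" using alg_closed_imp_poly_has_root[of q] by auto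
      then obtain r where r: "q = [:- \<xi>, 1:] * r" by (auto simp: poly_eq_0_iff_dvd dvd_def)
      let ?w = "poly_action a r v"
      have "?w \<in> V" using V v(1) by (rule poly_action_in_subspace)
      moreover have "a *v ?w = \<xi> *s ?w"
        using less.prems(2) unfolding r poly_action_linear_factor by simp
      moreover have r0: "r \<noteq> 0" using less.prems(1) r by auto
      have "degree q = Suc (degree r)" unfolding r using r0 by (subst degree_mult_eq) auto
      ultimately show ?thesis using less.hyps[of r] r0 by (cases "?w = 0") auto
    qed
  qed
qed

text \<open>Accounts for the drop of rank in Burnside's theorem: in a basis of \<open>V\<close>
  through \<open>w\<close>, the images of the other basis vectors already span.\<close>

lemma dim_image_less:
  fixes f :: "'k::field^'n \<Rightarrow> 'k^'n"
  assumes f: "Vector_Spaces.linear (*s) (*s) f" and V: "vec.subspace V" and w: "w \<in> V" "w \<noteq> 0" "f w = 0"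
  shows "vec.dim (f ` V) < vec.dim V"
proof -
  have "vec.independent {w}" using w(2) by simp
  then obtain B where B: "{w} \<subseteq> B" "B \<subseteq> V" "vec.independent B" "V \<subseteq> vec.span B"
    using vec.maximal_independent_subset_extend[of "{w}" V] w(1) by auto
  have fin: "finite B" using B(3) by (rule vec.finiteI_independent)
  have card: "card B = vec.dim V" using vec.basis_card_eq_dim[OF B(2,4,3)] .
  have "f ` V \<subseteq> vec.span (f ` (B - {w}))"
  proof clarify
    fix x assume "x \<in> V"
    then have "x \<in> vec.span B" using B(4) by blast
    then show "f x \<in> vec.span (f ` (B - {w}))"
    proof (induction rule: vec.span_induct_alt)
      case base
      then show ?case using f by (simp add: vec.linear_0 vec.span_zero)
    next
      case (step c b y)
      have "f b \<in> vec.span (f ` (B - {w}))"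
        using step(1) w(3) by (cases "b = w") (auto simp: vec.span_zero intro: vec.span_base)
      then show ?case using step(2) f by (simp add: vec.linear_add vec.linear_scale vec.span_add vec.span_scale)
    qed
  qed
  then have "vec.dim (f ` V) \<le> card (f ` (B - {w}))" by (rule vec.dim_le_card) (use fin in simp)
  also have "\<dots> \<le> card (B - {w})" using fin by (intro card_image_le) simp
  also have "\<dots> < card B" using fin B(1) by (intro card_Diff1_less) auto
  finally show ?thesis using card by simp
qed

section \<open>Burnside's theorem and Schur's lemma\<close>

definition irreducible_action :: "('k::field^'n^'n) set \<Rightarrow> bool" where
  "irreducible_action B \<longleftrightarrow> (\<forall>V. vec.subspace V \<longrightarrow> (\<forall>a\<in>B. stabilizes a V) \<longrightarrow> V = {0} \<or> V = UNIV)"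

lemma mat_vector_mult [simp]: "mat c *v x = c *s (x :: 'k::field^'n)"
  by (simp add: vec_eq_iff matrix_vector_mult_def mat_def if_distrib[where f="\<lambda>a. a * _"] cong: if_cong)

definition matrix_unit :: "'n \<Rightarrow> 'm \<Rightarrow> 'k::field^'m^'n" where
  "matrix_unit k l = (\<chi> i j. if i = k \<and> j = l then 1 else 0)"

lemma matrix_unit_mult_vec: "matrix_unit k l *v x = x $ l *s axis k 1"
  by (simp add: vec_eq_iff matrix_vector_mult_def matrix_unit_def axis_def if_distrib[where f="\<lambda>a. a * _"] cong: if_cong)

lemma matrix_eq_sum_units:
  fixes M :: "'k::field^'n^'n"
  shows "M = (\<Sum>k\<in>UNIV. \<Sum>l\<in>UNIV. mat (M $ k $ l) ** matrix_unit k l)"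
proof -
  have "(\<Sum>k\<in>UNIV. \<Sum>l\<in>UNIV. (mat (M $ k $ l) ** matrix_unit k l :: 'k^'n^'n)) $ i $ j =
      (\<Sum>k\<in>UNIV. \<Sum>l\<in>UNIV. if k = i then if l = j then M $ k $ l else 0 else 0)" for i j
    unfolding sum_component
    by (intro sum.cong refl)
       (auto simp: matrix_matrix_mult_def mat_def matrix_unit_def if_distrib[where f="\<lambda>a. a * _"] cong: if_cong)
  moreover have "\<dots> i j = (\<Sum>k\<in>UNIV. if k = i then \<Sum>l\<in>UNIV. if l = j then M $ k $ l else 0 else 0)" for i j
    by (intro sum.cong refl) simp
  ultimately show ?thesis by (simp add: vec_eq_iff)
qed

text \<open>A nonzero element of least rank has rank one, that is, it is the product of a column
  \<open>?u\<close> and a row \<open>f\<close>. Irreducibility moves \<open>?u\<close> to every unit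
  vector from the left and \<open>f\<close> to every unit covector from the right, which yields all
  matrix units.\<close>

theorem burnside:
  fixes B :: "('k::alg_closed_field^'n^'n) set"
  assumes scalar: "\<And>c. mat c \<in> B" and add: "\<And>x y. x \<in> B \<Longrightarrow> y \<in> B \<Longrightarrow> x + y \<in> B"
    and mult: "\<And>x y. x \<in> B \<Longrightarrow> y \<in> B \<Longrightarrow> x ** y \<in> B" and irr: "irreducible_action B"
  shows "B = UNIV"
proof -
  have transitive: "\<exists>A\<in>B. A *v x = y" if x: "x \<noteq> 0" for x y
  proof -
    let ?V = "{A *v x |A. A \<in> B}"
    have "vec.subspace ?V"
      unfolding vec.subspace_def
    proof (intro conjI ballI allI)
      show "0 \<in> ?V" using scalar[of 0] by (force intro!: exI[of _ "mat 0"])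
      show "u + v \<in> ?V" if "u \<in> ?V" "v \<in> ?V" for u v
        using that add by (auto, metis matrix_vector_mult_add_rdistrib)
      show "c *s u \<in> ?V" if "u \<in> ?V" for c u
        using that mult[OF scalar[of c]] by (auto, metis mat_vector_mult matrix_vector_mul_assoc)
    qed
    moreover have "\<forall>a\<in>B. stabilizes a ?V"
      using mult by (auto simp: stabilizes_def, metis matrix_vector_mul_assoc)
    moreover have "x \<in> ?V" using scalar[of 1] by (force intro!: exI[of _ "mat 1"])
    then have "?V \<noteq> {0}" using x by auto
    ultimately have "?V = UNIV" using irr unfolding irreducible_action_def by blast
    then have "y \<in> ?V" by simp
    then show ?thesis by blast
  qed
  have "\<exists>T. T \<in> B \<and> T \<noteq> 0"
    using scalar[of 1] by (intro exI[of _ "mat 1"]) (auto simp: vec_eq_iff mat_def)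
  from ex_has_least_nat[of "\<lambda>T. T \<in> B \<and> T \<noteq> 0" _ "\<lambda>T. vec.dim (range ((*v) T))"] this
  obtain T where T: "T \<in> B" "T \<noteq> 0"
    and min: "\<And>S. S \<in> B \<Longrightarrow> S \<noteq> 0 \<Longrightarrow> vec.dim (range ((*v) T)) \<le> vec.dim (range ((*v) S))" by blast
  obtain x1 where x1: "T *v x1 \<noteq> 0"
    using T(2) by (metis matrix_eq matrix_vector_mult_0)
  let ?u = "T *v x1" and ?R = "range ((*v) T)"
  have R: "vec.subspace ?R" by (intro vec.subspace_UNIV vec.linear_subspace_image[OF matrix_vector_mul_linear_gen])
  have rank_one: "\<exists>c. T *v x2 = c *s ?u" for x2
  proof (rule ccontr)
    assume no: "\<nexists>c. T *v x2 = c *s ?u"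
    obtain A where A: "A \<in> B" "A *v ?u = x2" using transitive[OF x1] by blast
    have "stabilizes (T ** A) ?R"
      by (auto simp: stabilizes_def matrix_vector_mul_assoc[symmetric])
    then obtain w \<xi> where w: "w \<in> ?R" "w \<noteq> 0" "(T ** A) *v w = \<xi> *s w"
      using eigenvector_exists[OF R] x1 by blast
    \<comment> \<open>\<open>S\<close> kills the eigenvector \<open>w\<close> in the range of
      \<open>T\<close>, so \<open>S ** T\<close> has smaller rank than \<open>T\<close>. It is not
      zero: \<open>x1\<close> goes to \<open>T *v x2 - \<xi> *s ?u\<close>, and
      \<open>T *v x2\<close> is no multiple of \<open>?u\<close>.\<close>
    define S where "S = T ** A + mat (- \<xi>)"
    have "S ** T \<in> B" unfolding S_def using A T(1) scalar add mult by metis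
    moreover have "(S ** T) *v x1 = T *v x2 - \<xi> *s ?u"
      using A(2) by (simp add: S_def matrix_vector_mul_assoc[symmetric] matrix_vector_mult_add_rdistrib)
    then have "S ** T \<noteq> 0" using no by (metis eq_iff_diff_eq_0 matrix_vector_mult_0)
    moreover have "vec.dim ((*v) S ` ?R) < vec.dim ?R"
      using R w by (intro dim_image_less[of _ _ w]) (auto simp: S_def matrix_vector_mult_add_rdistrib)
    moreover have "(*v) S ` ?R = range ((*v) (S ** T))" by (auto simp: matrix_vector_mul_assoc[symmetric])
    ultimately show False using min[of "S ** T"] by simp
  qed
  obtain m where m: "?u $ m \<noteq> 0" using x1 by (auto simp: vec_eq_iff)
  define f where "f = (1 / ?u $ m) *s row m T"
  have Tf: "T *v x = dot f x *s ?u" for x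
  proof -
    obtain c where c: "T *v x = c *s ?u" using rank_one by blast
    then have "(T *v x) $ m = c * ?u $ m" by simp
    moreover have "dot f x = (T *v x) $ m / ?u $ m"
      by (simp add: f_def row_def matrix_vector_mult_def sum_divide_distrib)
    ultimately show ?thesis using m c by simp
  qed
  \<comment> \<open>The transposed action on \<open>f\<close> is transitive by duality: a vector
    \<open>g\<close> annihilating a proper orbit would give \<open>dot f (A *v g) = 0\<close> for
    all \<open>A\<close>, although some \<open>A\<close> takes \<open>g\<close> to
    \<open>x1\<close>, where \<open>f\<close> does not vanish.\<close>
  have cotransitive: "\<exists>A\<in>B. transpose A *v f = y" for y
  proof -
    let ?W = "{transpose A *v f |A. A \<in> B}"
    have "vec.subspace ?W"
      unfolding vec.subspace_def
    proof (intro conjI ballI allI)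
      show "0 \<in> ?W" using scalar[of 0] by (force intro!: exI[of _ "mat 0"] simp: transpose_mat)
      show "u + v \<in> ?W" if uv: "u \<in> ?W" "v \<in> ?W" for u v
      proof -
        obtain A A' where A: "A \<in> B" "A' \<in> B" "u = transpose A *v f" "v = transpose A' *v f" using uv by blast
        have "u + v = transpose (A + A') *v f"
          by (simp add: A matrix_vector_mult_add_rdistrib[symmetric] transpose_def vec_eq_iff matrix_vector_mult_def
              sum.distrib[symmetric] algebra_simps)
        then show ?thesis using add A by blast
      qed
      show "c *s u \<in> ?W" if u: "u \<in> ?W" for c u
      proof -
        obtain A where A: "A \<in> B" "u = transpose A *v f" using u by blast
        have "c *s u = transpose (A ** mat c) *v f"
          by (simp add: A matrix_transpose_mul transpose_mat matrix_vector_mul_assoc[symmetric])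
        then show ?thesis using mult A scalar by blast
      qed
    qed
    moreover have False if nW: "?W \<noteq> UNIV" and sW: "vec.subspace ?W"
    proof -
      obtain z where "z \<notin> ?W" using nW by blast
      then obtain g where g: "g \<in> perp ?W" "dot g z \<noteq> 0" using subspace_separation[OF sW] by blast
      have "g \<noteq> 0" using g(2) by auto
      have "dot f (A *v g) = 0" if "A \<in> B" for A
      proof -
        have "dot (A *v g) f = 0" using g(1) that unfolding dot_matrix_vector perp_def by blast
        then show ?thesis by (simp add: mult.commute)
      qed
      moreover obtain A where "A \<in> B" "A *v g = x1" using transitive[OF \<open>g \<noteq> 0\<close>] by blast
      ultimately have "?u = 0" using Tf[of x1] by auto
      then show False using x1 by simp
    qed
    ultimately have "?W = UNIV" by blast
    then have "y \<in> ?W" by simp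
    then show ?thesis by blast
  qed
  have unit: "matrix_unit k l \<in> B" for k l
  proof -
    obtain A where A: "A \<in> B" "A *v ?u = axis k 1" using transitive[OF x1] by blast
    obtain A' where A': "A' \<in> B" "transpose A' *v f = axis l 1" using cotransitive by blast
    have "(A ** T ** A') *v x = matrix_unit k l *v x" for x
    proof -
      have "dot f (A' *v x) = dot (A' *v x) f" by (simp add: mult.commute)
      also have "\<dots> = x $ l"
        unfolding dot_matrix_vector A'(2) by (simp add: axis_def if_distrib cong: if_cong)
      finally have fA: "dot f (A' *v x) = x $ l" .
      have "(A ** T ** A') *v x = A *v (T *v (A' *v x))" by (simp add: matrix_vector_mul_assoc matrix_mul_assoc)
      also have "\<dots> = x $ l *s axis k 1" unfolding Tf[of "A' *v x"] fA by (simp add: vector_scalar_commute A(2))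
      finally show ?thesis by (simp add: matrix_unit_mult_vec)
    qed
    then have "A ** T ** A' = matrix_unit k l" by (simp add: matrix_eq)
    then show ?thesis using A(1) A'(1) T(1) mult by metis
  qed
  have sum: "sum h I \<in> B" if "\<And>i. i \<in> I \<Longrightarrow> h i \<in> B" for h :: "'n \<Rightarrow> 'k^'n^'n" and I
    using that scalar[of 0] add by (induction I rule: infinite_finite_induct) (auto simp: mat_0)
  have "M \<in> B" for M
    by (subst matrix_eq_sum_units) (intro sum mult scalar unit)
  then show ?thesis by blast
qed

lemma mat_matrix_mult: "mat c ** a = (\<chi> i j. c * a $ i $ j)"
  by (simp add: vec_eq_iff matrix_matrix_mult_def mat_def if_distrib[where f="\<lambda>a. a * _"] cong: if_cong)

lemma mat_commute: "z ** (mat c ** x) = mat c ** (z ** (x :: 'k::field^'m^'n))"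
  unfolding mat_matrix_mult by (simp add: vec_eq_iff matrix_matrix_mult_def sum_distrib_left mult_ac)

lemma irreducible_action_mono: "irreducible_action A \<Longrightarrow> A \<subseteq> B \<Longrightarrow> irreducible_action B"
  unfolding irreducible_action_def by blast

lemma schur:
  fixes q :: "'k::alg_closed_field^'n^'n"
  assumes irr: "irreducible_action B" and comm: "\<And>x. x \<in> B \<Longrightarrow> q ** x = x ** q"
  shows "\<exists>c. q = mat c"
proof -
  have "axis undefined 1 \<noteq> (0 :: 'k^'n)" by (simp add: axis_eq_0_iff)
  then obtain w \<xi> where w: "w \<noteq> 0" "q *v w = \<xi> *s w"
    using eigenvector_exists[of UNIV q "axis undefined 1"] by (auto simp: stabilizes_def)
  let ?V = "{v. q *v v = \<xi> *s v}"
  have "vec.subspace ?V"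
    by (auto simp: vec.subspace_def matrix_vector_right_distrib vector_scalar_commute vec.scale_right_distrib mult.commute)
  moreover have "stabilizes x ?V" if "x \<in> B" for x
  proof -
    have "q *v (x *v v) = \<xi> *s (x *v v)" if "q *v v = \<xi> *s v" for v
      using that by (metis comm[OF \<open>x \<in> B\<close>] matrix_vector_mul_assoc vector_scalar_commute)
    then show ?thesis by (auto simp: stabilizes_def)
  qed
  moreover have "?V \<noteq> {0}" using w by auto
  ultimately have "?V = UNIV" using irr unfolding irreducible_action_def by blast
  then have "q *v v = mat \<xi> *v v" for v by auto
  then have "q = mat \<xi>" by (simp add: matrix_eq)
  then show ?thesis by blast
qed

lemma irreducible_action_UNIV: "irreducible_action (UNIV :: ('k::field^'n^'n) set)"
  unfolding irreducible_action_def
proof (intro allI impI)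
  fix V :: "('k^'n) set" assume V: "vec.subspace V" "\<forall>a\<in>UNIV. stabilizes a V"
  show "V = {0} \<or> V = UNIV"
  proof (cases "V = {0}")
    case False
    then obtain v where v: "v \<in> V" "v \<noteq> 0" using vec.subspace_0[OF V(1)] by blast
    then obtain m where m: "v $ m \<noteq> 0" by (auto simp: vec_eq_iff)
    have "w \<in> V" for w
    proof -
      have "(\<chi> i j. if j = m then w $ i / v $ m else 0) *v v = w"
        using m by (simp add: vec_eq_iff matrix_vector_mult_def if_distrib[where f="\<lambda>a. a * _"] cong: if_cong)
      then show ?thesis using V(2) v(1) unfolding stabilizes_def by (metis UNIV_I image_subset_iff)
    qed
    then show ?thesis by blast
  qed simp
qed

lemma matrix_vector_mult_axis: "(y *v axis j 1) $ i = (y :: 'k::field^'n^'m) $ i $ j"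
  by (simp add: matrix_vector_mult_def axis_def if_distrib cong: if_cong)

lemma transpose_0: "transpose 0 = 0"
  by (simp add: transpose_def vec_eq_iff)

lemma matrix_add_mult: "(x + y) ** z = x ** z + y ** (z :: 'k::field^'n^'m)"
  by (simp add: matrix_matrix_mult_def vec_eq_iff sum.distrib algebra_simps)

lemma matrix_unit_sandwich:
  "matrix_unit k i ** y ** matrix_unit j l = mat (y $ i $ j) ** (matrix_unit k l :: 'k::field^'n^'n)"
proof -
  have "(matrix_unit k i ** y ** matrix_unit j l) *v x = (mat (y $ i $ j) ** matrix_unit k l) *v x" for x :: "'k^'n"
  proof -
    have "(matrix_unit k i ** y ** matrix_unit j l) *v x = matrix_unit k i *v (y *v (matrix_unit j l *v x))"
      by (simp add: matrix_vector_mul_assoc matrix_mul_assoc)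
    also have "\<dots> = (x $ l * y $ i $ j) *s axis k 1"
      by (simp add: matrix_unit_mult_vec vector_scalar_commute matrix_vector_mult_axis)
    also have "\<dots> = (mat (y $ i $ j) ** matrix_unit k l) *v x"
      by (simp add: matrix_vector_mul_assoc[symmetric] matrix_unit_mult_vec mult.commute)
    finally show ?thesis .
  qed
  then show ?thesis by (simp add: matrix_eq)
qed

section \<open>Star subalgebras\<close>

lemma star_subalgebraD:
  assumes "star_subalgebra H"
  shows "(mat 1, mat 1) \<in> H"
    and "(x, y) \<in> H \<Longrightarrow> (x', y') \<in> H \<Longrightarrow> (x + x', y + y') \<in> H"
    and "(x, y) \<in> H \<Longrightarrow> (x', y') \<in> H \<Longrightarrow> (x ** x', y ** y') \<in> H"
    and "(x, y) \<in> H \<Longrightarrow> (mat c ** x, mat c ** y) \<in> H"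
    and "(x, y) \<in> H \<Longrightarrow> (transpose y, transpose x) \<in> H"
  using assms
  unfolding star_subalgebra_def pair_one_def pair_add_def pair_mult_def pair_scale_def pair_star_def mat_matrix_mult
  by (fastforce simp del: split_paired_All split_paired_Ex)+

lemma star_subalgebraI:
  assumes "(mat 1, mat 1) \<in> H"
    and "\<And>x y x' y'. (x, y) \<in> H \<Longrightarrow> (x', y') \<in> H \<Longrightarrow> (x + x', y + y') \<in> H"
    and "\<And>x y x' y'. (x, y) \<in> H \<Longrightarrow> (x', y') \<in> H \<Longrightarrow> (x ** x', y ** y') \<in> H"
    and "\<And>c x y. (x, y) \<in> H \<Longrightarrow> (mat c ** x, mat c ** y) \<in> H"
    and "\<And>x y. (x, y) \<in> H \<Longrightarrow> (transpose y, transpose x) \<in> H"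
  shows "star_subalgebra H"
  using assms
  unfolding star_subalgebra_def pair_one_def pair_add_def pair_mult_def pair_scale_def pair_star_def mat_matrix_mult
  by auto

lemma not_generates_iff:
  "\<not> generates t \<longleftrightarrow> (\<exists>H. star_subalgebra H \<and> (\<forall>j. t $ j \<in> H) \<and> H \<noteq> UNIV)"
proof
  assume t: "\<not> generates t"
  have "star_subalgebra (star_subalgebra hull range (\<lambda>j. t $ j))"
    by (rule hull_in) (auto simp: star_subalgebra_def)
  then show "\<exists>H. star_subalgebra H \<and> (\<forall>j. t $ j \<in> H) \<and> H \<noteq> UNIV"
    using t hull_subset[of "range (\<lambda>j. t $ j)" star_subalgebra] unfolding generates_def by blast
next
  assume "\<exists>H. star_subalgebra H \<and> (\<forall>j. t $ j \<in> H) \<and> H \<noteq> UNIV"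
  then obtain H where H: "star_subalgebra H" "range (\<lambda>j. t $ j) \<subseteq> H" "H \<noteq> UNIV" by blast
  then have "star_subalgebra hull range (\<lambda>j. t $ j) \<subseteq> H" by (intro hull_minimal)
  then show "\<not> generates t" using H(3) unfolding generates_def by blast
qed

text \<open>By Burnside's theorem \<open>H\<close> projects onto both factors, so it is the graph of an algebra automorphism, which is
  inner; compatibility with the star forces the conjugating matrix to agree with its transpose up to sign.\<close>

lemma star_subalgebra_goursat:
  fixes H :: "('k::alg_closed_field, 'n::finite) mat_pair set"
  assumes H: "star_subalgebra H" "H \<noteq> UNIV" and irr: "irreducible_action {x. \<exists>y. (x, y) \<in> H}"
  shows "\<exists>p. invertible p \<and> (\<forall>x y. (x, y) \<in> H \<longrightarrow> p ** x = y ** p) \<and> (transpose p = p \<or> transpose p = - p)"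
proof -
  note one = star_subalgebraD(1)[OF H(1)] and add = star_subalgebraD(2)[OF H(1)]
    and mult = star_subalgebraD(3)[OF H(1)] and scale = star_subalgebraD(4)[OF H(1)]
    and star = star_subalgebraD(5)[OF H(1)]
  have "{x. \<exists>y. (x, y) \<in> H} = UNIV"
  proof (rule burnside[OF _ _ _ irr])
    show "mat c \<in> {x. \<exists>y. (x, y) \<in> H}" for c using scale[OF one, of c] by auto
  qed (use add mult in blast)+
  then have ex1: "\<exists>y. (x, y) \<in> H" for x by blast
  have ex2: "\<exists>x. (x, y) \<in> H" for y
    using ex1[of "transpose y"] star[of "transpose y"] by (metis transpose_transpose)
  \<comment> \<open>The second components paired with 0 form a two-sided ideal, because
    \<open>H\<close> projects onto the second factor. Matrix units extract an entry of a nonzero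
    \<open>y\<close>, so the ideal would be everything; the star would then supply the first factor
    as well, against \<open>H \<noteq> UNIV\<close>.\<close>
  have ideal: "y = 0" if y: "(0, y) \<in> H" for y
  proof (rule ccontr)
    assume "y \<noteq> 0"
    then obtain i j where ij: "y $ i $ j \<noteq> 0" by (auto simp: vec_eq_iff)
    have sandwich: "(0, z ** y ** z') \<in> H" for z z'
    proof -
      obtain w w' where "(w, z) \<in> H" "(w', z') \<in> H" using ex2 by metis
      then have "(w ** 0 ** w', z ** y ** z') \<in> H" using y mult by metis
      then show ?thesis by simp
    qed
    have unit: "(0, mat c ** matrix_unit k l) \<in> H" for c k l
    proof -
      have "mat (c / y $ i $ j) ** (matrix_unit k i ** y ** matrix_unit j l) = mat c ** matrix_unit k l"
        unfolding matrix_unit_sandwich using ij by (simp add: mat_matrix_mult vec_eq_iff)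
      then show ?thesis using scale[OF sandwich, of "c / y $ i $ j" "matrix_unit k i" "matrix_unit j l"] by simp
    qed
    have sum: "(0, sum h I) \<in> H" if "\<And>i. i \<in> I \<Longrightarrow> (0, h i) \<in> H" for h :: "'n \<Rightarrow> 'k^'n^'n" and I
      using that
    proof (induction I rule: infinite_finite_induct)
      case (insert i I)
      then show ?case using add[of 0 "h i" 0 "sum h I"] by simp
    qed (use scale[OF one, of 0] in \<open>simp_all add: mat_0\<close>)
    have all: "(0, M) \<in> H" for M
      by (subst matrix_eq_sum_units) (intro sum unit)
    have "(x, y) \<in> H" for x y
    proof -
      have "(x, 0) \<in> H" using star[OF all[of "transpose x"]] by (simp add: transpose_0)
      then show ?thesis using add[OF _ all[of y]] by fastforce
    qed
    then show False using H(2) by auto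
  qed
  obtain \<phi> where \<phi>: "\<And>x. (x, \<phi> x) \<in> H" using ex1 by metis
  have \<phi>_unique: "y = \<phi> x" if "(x, y) \<in> H" for x y
  proof -
    have "(x + mat (-1) ** x, y + mat (-1) ** \<phi> x) \<in> H" using that \<phi> add scale by blast
    moreover have "x + mat (-1) ** x = 0" "y + mat (-1) ** \<phi> x = y - \<phi> x" by (simp_all add: mat_matrix_mult vec_eq_iff)
    ultimately show ?thesis using ideal by fastforce
  qed
  have \<phi>_add: "\<phi> (x + x') = \<phi> x + \<phi> x'" and \<phi>_mult: "\<phi> (x ** x') = \<phi> x ** \<phi> x'" and \<phi>_scale: "\<phi> (mat c ** x) = mat c ** \<phi> x"
    for x x' c using \<phi>_unique \<phi> add mult scale by metis+
  have \<phi>_inj: "x = 0" if "\<phi> x = 0" for x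
  proof -
    have "(0, transpose x) \<in> H" using star[OF \<phi>[of x]] that by (simp add: transpose_0)
    then have "transpose x = 0" by (rule ideal)
    then show ?thesis by (metis transpose_transpose transpose_0)
  qed
  define o0 :: 'n where "o0 = undefined"
  \<comment> \<open>The Skolem-Noether argument: \<open>col\<close> identifies the column vectors
    with the left ideal of matrices supported in column \<open>o0\<close>. Applying
    \<open>\<phi>\<close> and evaluating at \<open>v\<close> turns left multiplication by
    \<open>x\<close> into left multiplication by \<open>\<phi> x\<close>, and the map obtained is
    \<open>p\<close>.\<close>
  define col where "col u = (\<chi> i j. if j = o0 then u $ i else 0)" for u :: "'k^'n"
  have col: "x ** col u = col (x *v u)" "col (u + v) = col u + col v" for x u v
    by (auto simp: col_def vec_eq_iff matrix_matrix_mult_def matrix_vector_mult_def)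
  have col_scale: "col (c *s u) = mat c ** col u" for u c
    unfolding mat_matrix_mult by (simp add: col_def vec_eq_iff)
  have "col (axis o0 1) $ o0 $ o0 = 1" by (simp add: col_def axis_def)
  then have "col (axis o0 1) \<noteq> 0" by auto
  then have "\<phi> (col (axis o0 1)) \<noteq> 0" using \<phi>_inj by blast
  then obtain v where v: "\<phi> (col (axis o0 1)) *v v \<noteq> 0" by (metis matrix_eq matrix_vector_mult_0)
  define p where "p = matrix (\<lambda>u. \<phi> (col u) *v v)"
  have "Vector_Spaces.linear (*s) (*s) (\<lambda>u. \<phi> (col u) *v v)"
    unfolding Vector_Spaces.linear_iff
  proof (intro conjI allI)
    show "\<phi> (col (u + w)) *v v = \<phi> (col u) *v v + \<phi> (col w) *v v" for u w
      by (simp add: col \<phi>_add matrix_vector_mult_add_rdistrib)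
    show "\<phi> (col (c *s u)) *v v = c *s (\<phi> (col u) *v v)" for c u
      unfolding col_scale \<phi>_scale matrix_vector_mul_assoc[symmetric] mat_vector_mult ..
  qed (rule vec.vector_space_axioms)+
  then have p: "p *v u = \<phi> (col u) *v v" for u by (simp add: p_def matrix_works)
  have p_inter: "p ** x = \<phi> x ** p" for x
  proof -
    have "(p ** x) *v u = (\<phi> x ** p) *v u" for u
      by (simp add: matrix_vector_mul_assoc[symmetric] p col(1)[symmetric] \<phi>_mult)
    then show ?thesis by (simp add: matrix_eq)
  qed
  have p_inj: "u = 0" if "p *v u = 0" for u
  proof -
    let ?V = "{u. p *v u = 0}"
    have "vec.subspace ?V" by (auto simp: vec.subspace_def matrix_vector_right_distrib vector_scalar_commute)
    moreover have "stabilizes x ?V" for x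
    proof -
      have "p *v (x *v u) = 0" if "p *v u = 0" for u
        using that p_inter[of x] by (metis matrix_vector_mul_assoc matrix_vector_mult_0_right)
      then show ?thesis by (auto simp: stabilizes_def)
    qed
    moreover have "?V \<noteq> UNIV" using v p by auto
    ultimately have "?V = {0}" using irreducible_action_UNIV unfolding irreducible_action_def by blast
    then show ?thesis using that by blast
  qed
  then have "\<exists>B. B ** p = mat 1" unfolding matrix_left_invertible_ker by simp
  then have inv: "invertible p" by (simp add: invertible_left_inverse)
  have pt_inter: "transpose p ** x = \<phi> x ** transpose p" for x
  proof -
    have "transpose x = \<phi> (transpose (\<phi> x))" using star[OF \<phi>[of x]] by (rule \<phi>_unique)
    then have "p ** transpose (\<phi> x) = transpose x ** p" using p_inter by metis
    then have "transpose (p ** transpose (\<phi> x)) = transpose (transpose x ** p)" by simp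
    then show ?thesis by (simp add: matrix_transpose_mul)
  qed
  \<comment> \<open>Both \<open>p\<close> and its transpose intertwine \<open>x\<close> with
    \<open>\<phi> x\<close>, so \<open>?q\<close> is central, hence a scalar \<open>c\<close>.
    Transposing \<open>transpose p = p ** mat c\<close> once more gives
    \<open>c * c = 1\<close>.\<close>
  let ?q = "matrix_inv p ** transpose p"
  have "?q ** x = x ** ?q" for x
  proof -
    have x: "matrix_inv p ** (\<phi> x ** p) = x"
      using inv by (simp add: p_inter[symmetric] matrix_mul_assoc matrix_inv_mult)
    have "x ** matrix_inv p = matrix_inv p ** \<phi> x ** (p ** matrix_inv p)"
      using arg_cong[OF x, of "\<lambda>y. y ** matrix_inv p"] by (simp only: matrix_mul_assoc)
    then have "x ** ?q = matrix_inv p ** \<phi> x ** transpose p"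
      using inv by (simp add: matrix_inv_mult matrix_mul_assoc)
    then show ?thesis by (simp add: matrix_mul_assoc[symmetric] pt_inter)
  qed
  then obtain c where c: "?q = mat c" using schur[OF irreducible_action_UNIV] by metis
  have "transpose p = p ** ?q" using inv by (simp add: matrix_mul_assoc matrix_inv_mult)
  then have tp: "transpose p = p ** mat c" using c by simp
  have entry: "p $ j $ i = c * p $ i $ j" for i j
  proof -
    have "transpose p $ i $ j = (p ** mat c) $ i $ j" using tp by simp
    then show ?thesis
      by (simp add: transpose_def matrix_matrix_mult_def mat_def if_distrib cong: if_cong)
  qed
  have "p \<noteq> 0" using v p by auto
  then obtain i j where ij: "p $ i $ j \<noteq> 0" by (auto simp: vec_eq_iff)
  have "p $ i $ j = c * (c * p $ i $ j)" using entry[of j i] entry[of i j] by simp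
  then have "c * c = 1" using ij by simp
  then have "c = 1 \<or> c = - 1" using square_eq_1_iff by blast
  then have "transpose p = p \<or> transpose p = - p"
  proof
    assume "c = 1"
    then have "p $ j $ i = p $ i $ j" for i j using entry[of j i] by simp
    then have "transpose p = p" unfolding vec_eq_iff transpose_def vec_lambda_beta by blast
    then show ?thesis ..
  next
    assume "c = - 1"
    then have "p $ j $ i = - p $ i $ j" for i j using entry[of j i] by simp
    then have "transpose p = - p" unfolding vec_eq_iff transpose_def vec_lambda_beta vector_uminus_component by blast
    then show ?thesis ..
  qed
  moreover have "\<forall>x y. (x, y) \<in> H \<longrightarrow> p ** x = y ** p"
    using p_inter \<phi>_unique by blast
  ultimately show ?thesis using inv by blast
qed

section \<open>The non-generating tuples as a union\<close>

lemma set_X_iff: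
  "t \<in> set_X i \<longleftrightarrow> (\<exists>V. vec.subspace V \<and> vec.dim V = i \<and>
     (\<forall>j. stabilizes (fst (t $ j)) V \<and> stabilizes (transpose (snd (t $ j))) V))"
  unfolding set_X_def using stabilizes_perp_iff by blast

definition tuple_action :: "('k::field, 'n::finite) mat_pair ^ 'r::finite \<Rightarrow> ('k^'n^'n) set" where
  "tuple_action t = range (\<lambda>j. fst (t $ j)) \<union> range (\<lambda>j. transpose (snd (t $ j)))"

lemma irreducible_tuple_action_iff:
  fixes t :: "('k::field, 'n::finite) mat_pair ^ 'r::finite"
  shows "irreducible_action (tuple_action t) \<longleftrightarrow> (\<forall>i\<in>{1..<CARD('n)}. t \<notin> set_X i)"
proof -
  have stab: "(\<forall>a\<in>tuple_action t. stabilizes a V) \<longleftrightarrow>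
      (\<forall>j. stabilizes (fst (t $ j)) V \<and> stabilizes (transpose (snd (t $ j))) V)" for V
    by (auto simp: tuple_action_def)
  have dim: "vec.dim V \<in> {1..<CARD('n)} \<longleftrightarrow> \<not> (V = {0} \<or> V = UNIV)" if V: "vec.subspace V" for V :: "('k^'n) set"
  proof -
    have "vec.dim V = 0 \<longleftrightarrow> V = {0}" using vec.subspace_0[OF V] by (auto simp: vec.dim_eq_0)
    moreover have "vec.dim V = CARD('n) \<longleftrightarrow> V = UNIV"
      using vec.subspace_dim_equal[OF V vec.subspace_UNIV] vec_dim_card[where 'a='k and 'n='n] by auto
    moreover have "vec.dim V \<le> CARD('n)" by (rule dim_subset_UNIV_cart_gen)
    ultimately show ?thesis by (metis One_nat_def Suc_leI atLeastLessThan_iff le_neq_implies_less less_le not_less_eq_eq zero_less_iff_neq_zero le0)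
  qed
  show ?thesis
    unfolding irreducible_action_def stab set_X_iff using dim by metis
qed

definition set_C :: "'k::field \<Rightarrow> (('k, 'n::finite) mat_pair ^ 'r::finite) set" where
  "set_C s = {t. \<exists>p. p \<noteq> 0 \<and> transpose p = mat s ** p \<and> (\<forall>j. p ** fst (t $ j) = snd (t $ j) ** p)}"

lemma set_X_subset_Z:
  assumes "i \<in> {1..<CARD('n)}"
  shows "set_X i \<subseteq> (set_Z :: (('k::field, 'n::finite) mat_pair ^ 'r::finite) set)"
proof
  fix t :: "('k, 'n) mat_pair ^ 'r" assume "t \<in> set_X i"
  then obtain V where V: "vec.subspace V" "vec.dim V = i"
    and t: "\<And>j. stabilizes (fst (t $ j)) V \<and> stabilizes (transpose (snd (t $ j))) V" unfolding set_X_iff by blast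
  define H :: "('k, 'n) mat_pair set" where "H = {(x, y). stabilizes x V \<and> stabilizes (transpose y) V}"
  have stab_add: "stabilizes (x + y) V" if "stabilizes x V" "stabilizes y V" for x y :: "'k^'n^'n"
    using that V(1) by (auto simp: stabilizes_def matrix_vector_mult_add_rdistrib image_subset_iff intro: vec.subspace_add)
  have stab_mult: "stabilizes (x ** y) V" if "stabilizes x V" "stabilizes y V" for x y :: "'k^'n^'n"
    using that by (auto simp: stabilizes_def matrix_vector_mul_assoc[symmetric] image_subset_iff)
  have stab_mat: "stabilizes (mat c) V" for c
    using V(1) by (auto simp: stabilizes_def vec.subspace_scale)
  have t_add: "transpose (x + y) = transpose x + transpose y" for x y :: "'k^'n^'n"
    by (simp add: transpose_def vec_eq_iff)
  have "star_subalgebra H"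
    by (rule star_subalgebraI)
       (auto simp: H_def t_add matrix_transpose_mul transpose_mat intro: stab_add stab_mult stab_mat)
  moreover have "t $ j \<in> H" for j using t[of j] by (simp add: H_def case_prod_unfold)
  moreover have "H \<noteq> UNIV"
  proof
    assume "H = UNIV"
    then have "stabilizes x V" for x by (auto simp: H_def set_eq_iff)
    then have "V = {0} \<or> V = UNIV" using irreducible_action_UNIV V(1) unfolding irreducible_action_def by blast
    then show False using V(2) assms vec_dim_card[where 'a='k and 'n='n] by auto
  qed
  ultimately show "t \<in> set_Z" unfolding set_Z_def not_generates_iff by blast
qed

text \<open>The pairs intertwined by both \<open>p\<close> and its transpose form a star subalgebra,
  with no need to invert \<open>p\<close>: the star exchanges the two conditions. It is proper
  because \<open>(mat 1, 0)\<close> would force \<open>p = 0\<close>.\<close>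

lemma set_C_subset_Z: "set_C s \<subseteq> (set_Z :: (('k::field, 'n::finite) mat_pair ^ 'r::finite) set)"
proof
  fix t :: "('k, 'n) mat_pair ^ 'r" assume "t \<in> set_C s"
  then obtain p where p: "p \<noteq> 0" "transpose p = mat s ** p" "\<And>j. p ** fst (t $ j) = snd (t $ j) ** p"
    unfolding set_C_def by blast
  define H :: "('k, 'n) mat_pair set" where "H = {(x, y). p ** x = y ** p \<and> transpose p ** x = y ** transpose p}"
  have "star_subalgebra H"
  proof (rule star_subalgebraI)
    show "(mat 1, mat 1) \<in> H" by (simp add: H_def)
    show "(x + x', y + y') \<in> H" if "(x, y) \<in> H" "(x', y') \<in> H" for x y x' y'
      using that by (simp add: H_def matrix_add_ldistrib matrix_add_mult)
    show "(x ** x', y ** y') \<in> H" if "(x, y) \<in> H" "(x', y') \<in> H" for x y x' y'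
      using that by (simp add: H_def) (metis matrix_mul_assoc)
    show "(mat c ** x, mat c ** y) \<in> H" if "(x, y) \<in> H" for c x y
      using that by (simp add: H_def mat_commute matrix_mul_assoc[symmetric])
    show "(transpose y, transpose x) \<in> H" if "(x, y) \<in> H" for x y
    proof -
      have "transpose (p ** x) = transpose (y ** p)" "transpose (transpose p ** x) = transpose (y ** transpose p)"
        using that by (simp_all add: H_def)
      then show ?thesis by (simp add: H_def matrix_transpose_mul)
    qed
  qed
  moreover have "t $ j \<in> H" for j
  proof -
    have "mat s ** p ** fst (t $ j) = mat s ** (snd (t $ j) ** p)" using p(3)[of j] by (simp add: matrix_mul_assoc[symmetric])
    also have "\<dots> = snd (t $ j) ** (mat s ** p)"
      by (simp add: mat_commute)
    finally show ?thesis using p(3)[of j] by (simp add: H_def case_prod_unfold p(2))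
  qed
  moreover have "(mat 1, 0) \<notin> H" using p(1) by (simp add: H_def)
  ultimately show "t \<in> set_Z" unfolding set_Z_def not_generates_iff by blast
qed

lemma conj_eq_iff:
  fixes p :: "'k::field^'n^'n"
  assumes "invertible p"
  shows "p ** a ** matrix_inv p = b \<longleftrightarrow> p ** a = b ** p"
proof
  assume "p ** a ** matrix_inv p = b"
  then show "p ** a = b ** p" using assms by (metis matrix_inv_mult(2) matrix_mul_assoc matrix_mul_rid)
next
  assume "p ** a = b ** p"
  then show "p ** a ** matrix_inv p = b" using assms by (metis matrix_inv_mult(1) matrix_mul_assoc matrix_mul_rid)
qed

lemma invertible_nonzero: "invertible p \<Longrightarrow> p \<noteq> (0 :: 'k::field^'n^'n)"
  by (auto simp: invertible_det_nz) (metis det_0 mat_0)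

lemma set_Z_decomposition:
  "set_Z \<subseteq> (\<Union>i\<in>{1..<CARD('n)}. set_X i) \<union> set_Y \<union> (set_Y' :: (('k::alg_closed_field, 'n::finite) mat_pair ^ 'r::finite) set)"
proof
  fix t :: "('k, 'n) mat_pair ^ 'r" assume "t \<in> set_Z"
  then obtain H where H: "star_subalgebra H" "\<And>j. t $ j \<in> H" "H \<noteq> UNIV"
    unfolding set_Z_def not_generates_iff by blast
  show "t \<in> (\<Union>i\<in>{1..<CARD('n)}. set_X i) \<union> set_Y \<union> set_Y'"
  proof (cases "irreducible_action (tuple_action t)")
    case False
    then show ?thesis unfolding irreducible_tuple_action_iff by blast
  next
    case True
    have "(fst (t $ j), snd (t $ j)) \<in> H" for j using H(2) by simp
    then have "tuple_action t \<subseteq> {x. \<exists>y. (x, y) \<in> H}"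
      using star_subalgebraD(5)[OF H(1)] unfolding tuple_action_def by blast
    then have "irreducible_action {x. \<exists>y. (x, y) \<in> H}" using True irreducible_action_mono by blast
    then obtain p where p: "invertible p" "\<And>x y. (x, y) \<in> H \<Longrightarrow> p ** x = y ** p"
      and sign: "transpose p = p \<or> transpose p = - p"
      using star_subalgebra_goursat[OF H(1,3)] by blast
    have conj: "\<forall>j. p ** fst (t $ j) ** matrix_inv p = snd (t $ j)"
      using p H(2) by (simp add: conj_eq_iff)
    show ?thesis
    proof (cases "alternating_matrix p")
      case True
      then have "t \<in> set_Y'" using p(1) conj unfolding set_Y'_def by blast
      then show ?thesis by blast
    next
      case False
      \<comment> \<open>A skew matrix with a nonzero diagonal entry exists only in characteristic 2,
        where skew and symmetric mean the same.\<close>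
      have "transpose p = p"
      proof (rule ccontr)
        assume ne: "transpose p \<noteq> p"
        then have skew: "transpose p = - p" using sign by blast
        then obtain i where i: "p $ i $ i \<noteq> 0" using False by (auto simp: alternating_matrix_def)
        have "transpose p $ i $ i = (- p) $ i $ i" using skew by simp
        then have "p $ i $ i + p $ i $ i = 0" by (simp add: transpose_def eq_neg_iff_add_eq_0)
        then have "(1 + 1) * p $ i $ i = 0" by (simp add: algebra_simps)
        then have "(1 :: 'k) + 1 = 0" using i by simp
        then have "(- 1 :: 'k) = 1" by (simp add: minus_unique)
        then have "- z = z" for z :: 'k by (metis mult_minus1 mult_1)
        then show False using skew ne by (simp add: vec_eq_iff)
      qed
      then have "t \<in> set_Y" using p(1) conj False unfolding set_Y_def symmetric_matrix_def by blast
      then show ?thesis by blast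
    qed
  qed
qed

lemma set_Y_subset_C: "set_Y \<subseteq> set_C 1"
proof
  fix t :: "('k::field, 'n::finite) mat_pair ^ 'r::finite" assume "t \<in> set_Y"
  then obtain p where p: "invertible p" "transpose p = p" "\<forall>j. p ** fst (t $ j) ** matrix_inv p = snd (t $ j)"
    unfolding set_Y_def symmetric_matrix_def by blast
  then have "transpose p = mat 1 ** p" "\<forall>j. p ** fst (t $ j) = snd (t $ j) ** p" by (simp_all add: conj_eq_iff)
  then show "t \<in> set_C 1" using invertible_nonzero[OF p(1)] unfolding set_C_def by blast
qed

lemma set_Y'_subset_C: "set_Y' \<subseteq> set_C (- 1)"
proof
  fix t :: "('k::field, 'n::finite) mat_pair ^ 'r::finite" assume "t \<in> set_Y'"
  then obtain p where p: "invertible p" "transpose p = - p" "\<forall>j. p ** fst (t $ j) ** matrix_inv p = snd (t $ j)"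
    unfolding set_Y'_def alternating_matrix_def by blast
  then have "\<forall>j. p ** fst (t $ j) = snd (t $ j) ** p" by (simp add: conj_eq_iff)
  moreover have "transpose p = mat (- 1) ** p" unfolding p(2) mat_matrix_mult by (simp add: vec_eq_iff)
  ultimately show "t \<in> set_C (- 1)" using invertible_nonzero[OF p(1)] unfolding set_C_def by blast
qed

section \<open>Closedness by specialization\<close>

text \<open>Divisibility in a valuation ring is total, so among finitely many elements, not all
  zero, one divides all the others. Since \<open>F\<close> is an ultrafilter, the choice of that
  index can be made once for almost all \<open>s\<close>.\<close>

lemma (in place) max_coordinate:
  assumes "finite I" "eventually (\<lambda>s. \<exists>i\<in>I. w i s \<noteq> 0) F"
  shows "\<exists>m\<in>I. eventually (\<lambda>s. w m s \<noteq> 0) F \<and> (\<forall>l\<in>I. \<exists>a. (\<lambda>s. w l s / w m s, a) \<in> G)"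
  using assms
proof (induction I)
  case empty
  then show ?case using nontrivial by (simp add: trivial_limit_def)
next
  case (insert i I)
  have self: "\<exists>a. (\<lambda>s. w m s / w m s, a) \<in> G" if "eventually (\<lambda>s. w m s \<noteq> 0) F" for m
  proof -
    have "eventually (\<lambda>s. 1 = w m s / w m s) F" using that by eventually_elim simp
    from cong[OF const this] show ?thesis by (rule exI)
  qed
  have null: "\<exists>a. (\<lambda>s. w l s / w m s, a) \<in> G" if "eventually (\<lambda>s. w l s = 0) F" for l m
  proof -
    have "eventually (\<lambda>s. 0 = w l s / w m s) F" using that by eventually_elim simp
    from cong[OF const this] show ?thesis by (rule exI)
  qed
  show ?case
  proof (cases "eventually (\<lambda>s. \<exists>i\<in>I. w i s \<noteq> 0) F")
    case False
    then have "eventually (\<lambda>s. \<not> (\<exists>i\<in>I. w i s \<noteq> 0)) F" using ultra by blast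
    then have z: "eventually (\<lambda>s. \<forall>l\<in>I. w l s = 0) F" by eventually_elim simp
    then have "eventually (\<lambda>s. w i s \<noteq> 0) F" using insert.prems by eventually_elim auto
    moreover have "\<exists>a. (\<lambda>s. w l s / w i s, a) \<in> G" if "l \<in> I" for l
      using z that by (intro null) (auto elim: eventually_mono)
    ultimately show ?thesis using self by blast
  next
    case True
    then obtain m where m: "m \<in> I" "eventually (\<lambda>s. w m s \<noteq> 0) F" "\<And>l. l \<in> I \<Longrightarrow> \<exists>a. (\<lambda>s. w l s / w m s, a) \<in> G"
      using insert.IH by blast
    show ?thesis
    proof (cases "\<exists>a. (\<lambda>s. w i s / w m s, a) \<in> G")
      case True
      then show ?thesis using m by blast
    next
      case False
      then have "\<not> eventually (\<lambda>s. w i s = 0) F" using null by blast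
      then have i: "eventually (\<lambda>s. w i s \<noteq> 0) F" using ultra by blast
      obtain b where b: "(\<lambda>s. w m s / w i s, b) \<in> G"
        using total[of "\<lambda>s. w i s / w m s"] False by (auto simp: inverse_divide)
      have "\<exists>a. (\<lambda>s. w l s / w i s, a) \<in> G" if l: "l \<in> I" for l
      proof -
        obtain a where "(\<lambda>s. w l s / w m s, a) \<in> G" using m(3)[OF l] by blast
        from mult[OF this b] have "(\<lambda>s. w l s / w m s * (w m s / w i s), a * b) \<in> G" .
        moreover have "eventually (\<lambda>s. w l s / w m s * (w m s / w i s) = w l s / w i s) F"
          using m(2) by eventually_elim simp
        ultimately have "(\<lambda>s. w l s / w i s, a * b) \<in> G" by (rule cong)
        then show ?thesis by (rule exI)
      qed
      then show ?thesis using i self by blast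
    qed
  qed
qed

lemma tuple_coords_poly:
  "(\<lambda>t. fst (t $ j) $ k $ l) \<in> poly_functions tuple_coords" "(\<lambda>t. snd (t $ j) $ k $ l) \<in> poly_functions tuple_coords"
  by (rule poly_functions.coord, simp only: tuple_coords_def, blast)+

lemma closedin_zariskiI:
  assumes "\<And>t. t \<in> zariski C closure_of S \<Longrightarrow> t \<in> S"
  shows "closedin (zariski C) S"
  using assms closure_of_subset[of S "zariski C"] closure_of_eq[of "zariski C" S] by fastforce

lemma closedin_set_C: "closedin tuple_zariski (set_C \<sigma> :: (('k::alg_closed_field, 'n::finite) mat_pair ^ 'r::finite) set)"
proof (rule closedin_zariskiI)
  fix t :: "('k, 'n) mat_pair ^ 'r" assume t: "t \<in> tuple_zariski closure_of (set_C \<sigma>)"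
  then obtain F and G :: "((('k, 'n) mat_pair ^ 'r \<Rightarrow> 'k) \<times> 'k) set" where "place F G"
    and ev: "eventually (\<lambda>s. s \<in> set_C \<sigma>) F" and poly: "\<And>f. f \<in> poly_functions tuple_coords \<Longrightarrow> (f, f t) \<in> G"
    using place_at_closure_point[OF t] by blast
  interpret place F G by fact
  have "\<forall>s :: ('k, 'n) mat_pair ^ 'r. \<exists>p. s \<in> set_C \<sigma> \<longrightarrow> p \<noteq> 0 \<and> transpose p = mat \<sigma> ** p \<and> (\<forall>j. p ** fst (s $ j) = snd (s $ j) ** p)"
    unfolding set_C_def by blast
  from choice[OF this] obtain P where "\<forall>s :: ('k, 'n) mat_pair ^ 'r. s \<in> set_C \<sigma> \<longrightarrow>
      P s \<noteq> 0 \<and> transpose (P s) = mat \<sigma> ** P s \<and> (\<forall>j. P s ** fst (s $ j) = snd (s $ j) ** P s)" ..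
  then have P: "P s \<noteq> 0" "transpose (P s) = mat \<sigma> ** P s" "P s ** fst (s $ j) = snd (s $ j) ** P s"
    if "s \<in> set_C \<sigma>" for s j using that by blast+
  let ?w = "\<lambda>(i, j) s. P s $ i $ j"
  have "eventually (\<lambda>s. \<exists>ij\<in>UNIV. ?w ij s \<noteq> 0) F"
    using ev by eventually_elim (use P(1) in \<open>force simp: vec_eq_iff\<close>)
  then obtain i0 j0 where m: "eventually (\<lambda>s. P s $ i0 $ j0 \<noteq> 0) F" "\<And>i j. \<exists>a. (\<lambda>s. P s $ i $ j / P s $ i0 $ j0, a) \<in> G"
    using max_coordinate[of UNIV ?w] by auto
  define q where "q i j = (SOME a. (\<lambda>s. P s $ i $ j / P s $ i0 $ j0, a) \<in> G)" for i j
  have q: "(\<lambda>s. P s $ i $ j / P s $ i0 $ j0, q i j) \<in> G" for i j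
    unfolding q_def using m(2) by (rule someI_ex)
  define p where "p = (\<chi> i j. q i j)"
  \<comment> \<open>The normalized pivot entry is constantly 1, which keeps the specialized
    intertwiner nonzero; its invertibility may be lost.\<close>
  have "q i0 j0 = 1"
    by (rule unique[OF q const]) (use m(1) in eventually_elim, simp)
  then have "p $ i0 $ j0 \<noteq> 0" by (simp add: p_def)
  then have "p \<noteq> 0" by auto
  moreover have "transpose p = mat \<sigma> ** p"
  proof -
    have "q j i = \<sigma> * q i j" for i j
    proof (rule unique[OF q mult[OF const q]])
      show "eventually (\<lambda>s. P s $ j $ i / P s $ i0 $ j0 = \<sigma> * (P s $ i $ j / P s $ i0 $ j0)) F"
        using ev
      proof eventually_elim
        case (elim s)
        have "transpose (P s) $ i $ j = (mat \<sigma> ** P s) $ i $ j" using P(2)[OF elim] by simp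
        then have "P s $ j $ i = \<sigma> * P s $ i $ j" unfolding mat_matrix_mult by (simp add: transpose_def)
        then show ?case by simp
      qed
    qed
    then show ?thesis unfolding mat_matrix_mult vec_eq_iff transpose_def p_def vec_lambda_beta by blast
  qed
  moreover have "p ** fst (t $ j) = snd (t $ j) ** p" for j
  proof -
    have "(\<Sum>k\<in>UNIV. q i k * fst (t $ j) $ k $ l) = (\<Sum>k\<in>UNIV. snd (t $ j) $ i $ k * q k l)" for i l
    proof (rule unique[OF sum[OF mult[OF q poly[OF tuple_coords_poly(1)]]] sum[OF mult[OF poly[OF tuple_coords_poly(2)] q]]])
      show "eventually (\<lambda>s. (\<Sum>k\<in>UNIV. P s $ i $ k / P s $ i0 $ j0 * fst (s $ j) $ k $ l) =
          (\<Sum>k\<in>UNIV. snd (s $ j) $ i $ k * (P s $ k $ l / P s $ i0 $ j0))) F"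
        using ev
      proof eventually_elim
        case (elim s)
        have "(P s ** fst (s $ j)) $ i $ l = (snd (s $ j) ** P s) $ i $ l" using P(3)[OF elim] by simp
        then show ?case by (simp add: matrix_matrix_mult_def sum_divide_distrib[symmetric])
      qed
    qed
    then show ?thesis by (simp add: p_def vec_eq_iff matrix_matrix_mult_def)
  qed
  ultimately show "t \<in> set_C \<sigma>" unfolding set_C_def by blast
qed

section \<open>Frames of subspaces and their specialization\<close>

text \<open>Otherwise the projection onto the coordinates in \<open>I\<close> would be injective on
  \<open>V\<close>. Provides the next vector of the elimination, already cleared at the pivots found
  so far.\<close>

lemma subspace_vanishing_coordinates:
  fixes V :: "('k::field^'n) set"
  assumes V: "vec.subspace V" "card I < vec.dim V"
  shows "\<exists>w\<in>V. w \<noteq> 0 \<and> (\<forall>l\<in>I. w $ l = 0)"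
proof (rule ccontr)
  assume no: "\<not> ?thesis"
  define a :: "'k^'n^'n" where "a = (\<chi> i j. if i = j \<and> i \<in> I then 1 else 0)"
  have a: "(a *v x) $ i = (if i \<in> I then x $ i else 0)" for x i
    by (simp add: a_def matrix_vector_mult_def if_distrib[where f="\<lambda>a. a * _"] cong: if_cong)
  have "inj_on ((*v) a) V"
  proof (rule inj_onI)
    fix x y assume xy: "x \<in> V" "y \<in> V" "a *v x = a *v y"
    then have "\<forall>l\<in>I. (x - y) $ l = 0" using a by (metis right_minus_eq vector_minus_component)
    moreover have "x - y \<in> V" using xy V(1) by (simp add: vec.subspace_diff)
    ultimately show "x = y" using no by (metis right_minus_eq)
  qed
  then have "vec.dim ((*v) a ` V) = vec.dim V"
    using V(1) by (intro vec.dim_image_eq[OF matrix_vector_mul_linear_gen]) (simp add: vec.span_eq_iff[THEN iffD2])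
  moreover have "(*v) a ` V \<subseteq> {x. \<forall>i. i \<notin> I \<longrightarrow> x $ i = 0}" using a by auto
  then have "vec.dim ((*v) a ` V) \<le> vec.dim {x :: 'k^'n. \<forall>i. i \<notin> I \<longrightarrow> x $ i = 0}" by (rule vec.dim_subset)
  ultimately show False using V(2) by (simp add: dim_substandard_cart)
qed

text \<open>For a frame in reduced form with pivots \<open>I\<close> this is its span, since a
  combination is determined by its pivot coordinates. Written as an equation, membership is
  polynomial in the entries and passes through a specialization.\<close>

definition frame_space :: "'n set \<Rightarrow> ('n \<Rightarrow> 'k::field^'n) \<Rightarrow> ('k^'n) set" where
  "frame_space I N = {v. v = (\<Sum>j\<in>I. v $ j *s N j)}"

lemma frame_space:
  fixes N :: "'n \<Rightarrow> 'k::field^'n"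
  assumes N: "\<And>j l. j \<in> I \<Longrightarrow> l \<in> I \<Longrightarrow> N j $ l = (if l = j then 1 else 0)"
  shows "vec.subspace (frame_space I N)" and "vec.dim (frame_space I N) = card I"
    and "j \<in> I \<Longrightarrow> N j \<in> frame_space I N"
proof -
  show sub: "vec.subspace (frame_space I N)"
    unfolding vec.subspace_def frame_space_def
  proof (intro conjI ballI allI CollectI)
    fix x y assume "x \<in> {v. v = (\<Sum>j\<in>I. v $ j *s N j)}" "y \<in> {v. v = (\<Sum>j\<in>I. v $ j *s N j)}"
    then have x: "x = (\<Sum>j\<in>I. x $ j *s N j)" and y: "y = (\<Sum>j\<in>I. y $ j *s N j)" by simp_all
    have "x + y = (\<Sum>j\<in>I. x $ j *s N j) + (\<Sum>j\<in>I. y $ j *s N j)" by (rule arg_cong2[OF x y])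
    also have "\<dots> = (\<Sum>j\<in>I. (x + y) $ j *s N j)" by (simp add: vec.scale_left_distrib sum.distrib)
    finally show "x + y = \<dots>" .
  next
    fix c x assume "x \<in> {v. v = (\<Sum>j\<in>I. v $ j *s N j)}"
    then have x: "x = (\<Sum>j\<in>I. x $ j *s N j)" by simp
    have "c *s x = c *s (\<Sum>j\<in>I. x $ j *s N j)" by (rule arg_cong[OF x])
    also have "\<dots> = (\<Sum>j\<in>I. (c *s x) $ j *s N j)" by (simp add: vec.scale_sum_right)
    finally show "c *s x = \<dots>" .
  qed simp
  show inN: "N j \<in> frame_space I N" if "j \<in> I" for j
  proof -
    have "(\<Sum>i\<in>I. N j $ i *s N i) = (\<Sum>i\<in>I. if i = j then N i else 0)"
      by (intro sum.cong) (auto simp: N that)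
    then show ?thesis using that by (simp add: frame_space_def)
  qed
  let ?D = "{x :: 'k^'n. \<forall>i. i \<notin> I \<longrightarrow> x $ i = 0}"
  define a :: "'k^'n^'n" where "a = (\<chi> i j. if j \<in> I then N j $ i else 0)"
  have a: "a *v x = (\<Sum>j\<in>I. x $ j *s N j)" for x
  proof -
    have "(\<Sum>j\<in>UNIV. (if j \<in> I then N j $ i else 0) * x $ j) = (\<Sum>j\<in>I. x $ j * N j $ i)" for i
      by (rule sum.mono_neutral_cong_right) (auto simp: mult.commute)
    then show ?thesis by (simp add: vec_eq_iff a_def matrix_vector_mult_def)
  qed
  have coord: "(a *v x) $ l = x $ l" if "l \<in> I" for x l
  proof -
    have "(\<Sum>j\<in>I. x $ j * N j $ l) = (\<Sum>j\<in>I. if j = l then x $ j else 0)"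
      by (intro sum.cong) (auto simp: N that)
    then show ?thesis using that by (simp add: a)
  qed
  have "inj_on ((*v) a) ?D"
  proof (rule inj_onI)
    fix x y assume xy: "x \<in> ?D" "y \<in> ?D" "a *v x = a *v y"
    have "x $ l = y $ l" for l using xy coord[of l x] coord[of l y] by (cases "l \<in> I") auto
    then show "x = y" by (simp add: vec_eq_iff)
  qed
  moreover have "vec.subspace ?D" by (auto simp: vec.subspace_def)
  ultimately have "vec.dim ((*v) a ` ?D) = vec.dim ?D"
    by (intro vec.dim_image_eq[OF matrix_vector_mul_linear_gen]) (simp add: vec.span_eq_iff[THEN iffD2])
  moreover have "(*v) a ` ?D = frame_space I N"
  proof
    show "(*v) a ` ?D \<subseteq> frame_space I N"
    proof clarify
      fix x :: "'k^'n" assume "\<forall>i. i \<notin> I \<longrightarrow> x $ i = 0"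
      have "(\<Sum>j\<in>I. (a *v x) $ j *s N j) = (\<Sum>j\<in>I. x $ j *s N j)" by (intro sum.cong) (auto simp: coord)
      then show "a *v x \<in> frame_space I N" by (simp add: frame_space_def a)
    qed
    show "frame_space I N \<subseteq> (*v) a ` ?D"
    proof
      fix v assume v: "v \<in> frame_space I N"
      let ?x = "\<chi> j. if j \<in> I then v $ j else 0"
      have "a *v ?x = (\<Sum>j\<in>I. v $ j *s N j)" unfolding a by (intro sum.cong) auto
      then have "v = a *v ?x" using v by (simp add: frame_space_def)
      then show "v \<in> (*v) a ` ?D" by auto
    qed
  qed
  ultimately show "vec.dim (frame_space I N) = card I" by (simp add: dim_substandard_cart)
qed

lemma frame_space_eq:
  assumes N: "\<And>j l. j \<in> I \<Longrightarrow> l \<in> I \<Longrightarrow> N j $ l = (if l = j then 1 else 0)"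
    and V: "vec.subspace V" "vec.dim V = card I" "\<And>j. j \<in> I \<Longrightarrow> N j \<in> V"
  shows "frame_space I N = V"
proof (rule vec.subspace_dim_equal)
  show "frame_space I N \<subseteq> V"
  proof
    fix v assume "v \<in> frame_space I N"
    then have "v = (\<Sum>j\<in>I. v $ j *s N j)" by (simp add: frame_space_def)
    also have "\<dots> \<in> V" using V by (intro vec.subspace_sum vec.subspace_scale) auto
    finally show "v \<in> V" .
  qed
qed (use frame_space[OF N] V in auto)

text \<open>Gaussian elimination over the valuation ring, pivoting on an entry that divides all the others.\<close>

lemma (in place) integral_frame:
  fixes V :: "'p \<Rightarrow> ('k^'n) set"
  assumes V: "eventually (\<lambda>s. vec.subspace (V s) \<and> vec.dim (V s) = k) F" and m: "m \<le> k"
  shows "\<exists>I N. card I = m \<and> eventually (\<lambda>s. \<forall>j\<in>I. N j s \<in> V s) F \<and> (\<forall>j\<in>I. \<forall>l. \<exists>a. (\<lambda>s. N j s $ l, a) \<in> G) \<and>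
    eventually (\<lambda>s. \<forall>j\<in>I. \<forall>l\<in>I. N j s $ l = (if l = j then 1 else 0)) F"
  using m
proof (induction m)
  case 0
  show ?case by (rule exI[of _ "{}"]) simp
next
  case (Suc m)
  then obtain I N where I: "card I = m" and NV: "eventually (\<lambda>s. \<forall>j\<in>I. N j s \<in> V s) F"
    and NG: "\<And>j l. j \<in> I \<Longrightarrow> \<exists>a. (\<lambda>s. N j s $ l, a) \<in> G"
    and Nd: "eventually (\<lambda>s. \<forall>j\<in>I. \<forall>l\<in>I. N j s $ l = (if l = j then 1 else 0)) F" by auto
  let ?Q = "\<lambda>s. vec.subspace (V s) \<and> vec.dim (V s) = k"
  have "\<forall>s. \<exists>w. ?Q s \<longrightarrow> w \<in> V s \<and> w \<noteq> 0 \<and> (\<forall>l\<in>I. w $ l = 0)"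
    using subspace_vanishing_coordinates[of _ I] I Suc.prems by (metis Suc_le_eq)
  then obtain w where w: "\<And>s. ?Q s \<Longrightarrow> w s \<in> V s" "\<And>s. ?Q s \<Longrightarrow> w s \<noteq> 0" "\<And>s l. ?Q s \<Longrightarrow> l \<in> I \<Longrightarrow> w s $ l = 0"
    by metis
  have "eventually (\<lambda>s. \<exists>i\<in>UNIV. w s $ i \<noteq> 0) F"
    using V by eventually_elim (use w(2) in \<open>auto simp: vec_eq_iff\<close>)
  then obtain i0 where i0: "eventually (\<lambda>s. w s $ i0 \<noteq> 0) F" "\<And>l. \<exists>a. (\<lambda>s. w s $ l / w s $ i0, a) \<in> G"
    using max_coordinate[of UNIV "\<lambda>i s. w s $ i"] by auto
  have "i0 \<notin> I"
  proof
    assume "i0 \<in> I"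
    have "eventually (\<lambda>_. False) F" using V i0(1) by eventually_elim (use w(3) \<open>i0 \<in> I\<close> in auto)
    then show False using nontrivial by (simp add: trivial_limit_def)
  qed
  define u where "u s = (1 / w s $ i0) *s w s" for s
  \<comment> \<open>The new vector \<open>u\<close> is 1 at the pivot \<open>i0\<close> and 0 at the
    old pivots, so subtracting its multiples clears coordinate \<open>i0\<close> without disturbing
    the others. All entries stay in the valuation ring.\<close>
  define N' where "N' j s = (if j = i0 then u s else N j s - N j s $ i0 *s u s)" for j s
  have uG: "\<exists>a. (\<lambda>s. u s $ l, a) \<in> G" for l using i0(2)[of l] by (simp add: u_def)
  show ?case
  proof (intro exI[of _ "insert i0 I"] exI[of _ N'] conjI)
    have "finite I" by simp
    then show "card (insert i0 I) = Suc m" using I \<open>i0 \<notin> I\<close> by simp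
    show "eventually (\<lambda>s. \<forall>j\<in>insert i0 I. N' j s \<in> V s) F"
      using V NV
    proof eventually_elim
      case (elim s)
      have "u s \<in> V s" using elim w(1)[of s] unfolding u_def by (intro vec.subspace_scale) auto
      then show ?case using elim by (auto simp: N'_def intro!: vec.subspace_diff vec.subspace_scale)
    qed
    show "\<forall>j\<in>insert i0 I. \<forall>l. \<exists>a. (\<lambda>s. N' j s $ l, a) \<in> G"
    proof (intro ballI allI)
      fix j l assume j: "j \<in> insert i0 I"
      obtain b where b: "(\<lambda>s. u s $ l, b) \<in> G" using uG by blast
      show "\<exists>a. (\<lambda>s. N' j s $ l, a) \<in> G"
      proof (cases "j = i0")
        case True
        then show ?thesis using b by (auto simp: N'_def)
      next
        case False
        then have "j \<in> I" using j by simp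
        then obtain a c where "(\<lambda>s. N j s $ l, a) \<in> G" "(\<lambda>s. N j s $ i0, c) \<in> G" using NG by metis
        from diff[OF this(1) mult[OF this(2) b]] show ?thesis using False by (auto simp: N'_def)
      qed
    qed
    show "eventually (\<lambda>s. \<forall>j\<in>insert i0 I. \<forall>l\<in>insert i0 I. N' j s $ l = (if l = j then 1 else 0)) F"
      using V Nd i0(1)
    proof eventually_elim
      case (elim s)
      have "u s $ i0 = 1" "\<And>l. l \<in> I \<Longrightarrow> u s $ l = 0" using elim w(3)[of s] by (auto simp: u_def)
      then show ?case using elim(2) \<open>i0 \<notin> I\<close> by (auto simp: N'_def)
    qed
  qed
qed

text \<open>Almost every \<open>V s\<close> is the frame space of an integral frame, so invariance
  becomes a set of identities between entries that have values, and these specialize.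
  \<open>V0\<close> is fixed before \<open>a\<close>, so that one subspace serves all matrices of a
  tuple.\<close>

lemma (in place) invariant_subspace_specializes:
  fixes V :: "'p \<Rightarrow> ('k^'n) set"
  assumes V: "eventually (\<lambda>s. vec.subspace (V s) \<and> vec.dim (V s) = k) F"
  shows "\<exists>V0. vec.subspace V0 \<and> vec.dim V0 = k \<and>
    (\<forall>a a0. (\<forall>i j. (\<lambda>s. a s $ i $ j, a0 $ i $ j) \<in> G) \<longrightarrow> eventually (\<lambda>s. stabilizes (a s) (V s)) F \<longrightarrow> stabilizes a0 V0)"
proof -
  obtain I N where I: "card I = k" and NV: "eventually (\<lambda>s. \<forall>j\<in>I. N j s \<in> V s) F"
    and NG: "\<And>j l. j \<in> I \<Longrightarrow> \<exists>a. (\<lambda>s. N j s $ l, a) \<in> G"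
    and Nd: "eventually (\<lambda>s. \<forall>j\<in>I. \<forall>l\<in>I. N j s $ l = (if l = j then 1 else 0)) F"
    using integral_frame[OF V order_refl] by auto
  obtain b where b: "\<And>j l. j \<in> I \<Longrightarrow> (\<lambda>s. N j s $ l, b j l) \<in> G" using NG by metis
  define N0 where "N0 j = (\<chi> l. b j l)" for j
  have N0: "N0 j $ l = (if l = j then 1 else 0)" if "j \<in> I" "l \<in> I" for j l
  proof -
    have "eventually (\<lambda>s. N j s $ l = (if l = j then 1 else 0)) F" using Nd by eventually_elim (use that in auto)
    from unique[OF b[OF that(1)] const this] show ?thesis by (simp add: N0_def)
  qed
  have frame: "eventually (\<lambda>s. frame_space I (\<lambda>j. N j s) = V s) F"
    using V NV Nd by eventually_elim (intro frame_space_eq; use I in auto)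
  have "stabilizes a0 (frame_space I N0)"
    if a: "\<And>i j. (\<lambda>s. a s $ i $ j, a0 $ i $ j) \<in> G" "eventually (\<lambda>s. stabilizes (a s) (V s)) F" for a a0
  proof -
    have basis: "a0 *v N0 j \<in> frame_space I N0" if j: "j \<in> I" for j
    proof -
      have aN: "(\<lambda>s. (a s *v N j s) $ l, (a0 *v N0 j) $ l) \<in> G" for l
        unfolding matrix_vector_mult_def by (simp add: N0_def) (intro sum mult a(1) b j)
      have "(a0 *v N0 j) $ i = (\<Sum>l\<in>I. (a0 *v N0 j) $ l * N0 l $ i)" for i
      proof (rule unique[OF aN])
        show "(\<lambda>s. \<Sum>l\<in>I. (a s *v N j s) $ l * N l s $ i, \<Sum>l\<in>I. (a0 *v N0 j) $ l * N0 l $ i) \<in> G"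
          using b by (intro sum mult aN) (simp add: N0_def)
        show "eventually (\<lambda>s. (a s *v N j s) $ i = (\<Sum>l\<in>I. (a s *v N j s) $ l * N l s $ i)) F"
          using frame NV a(2)
        proof eventually_elim
          case (elim s)
          have "a s *v N j s \<in> frame_space I (\<lambda>j. N j s)" using elim j by (auto simp: stabilizes_def)
          then have "a s *v N j s = (\<Sum>l\<in>I. (a s *v N j s) $ l *s N l s)" by (simp add: frame_space_def)
          then have "(a s *v N j s) $ i = (\<Sum>l\<in>I. (a s *v N j s) $ l *s N l s) $ i" by (rule arg_cong)
          then show ?case by simp
        qed
      qed
      then show ?thesis
        unfolding frame_space_def mem_Collect_eq vec_eq_iff sum_component vector_smult_component by blast
    qed
    have "a0 *v v \<in> frame_space I N0" if "v \<in> frame_space I N0" for v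
    proof -
      have "v = (\<Sum>j\<in>I. v $ j *s N0 j)" using that by (simp add: frame_space_def)
      then have "a0 *v v = (\<Sum>j\<in>I. v $ j *s (a0 *v N0 j))" by (metis (no_types, lifting) sum.cong vec.sum vector_scalar_commute)
      also have "\<dots> \<in> frame_space I N0"
        using frame_space(1)[OF N0] basis by (intro vec.subspace_sum vec.subspace_scale) auto
      finally show ?thesis .
    qed
    then show ?thesis by (auto simp: stabilizes_def)
  qed
  then show ?thesis using frame_space(1,2)[OF N0] I by blast
qed

lemma closedin_set_X: "closedin tuple_zariski (set_X k :: (('k::alg_closed_field, 'n::finite) mat_pair ^ 'r::finite) set)"
proof (rule closedin_zariskiI)
  fix t :: "('k, 'n) mat_pair ^ 'r" assume t: "t \<in> tuple_zariski closure_of (set_X k)"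
  then obtain F and G :: "((('k, 'n) mat_pair ^ 'r \<Rightarrow> 'k) \<times> 'k) set" where "place F G"
    and ev: "eventually (\<lambda>s. s \<in> set_X k) F" and poly: "\<And>f. f \<in> poly_functions tuple_coords \<Longrightarrow> (f, f t) \<in> G"
    using place_at_closure_point[OF t] by blast
  interpret place F G by fact
  have "\<forall>s :: ('k, 'n) mat_pair ^ 'r. \<exists>V. s \<in> set_X k \<longrightarrow> vec.subspace V \<and> vec.dim V = k \<and>
      (\<forall>j. stabilizes (fst (s $ j)) V \<and> stabilizes (transpose (snd (s $ j))) V)"
    unfolding set_X_iff by blast
  from choice[OF this] obtain V where V: "\<forall>s :: ('k, 'n) mat_pair ^ 'r. s \<in> set_X k \<longrightarrow> vec.subspace (V s) \<and>
      vec.dim (V s) = k \<and> (\<forall>j. stabilizes (fst (s $ j)) (V s) \<and> stabilizes (transpose (snd (s $ j))) (V s))" ..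
  have "eventually (\<lambda>s. vec.subspace (V s) \<and> vec.dim (V s) = k) F"
    using ev by eventually_elim (use V in blast)
  from invariant_subspace_specializes[OF this]
  obtain V0 where V0: "vec.subspace V0" "vec.dim V0 = k" and stab: "\<And>a a0. (\<And>i j. (\<lambda>s. a s $ i $ j, a0 $ i $ j) \<in> G) \<Longrightarrow>
      eventually (\<lambda>s. stabilizes (a s) (V s)) F \<Longrightarrow> stabilizes a0 V0" by blast
  have "stabilizes (fst (t $ j)) V0" for j
    by (rule stab[of "\<lambda>s. fst (s $ j)"]) (rule poly[OF tuple_coords_poly(1)], use ev in eventually_elim, use V in blast)
  moreover have "stabilizes (transpose (snd (t $ j))) V0" for j
  proof (rule stab[of "\<lambda>s. transpose (snd (s $ j))"])
    show "(\<lambda>s. transpose (snd (s $ j)) $ i $ l, transpose (snd (t $ j)) $ i $ l) \<in> G" for i l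
      unfolding transpose_def vec_lambda_beta by (rule poly[OF tuple_coords_poly(2)])
    show "eventually (\<lambda>s. stabilizes (transpose (snd (s $ j))) (V s)) F"
      using ev by eventually_elim (use V in blast)
  qed
  ultimately show "t \<in> set_X k" unfolding set_X_iff using V0 by blast
qed

section \<open>Irreducibility of the components\<close>

definition stabilizes_coordinates :: "'n set \<Rightarrow> 'k::field^'n^'n \<Rightarrow> bool" where
  "stabilizes_coordinates I w \<longleftrightarrow> (\<forall>i j. i \<notin> I \<longrightarrow> j \<in> I \<longrightarrow> w $ i $ j = 0)"

lemma stabilizes_coordinates_iff:
  fixes w :: "'k::field^'n^'n::finite"
  shows "stabilizes_coordinates I w \<longleftrightarrow> stabilizes w {x. \<forall>i. i \<notin> I \<longrightarrow> x $ i = 0}"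
proof
  assume w: "stabilizes_coordinates I w"
  have "w $ i $ j * x $ j = 0" if "i \<notin> I" "\<forall>i. i \<notin> I \<longrightarrow> x $ i = 0" for i j and x :: "'k^'n"
    using w that unfolding stabilizes_coordinates_def by (cases "j \<in> I") auto
  then show "stabilizes w {x. \<forall>i. i \<notin> I \<longrightarrow> x $ i = 0}"
    by (auto simp: stabilizes_def matrix_vector_mult_def intro!: sum.neutral)
next
  assume w: "stabilizes w {x. \<forall>i. i \<notin> I \<longrightarrow> x $ i = 0}"
  have "w $ i $ j = 0" if "i \<notin> I" "j \<in> I" for i j
  proof -
    have "axis j 1 \<in> {x :: 'k^'n. \<forall>i. i \<notin> I \<longrightarrow> x $ i = 0}" using that by (auto simp: axis_def)
    then have "w *v axis j 1 \<in> {x. \<forall>i. i \<notin> I \<longrightarrow> x $ i = 0}" using w by (auto simp: stabilizes_def)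
    then have "(w *v axis j 1) $ i = 0" using that by blast
    then show ?thesis by (simp add: matrix_vector_mult_axis)
  qed
  then show "stabilizes_coordinates I w" by (simp add: stabilizes_coordinates_def)
qed

lemma subspace_image_coordinates:
  fixes V :: "('k::field^'n) set"
  assumes V: "vec.subspace V" "vec.dim V = card I"
  shows "\<exists>P. invertible P \<and> (*v) P ` {x :: 'k^'n. \<forall>i. i \<notin> I \<longrightarrow> x $ i = 0} = V"
proof -
  let ?D = "{x :: 'k^'n. \<forall>i. i \<notin> I \<longrightarrow> x $ i = 0}"
  obtain B where B: "B \<subseteq> V" "vec.independent B" "V \<subseteq> vec.span B" "card B = vec.dim V"
    by (rule vec.basis_exists)
  obtain B' where B': "B \<subseteq> B'" "vec.independent B'" "UNIV \<subseteq> vec.span B'"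
    by (rule vec.maximal_independent_subset_extend[OF subset_UNIV B(2)])
  have fin: "finite B'" "finite B" using B'(2) B(2) vec.finiteI_independent by auto
  have "card B' = CARD('n)"
    using vec.basis_card_eq_dim[OF subset_UNIV B'(3,2)] by (simp add: card_cart_basis)
  then have "card (B' - B) = card (UNIV - I)"
    using B(4) V(2) B'(1) fin by (simp add: card_Diff_subset)
  then obtain h' where h': "bij_betw h' (UNIV - I) (B' - B)"
    using finite_same_card_bij[of "UNIV - I" "B' - B"] fin by auto
  obtain h where h: "bij_betw h I B"
    using finite_same_card_bij[of I B] fin B(4) V(2) by auto
  define f where "f j = (if j \<in> I then h j else h' j)" for j
  have "bij_betw f I B" "bij_betw f (UNIV - I) (B' - B)"
    using h h' bij_betw_cong[of I f h B] bij_betw_cong[of "UNIV - I" f h' "B' - B"] by (auto simp: f_def)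
  then have "bij_betw f (I \<union> (UNIV - I)) (B \<union> (B' - B))" by (rule bij_betw_combine) auto
  then have f: "bij_betw f UNIV B'" using B'(1) by (simp add: Un_absorb1)
  define P :: "'k^'n^'n" where "P = (\<chi> i j. f j $ i)"
  have P: "P *v x = (\<Sum>j\<in>UNIV. x $ j *s f j)" for x
    by (simp add: vec_eq_iff P_def matrix_vector_mult_def mult.commute)
  have surj: "\<exists>x. P *v x = y" for y
  proof -
    have "y \<in> vec.span B'" using B'(3) by blast
    then obtain u where "y = (\<Sum>b\<in>B'. u b *s b)" using vec.span_finite[OF fin(1)] by auto
    also have "\<dots> = (\<Sum>j\<in>UNIV. u (f j) *s f j)" using sum.reindex_bij_betw[OF f, of "\<lambda>b. u b *s b"] by simp
    also have "\<dots> = P *v (\<chi> j. u (f j))" by (simp add: P)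
    finally show ?thesis by metis
  qed
  then have "\<exists>Q. P ** Q = mat 1" unfolding matrix_right_invertible_surjective surj_def by metis
  then have inv: "invertible P" by (simp add: invertible_right_inverse)
  have "inj ((*v) P)" using inv matrix_left_invertible_injective[of P] invertible_left_inverse[of P] by blast
  moreover have "vec.subspace ?D" by (auto simp: vec.subspace_def)
  ultimately have "vec.dim ((*v) P ` ?D) = vec.dim ?D"
    by (intro vec.dim_image_eq[OF matrix_vector_mul_linear_gen]) (auto intro: inj_on_subset)
  then have "vec.dim ((*v) P ` ?D) = vec.dim V" by (simp add: dim_substandard_cart V(2))
  moreover have "(*v) P ` ?D \<subseteq> V"
  proof clarify
    fix x :: "'k^'n" assume x: "\<forall>i. i \<notin> I \<longrightarrow> x $ i = 0"
    have "x $ j *s f j \<in> V" for j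
      using x V(1) B(1) \<open>bij_betw f I B\<close> by (cases "j \<in> I") (auto simp: bij_betw_def intro!: vec.subspace_scale vec.subspace_0)
    then show "P *v x \<in> V" unfolding P using V(1) by (intro vec.subspace_sum)
  qed
  moreover have "vec.subspace ((*v) P ` ?D)"
    using \<open>vec.subspace ?D\<close> by (intro vec.linear_subspace_image matrix_vector_mul_linear_gen)
  ultimately have "(*v) P ` ?D = V" using V(1) by (intro vec.subspace_dim_equal) auto
  then show ?thesis using inv by blast
qed

text \<open>Parametrizes \<open>set_X k\<close> by an invertible matrix and tuples from the linear
  space of matrices preserving a fixed coordinate subspace. Being linear, the latter condition
  persists along lines.\<close>

lemma set_X_conj_iff:
  fixes t :: "('k::field, 'n::finite) mat_pair ^ 'r::finite" and I :: "'n set"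
  assumes k: "k = card I"
  shows "t \<in> set_X k \<longleftrightarrow> (\<exists>P w u. invertible P \<and> (\<forall>j. stabilizes_coordinates I (w j) \<and> stabilizes_coordinates I (u j) \<and>
    fst (t $ j) = P ** w j ** matrix_inv P \<and> snd (t $ j) = transpose (P ** u j ** matrix_inv P)))"
proof
  let ?D = "{x :: 'k^'n. \<forall>i. i \<notin> I \<longrightarrow> x $ i = 0}"
  assume "t \<in> set_X k"
  then obtain V where V: "vec.subspace V" "vec.dim V = k"
    and t: "\<And>j. stabilizes (fst (t $ j)) V" "\<And>j. stabilizes (transpose (snd (t $ j))) V" unfolding set_X_iff by blast
  obtain P where P: "invertible P" "(*v) P ` ?D = V" using subspace_image_coordinates[OF V(1) V(2)[unfolded k]] by blast
  have stab: "stabilizes_coordinates I (matrix_inv P ** a ** P)" if a: "stabilizes a V" for a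
    unfolding stabilizes_coordinates_iff stabilizes_def
  proof (rule image_subsetI)
    fix x assume "x \<in> ?D"
    then have "a *v (P *v x) \<in> V" using P(2) a by (auto simp: stabilizes_def)
    then obtain y where y: "y \<in> ?D" "a *v (P *v x) = P *v y" using P(2) by blast
    have "(matrix_inv P ** a ** P) *v x = matrix_inv P *v (a *v (P *v x))"
      by (simp add: matrix_vector_mul_assoc matrix_mul_assoc)
    also have "\<dots> = y" using P(1) unfolding y(2) by (simp add: matrix_vector_mul_assoc matrix_inv_mult)
    finally show "(matrix_inv P ** a ** P) *v x \<in> ?D" using y(1) by simp
  qed
  have conj: "P ** (matrix_inv P ** a ** P) ** matrix_inv P = a" for a
  proof -
    have "P ** (matrix_inv P ** a ** P) ** matrix_inv P = (P ** matrix_inv P) ** a ** (P ** matrix_inv P)"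
      by (simp only: matrix_mul_assoc)
    then show ?thesis using P(1) by (simp add: matrix_inv_mult)
  qed
  show "\<exists>P w u. invertible P \<and> (\<forall>j. stabilizes_coordinates I (w j) \<and> stabilizes_coordinates I (u j) \<and>
    fst (t $ j) = P ** w j ** matrix_inv P \<and> snd (t $ j) = transpose (P ** u j ** matrix_inv P))"
    using stab[OF t(1)] stab[OF t(2)] P(1)
    by (intro exI[of _ P] exI[of _ "\<lambda>j. matrix_inv P ** fst (t $ j) ** P"]
        exI[of _ "\<lambda>j. matrix_inv P ** transpose (snd (t $ j)) ** P"]) (simp add: conj)
next
  let ?D = "{x :: 'k^'n. \<forall>i. i \<notin> I \<longrightarrow> x $ i = 0}"
  assume "\<exists>P w u. invertible P \<and> (\<forall>j. stabilizes_coordinates I (w j) \<and> stabilizes_coordinates I (u j) \<and>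
    fst (t $ j) = P ** w j ** matrix_inv P \<and> snd (t $ j) = transpose (P ** u j ** matrix_inv P))"
  then obtain P w u where P: "invertible P" and w: "\<And>j. stabilizes (w j) ?D" "\<And>j. stabilizes (u j) ?D"
    and t: "\<And>j. fst (t $ j) = P ** w j ** matrix_inv P" "\<And>j. snd (t $ j) = transpose (P ** u j ** matrix_inv P)"
    unfolding stabilizes_coordinates_iff by blast
  have D: "vec.subspace ?D" by (auto simp: vec.subspace_def)
  have "inj ((*v) P)" using P matrix_left_invertible_injective[of P] invertible_left_inverse[of P] by blast
  then have "vec.dim ((*v) P ` ?D) = vec.dim ?D"
    by (intro vec.dim_image_eq[OF matrix_vector_mul_linear_gen]) (auto intro: inj_on_subset)
  then have dim: "vec.dim ((*v) P ` ?D) = k" by (simp add: dim_substandard_cart k)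
  have stab: "stabilizes (P ** a ** matrix_inv P) ((*v) P ` ?D)" if a: "stabilizes a ?D" for a
    unfolding stabilizes_def
  proof (intro image_subsetI, elim imageE)
    fix v x assume x: "v = P *v x" "x \<in> ?D"
    have "(P ** a ** matrix_inv P) *v v = P *v (a *v x)"
    proof -
      have "(P ** a ** matrix_inv P) ** P = P ** a"
        using P by (simp add: matrix_mul_assoc[symmetric] matrix_inv_mult)
      then show ?thesis by (simp add: x(1) matrix_vector_mul_assoc)
    qed
    then show "(P ** a ** matrix_inv P) *v v \<in> (*v) P ` ?D" using a x(2) by (auto simp: stabilizes_def)
  qed
  have "vec.subspace ((*v) P ` ?D)" using D by (intro vec.linear_subspace_image matrix_vector_mul_linear_gen)
  then show "t \<in> set_X k" unfolding set_X_iff using dim stab w t by (intro exI[of _ "(*v) P ` ?D"]) simp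
qed

lemma rational_tuple_curve:
  assumes "\<And>j. matrix_rational_off d (\<lambda>x. fst (\<gamma> x $ j))" "\<And>j. matrix_rational_off d (\<lambda>x. snd (\<gamma> x $ j))"
  shows "\<forall>c\<in>tuple_coords. rational_off d (\<lambda>x. c (\<gamma> x))"
  using assms unfolding tuple_coords_def matrix_rational_off_def by auto

lemma det_line_poly:
  assumes "invertible A" "invertible (B :: 'k::field^'n^'n)"
  obtains d where "\<And>x. poly d x = det (matrix_line A B x)" "poly d 0 \<noteq> 0" "poly d 1 \<noteq> 0" "finite {x. \<not> invertible (matrix_line A B x)}"
proof -
  obtain d where d: "\<And>x. poly d x = det (matrix_line A B x)" using poly_det_line by blast
  have d01: "poly d 0 \<noteq> 0" "poly d 1 \<noteq> 0" using assms by (simp_all add: d invertible_det_nz)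
  then have "d \<noteq> 0" by auto
  then have "finite {x. poly d x = 0}" by (rule poly_roots_finite)
  then have "finite {x. \<not> invertible (matrix_line A B x)}" by (simp add: d invertible_det_nz)
  then show ?thesis using that d d01 by blast
qed

lemma irreducible_set_X:
  assumes "k \<le> CARD('n)"
  shows "irreducible_space (subtopology tuple_zariski (set_X k :: (('k::alg_closed_field, 'n::finite) mat_pair ^ 'r::finite) set))"
proof (rule irreducible_by_curves)
  obtain I :: "'n set" where I: "card I = k" using obtain_subset_with_card_n[OF assms] by blast
  note iff = set_X_conj_iff[OF I[symmetric]]
  have "0 \<in> (set_X k :: (('k, 'n) mat_pair ^ 'r) set)"
    unfolding iff by (intro exI[of _ "mat 1"] exI[of _ "\<lambda>_. 0"]) (simp add: stabilizes_coordinates_def transpose_0 invertible_det_nz)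
  then show "set_X k \<noteq> ({} :: (('k, 'n) mat_pair ^ 'r) set)" by blast
  fix s t :: "('k, 'n) mat_pair ^ 'r" assume "s \<in> set_X k" "t \<in> set_X k"
  then obtain P w u Q v z where P: "invertible P" and s: "\<And>j. stabilizes_coordinates I (w j)" "\<And>j. stabilizes_coordinates I (u j)"
      "\<And>j. fst (s $ j) = P ** w j ** matrix_inv P" "\<And>j. snd (s $ j) = transpose (P ** u j ** matrix_inv P)"
    and Q: "invertible Q" and t: "\<And>j. stabilizes_coordinates I (v j)" "\<And>j. stabilizes_coordinates I (z j)"
      "\<And>j. fst (t $ j) = Q ** v j ** matrix_inv Q" "\<And>j. snd (t $ j) = transpose (Q ** z j ** matrix_inv Q)"
    unfolding iff by metis
  obtain d where d: "\<And>x. poly d x = det (matrix_line P Q x)" "poly d 0 \<noteq> 0" "poly d 1 \<noteq> 0"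
    and fin: "finite {x. \<not> invertible (matrix_line P Q x)}" using det_line_poly[OF P Q] by blast
  define conj where "conj A B x = matrix_line P Q x ** matrix_line A B x ** matrix_inv (matrix_line P Q x)" for A B x
  have rat: "matrix_rational_off d (conj A B)" for A B
    unfolding conj_def
    by (intro matrix_rational_off_mult matrix_rational_off_line matrix_rational_off_inv_line d(1))
  define \<gamma> :: "'k \<Rightarrow> ('k, 'n) mat_pair ^ 'r" where
    "\<gamma> x = (\<chi> j. (conj (w j) (v j) x, transpose (conj (u j) (z j) x)))" for x
  have "\<gamma> 0 = s" "\<gamma> 1 = t" using s t by (simp_all add: \<gamma>_def conj_def vec_eq_iff prod_eq_iff)
  moreover have "\<forall>c\<in>tuple_coords. rational_off d (\<lambda>x. c (\<gamma> x))"
    by (rule rational_tuple_curve) (simp_all add: \<gamma>_def rat matrix_rational_off_transpose)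
  moreover have "\<gamma> x \<in> set_X k" if "invertible (matrix_line P Q x)" for x
    unfolding iff using that s t
    by (intro exI[of _ "matrix_line P Q x"] exI[of _ "\<lambda>j. matrix_line (w j) (v j) x"] exI[of _ "\<lambda>j. matrix_line (u j) (z j) x"])
       (simp add: \<gamma>_def conj_def stabilizes_coordinates_def matrix_line_def)
  then have "finite {x. \<gamma> x \<notin> set_X k}" by (intro finite_subset[OF _ fin]) blast
  ultimately show "\<exists>\<gamma> d. \<gamma> 0 = s \<and> \<gamma> 1 = t \<and> poly d 0 \<noteq> 0 \<and> poly d 1 \<noteq> 0 \<and>
      (\<forall>c\<in>tuple_coords. rational_off d (\<lambda>x. c (\<gamma> x))) \<and> finite {x. \<gamma> x \<notin> set_X k}"
    using d(2,3) by blast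
qed

lemma conj_curve:
  fixes p q :: "'k::alg_closed_field^'n^'n::finite" and a b :: "'k^'n^'n^'r::finite"
  assumes p: "invertible p" and q: "invertible q"
  defines "\<gamma> \<equiv> \<lambda>x. \<chi> j. (matrix_line (a $ j) (b $ j) x,
    matrix_line p q x ** matrix_line (a $ j) (b $ j) x ** matrix_inv (matrix_line p q x))"
  obtains d where "poly d 0 \<noteq> 0" "poly d 1 \<noteq> 0" "\<forall>c\<in>tuple_coords. rational_off d (\<lambda>x. c (\<gamma> x))"
    "finite {x. \<not> invertible (matrix_line p q x)}"
proof -
  obtain d where d: "\<And>x. poly d x = det (matrix_line p q x)" "poly d 0 \<noteq> 0" "poly d 1 \<noteq> 0"
    and fin: "finite {x. \<not> invertible (matrix_line p q x)}" using det_line_poly[OF p q] by blast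
  have "\<forall>c\<in>tuple_coords. rational_off d (\<lambda>x. c (\<gamma> x))"
    by (rule rational_tuple_curve)
       (simp_all add: \<gamma>_def matrix_rational_off_line matrix_rational_off_mult matrix_rational_off_inv_line d(1))
  then show ?thesis using that d fin by blast
qed

text \<open>Common form of the argument for \<open>set_Y\<close> and \<open>set_Y'\<close>. Being
  alternating is a linear condition, but not being alternating is an open one, hence the finitely
  many exceptions allowed on each line.\<close>

lemma irreducible_conjugate_tuples:
  fixes Q :: "'k::alg_closed_field^'n^'n \<Rightarrow> bool"
  defines "S \<equiv> {t :: ('k, 'n::finite) mat_pair ^ 'r::finite. \<exists>p. invertible p \<and> Q p \<and> (\<forall>j. p ** fst (t $ j) ** matrix_inv p = snd (t $ j))}"
  assumes ne: "invertible p0" "Q p0"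
    and line: "\<And>p q. Q p \<Longrightarrow> Q q \<Longrightarrow> finite {x. \<not> Q (matrix_line p q x)}"
  shows "irreducible_space (subtopology tuple_zariski S)"
proof (rule irreducible_by_curves)
  have "(\<chi> j. (0, 0)) \<in> S" using ne by (auto simp: S_def)
  then show "S \<noteq> {}" by blast
  fix s t assume "s \<in> S" "t \<in> S"
  then obtain p q where p: "invertible p" "Q p" "\<And>j. p ** fst (s $ j) ** matrix_inv p = snd (s $ j)"
    and q: "invertible q" "Q q" "\<And>j. q ** fst (t $ j) ** matrix_inv q = snd (t $ j)" unfolding S_def by blast
  define a :: "'k^'n^'n^'r" where "a = (\<chi> j. fst (s $ j))"
  define b :: "'k^'n^'n^'r" where "b = (\<chi> j. fst (t $ j))"
  define \<gamma> :: "'k \<Rightarrow> ('k, 'n) mat_pair ^ 'r" where "\<gamma> = (\<lambda>x. \<chi> j. (matrix_line (a $ j) (b $ j) x,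
    matrix_line p q x ** matrix_line (a $ j) (b $ j) x ** matrix_inv (matrix_line p q x)))"
  obtain d where d: "poly d 0 \<noteq> 0" "poly d 1 \<noteq> 0" "\<forall>c\<in>tuple_coords. rational_off d (\<lambda>x. c (\<gamma> x))"
    and fin: "finite {x. \<not> invertible (matrix_line p q x)}"
    unfolding \<gamma>_def using conj_curve[OF p(1) q(1), of a b] by blast
  have "\<gamma> 0 = s" "\<gamma> 1 = t" using p q by (simp_all add: \<gamma>_def a_def b_def vec_eq_iff prod_eq_iff)
  moreover have "\<gamma> x \<in> S" if "invertible (matrix_line p q x)" "Q (matrix_line p q x)" for x
    using that by (auto simp: S_def \<gamma>_def)
  then have "finite {x. \<gamma> x \<notin> S}"
    by (intro finite_subset[OF _ finite_UnI[OF fin line[OF p(2) q(2)]]]) blast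
  ultimately show "\<exists>\<gamma> d. \<gamma> 0 = s \<and> \<gamma> 1 = t \<and> poly d 0 \<noteq> 0 \<and> poly d 1 \<noteq> 0 \<and>
      (\<forall>c\<in>tuple_coords. rational_off d (\<lambda>x. c (\<gamma> x))) \<and> finite {x. \<gamma> x \<notin> S}"
    using d by blast
qed

section \<open>Alternating and symmetric matrices along lines\<close>

lemma alternating_matrix_iff: "alternating_matrix p \<longleftrightarrow> (\<forall>i j. p $ j $ i + p $ i $ j = 0) \<and> (\<forall>i. p $ i $ i = 0)"
  unfolding alternating_matrix_def vec_eq_iff by (simp add: transpose_def eq_neg_iff_add_eq_0)

lemma alternating_matrix_line:
  "alternating_matrix p \<Longrightarrow> alternating_matrix q \<Longrightarrow> alternating_matrix (matrix_line p q x)"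
proof -
  assume pq: "alternating_matrix p" "alternating_matrix q"
  have "matrix_line p q x $ j $ i + matrix_line p q x $ i $ j =
      (1 - x) * (p $ j $ i + p $ i $ j) + x * (q $ j $ i + q $ i $ j)" for i j
    by (simp add: matrix_line_def algebra_simps)
  then show ?thesis using pq unfolding alternating_matrix_iff by (simp add: matrix_line_def)
qed

lemma finite_alternating_line:
  assumes "\<not> alternating_matrix p"
  shows "finite {x. alternating_matrix (matrix_line p q x)}"
proof -
  let ?e = "\<lambda>i j. [:p $ i $ j, q $ i $ j - p $ i $ j:]"
  consider i j where "p $ j $ i + p $ i $ j \<noteq> 0" | i where "p $ i $ i \<noteq> 0"
    using assms unfolding alternating_matrix_iff by blast
  then obtain c where c: "poly c 0 \<noteq> 0" "\<And>x. alternating_matrix (matrix_line p q x) \<Longrightarrow> poly c x = 0"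
  proof cases
    case (1 i j)
    show ?thesis
    proof (rule that[of "?e j i + ?e i j"])
      show "poly (?e j i + ?e i j) x = 0" if "alternating_matrix (matrix_line p q x)" for x
        using that unfolding alternating_matrix_iff poly_add matrix_line_entry[symmetric] by blast
    qed (use 1 in simp)
  next
    case (2 i)
    show ?thesis
    proof (rule that[of "?e i i"])
      show "poly (?e i i) x = 0" if "alternating_matrix (matrix_line p q x)" for x
        using that unfolding alternating_matrix_iff matrix_line_entry by simp
    qed (use 2 in simp)
  qed
  then have "c \<noteq> 0" by auto
  then have "finite {x. poly c x = 0}" by (rule poly_roots_finite)
  then show ?thesis by (rule finite_subset[rotated]) (use c(2) in blast)
qed

lemma symmetric_matrix_line:
  "symmetric_matrix p \<Longrightarrow> symmetric_matrix q \<Longrightarrow> symmetric_matrix (matrix_line p q x)"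
  unfolding symmetric_matrix_def vec_eq_iff by (simp add: transpose_def matrix_line_def)

lemma not_alternating_mat_1: "\<not> alternating_matrix (mat 1 :: 'k::field^'n^'n)"
  by (simp add: alternating_matrix_def mat_def)

lemma irreducible_set_Y:
  "irreducible_space (subtopology tuple_zariski (set_Y :: (('k::alg_closed_field, 'n::finite) mat_pair ^ 'r::finite) set))"
proof -
  have "irreducible_space (subtopology tuple_zariski {t :: ('k, 'n) mat_pair ^ 'r.
    \<exists>p. invertible p \<and> (symmetric_matrix p \<and> \<not> alternating_matrix p) \<and> (\<forall>j. p ** fst (t $ j) ** matrix_inv p = snd (t $ j))})"
  proof (rule irreducible_conjugate_tuples[of "mat 1"])
    fix p q :: "'k^'n^'n"
    assume "symmetric_matrix p \<and> \<not> alternating_matrix p" "symmetric_matrix q \<and> \<not> alternating_matrix q"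
    then show "finite {x. \<not> (symmetric_matrix (matrix_line p q x) \<and> \<not> alternating_matrix (matrix_line p q x))}"
      using finite_alternating_line[of p q] by (simp add: symmetric_matrix_line)
  qed (simp_all add: not_alternating_mat_1 symmetric_matrix_def transpose_mat invertible_det_nz)
  then show ?thesis by (simp add: set_Y_def conj_assoc)
qed

lemma irreducible_set_Y':
  fixes p0 :: "'k::alg_closed_field^'n^'n::finite"
  assumes "invertible p0" "alternating_matrix p0"
  shows "irreducible_space (subtopology tuple_zariski (set_Y' :: (('k, 'n) mat_pair ^ 'r::finite) set))"
  unfolding set_Y'_def
  by (rule irreducible_conjugate_tuples[of p0]) (simp_all add: assms alternating_matrix_line)

lemma set_Y'_subset_closure_Y:
  assumes char: "CHAR('k) = 2"
  shows "set_Y' \<subseteq> tuple_zariski closure_of (set_Y :: (('k::alg_closed_field, 'n::finite) mat_pair ^ 'r::finite) set)"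
proof
  fix t :: "('k, 'n) mat_pair ^ 'r" assume "t \<in> set_Y'"
  then obtain p where p: "invertible p" "alternating_matrix p" "\<And>j. p ** fst (t $ j) ** matrix_inv p = snd (t $ j)"
    unfolding set_Y'_def by blast
  have "(2 :: 'k) = 0" using of_nat_CHAR[where 'a='k] char by simp
  then have neg: "- z = z" for z :: 'k
    by (metis add.right_inverse eq_neg_iff_add_eq_0 mult_2 mult_zero_left)
  \<comment> \<open>Chosen so that \<open>matrix_line p q x\<close> is \<open>p\<close> plus
    \<open>x\<close> times the identity; its diagonal is constantly \<open>x\<close>, so it is
    alternating at \<open>x = 0\<close> only.\<close>
  define q where "q = p + mat 1"
  have q: "matrix_line p q x $ i $ j = p $ i $ j + (if i = j then x else 0)" for x i j
    by (simp add: matrix_line_def q_def mat_def algebra_simps)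
  have sym: "symmetric_matrix (matrix_line p q x)" for x
  proof -
    have "p $ j $ i = p $ i $ j" for i j
      using p(2) neg unfolding alternating_matrix_iff by (metis eq_neg_iff_add_eq_0)
    then show ?thesis unfolding symmetric_matrix_def vec_eq_iff transpose_def vec_lambda_beta q by auto
  qed
  have nonalt: "\<not> alternating_matrix (matrix_line p q x)" if "x \<noteq> 0" for x
    using that p(2) unfolding alternating_matrix_def by (simp add: q)
  obtain d where d: "\<And>x. poly d x = det (matrix_line p q x)" using poly_det_line by blast
  have d0: "poly d 0 \<noteq> 0" using p(1) by (simp add: d invertible_det_nz)
  then have "d \<noteq> 0" by auto
  then have fin: "finite {x. poly d x = 0}" by (rule poly_roots_finite)
  define \<gamma> :: "'k \<Rightarrow> ('k, 'n) mat_pair ^ 'r" where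
    "\<gamma> x = (\<chi> j. (fst (t $ j), matrix_line p q x ** fst (t $ j) ** matrix_inv (matrix_line p q x)))" for x
  have const: "matrix_rational_off d (\<lambda>_. fst (t $ j))" for j
    unfolding matrix_rational_off_def by blast
  have "\<gamma> 0 \<in> tuple_zariski closure_of set_Y"
  proof (rule curve_in_closure)
    show "rational_off d (\<lambda>x. c (\<gamma> x))" if "c \<in> tuple_coords" for c
    proof -
      have "\<forall>c\<in>tuple_coords. rational_off d (\<lambda>x. c (\<gamma> x))"
        by (rule rational_tuple_curve)
           (simp_all add: \<gamma>_def const matrix_rational_off_line matrix_rational_off_mult matrix_rational_off_inv_line d)
      then show ?thesis using that by blast
    qed
    show "poly d 0 \<noteq> 0" by (rule d0)
    have "\<gamma> x \<in> set_Y" if "poly d x \<noteq> 0" "x \<noteq> 0" for x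
      unfolding set_Y_def using that sym nonalt
      by (intro CollectI exI[of _ "matrix_line p q x"]) (simp add: \<gamma>_def d invertible_det_nz)
    then have "{x. \<gamma> x \<notin> set_Y} \<subseteq> insert 0 {x. poly d x = 0}" by blast
    then show "finite {x. \<gamma> x \<notin> set_Y}" using fin finite_subset by blast
  qed
  moreover have "\<gamma> 0 = t" using p(3) by (simp add: \<gamma>_def vec_eq_iff prod_eq_iff)
  ultimately show "t \<in> tuple_zariski closure_of set_Y" by simp
qed

lemma two_nonzero:
  assumes "CHAR('k::field) \<noteq> 2"
  shows "(2 :: 'k) \<noteq> 0"
proof
  assume "(2 :: 'k) = 0"
  then have "of_nat 2 = (0 :: 'k)" by simp
  then have "CHAR('k) dvd 2" unfolding of_nat_eq_0_iff_char_dvd .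
  then have "CHAR('k) \<le> 2" by (auto dest: dvd_imp_le)
  moreover have "CHAR('k) \<noteq> 1" by simp
  moreover have "CHAR('k) \<noteq> 0" using \<open>CHAR('k) dvd 2\<close> by (intro notI) simp
  ultimately show False using assms by linarith
qed

text \<open>For odd size the determinant of a skew matrix equals its negative, and 2 is
  invertible.\<close>

lemma set_Y'_empty:
  assumes odd: "odd CARD('n)" and char: "CHAR('k) \<noteq> 2"
  shows "set_Y' = ({} :: (('k::field, 'n::finite) mat_pair ^ 'r::finite) set)"
proof -
  have False if p: "invertible p" "alternating_matrix p" for p :: "'k^'n^'n"
  proof -
    have "transpose p = (\<chi> i. (- 1) *s p $ i)" using p(2) unfolding alternating_matrix_def by (simp add: vec_eq_iff)
    then have "det p = det (\<chi> i. (- 1) *s p $ i)" by (metis det_transpose)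
    also have "\<dots> = (- 1) ^ CARD('n) * det p" by (subst det_rows_mul) simp
    finally have "det p = - det p" using odd by simp
    then have "det p + det p = 0" by (simp add: eq_neg_iff_add_eq_0)
    then have "2 * det p = 0" by (simp only: mult_2)
    then show False using two_nonzero[OF char] p(1) by (simp add: invertible_det_nz)
  qed
  then show ?thesis unfolding set_Y'_def by blast
qed

section \<open>Witnesses\<close>

text \<open>An arbitrary numbering from 0, which gives the unordered index type the order that
  shifts and flags need.\<close>

definition enum :: "'n::finite \<Rightarrow> nat" where
  "enum = (SOME e. bij_betw e UNIV {..<CARD('n)})"

lemma bij_enum: "bij_betw (enum :: 'n \<Rightarrow> nat) UNIV {..<CARD('n::finite)}"
proof -
  have "\<exists>e. bij_betw e (UNIV :: 'n set) {..<CARD('n)}"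
    using ex_bij_betw_finite_nat[of "UNIV :: 'n set"] by (simp add: atLeast0LessThan)
  then show ?thesis unfolding enum_def by (rule someI_ex)
qed

lemma enum_less: "enum (i :: 'n::finite) < CARD('n)"
  using bij_enum by (auto simp: bij_betw_def)

lemma enum_eq_iff [simp]: "enum i = enum j \<longleftrightarrow> i = j"
  using bij_enum by (auto simp: bij_betw_def inj_on_def)

lemma enum_surj: "m < CARD('n) \<Longrightarrow> \<exists>i :: 'n::finite. enum i = m"
  using bij_enum[where 'n='n] by (metis bij_betw_def imageE lessThan_iff)

text \<open>This is zero for \<open>m \<ge> CARD('n)\<close>.\<close>

definition basis_vector :: "nat \<Rightarrow> 'k::field^'n::finite" where
  "basis_vector m = (\<chi> i. if enum i = m then 1 else 0)"

lemma basis_vector_enum: "basis_vector (enum i) = axis i 1"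
  by (simp add: basis_vector_def axis_def vec_eq_iff)

lemma basis_vector_eq_0: "CARD('n) \<le> m \<Longrightarrow> basis_vector m = (0 :: 'k::field^'n::finite)"
  using enum_less[where 'n='n] by (auto simp: basis_vector_def vec_eq_iff dest: leD)

definition shift :: "'k::field^'n^'n::finite" where
  "shift = (\<chi> i j. if enum j = Suc (enum i) then 1 else 0)"

text \<open>Sends each basis vector to its successor, except that the arrow into index
  \<open>k\<close> is removed. For \<open>k = 0\<close> nothing is removed, since index 0 has no
  predecessor.\<close>

definition lower_shift :: "nat \<Rightarrow> 'k::field^'n^'n::finite" where
  "lower_shift k = (\<chi> i j. if enum i = Suc (enum j) \<and> enum i \<noteq> k then 1 else 0)"

lemma transpose_shift: "transpose shift = lower_shift 0"
  by (auto simp: vec_eq_iff transpose_def shift_def lower_shift_def)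

lemma lower_shift_basis_vector:
  "lower_shift k *v basis_vector m = (if Suc m = k then 0 else basis_vector (Suc m) :: 'k::field^'n::finite)"
proof (cases "m < CARD('n)")
  case True
  then obtain j :: 'n where j: "enum j = m" using enum_surj by blast
  then have bv: "basis_vector m = (axis j 1 :: 'k^'n)" using basis_vector_enum[of j] by simp
  show ?thesis
    unfolding bv vec_eq_iff matrix_vector_mult_axis by (auto simp: lower_shift_def basis_vector_def j)
qed (simp add: basis_vector_eq_0)

definition coordinate_space :: "nat \<Rightarrow> ('k::field^'n::finite) set" where
  "coordinate_space k = {v. \<forall>i. i \<notin> {i. enum i < k} \<longrightarrow> v $ i = 0}"

lemma card_enum_less: "k \<le> CARD('n) \<Longrightarrow> card {i :: 'n::finite. enum i < k} = k"
proof -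
  assume k: "k \<le> CARD('n)"
  have "enum ` {i :: 'n. enum i < k} = {..<k}"
    using k enum_surj[where 'n='n] by (auto simp: image_iff) (metis order.strict_trans2)
  moreover have "inj_on enum {i :: 'n. enum i < k}" by (rule inj_onI) simp
  ultimately show ?thesis using card_image by fastforce
qed

lemma basis_vector_in_coordinate_space:
  "basis_vector m \<in> (coordinate_space k :: ('k::field^'n::finite) set) \<Longrightarrow> m < CARD('n) \<Longrightarrow> m < k"
  using enum_surj[of m, where 'n='n] by (force simp: coordinate_space_def basis_vector_def)

text \<open>Applying the shift lowers the top index of a vector one by one, so an invariant subspace is spanned by the
  basis vectors up to its top index.\<close>

lemma shift_invariant_subspace:
  fixes V :: "('k::field^'n::finite) set"
  assumes V: "vec.subspace V" "stabilizes shift V"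
  shows "V = coordinate_space (vec.dim V)"
proof -
  have "\<exists>k\<le>CARD('n). V = coordinate_space k"
  proof (cases "V = {0}")
    case True
    then have "V = coordinate_space 0" by (auto simp: coordinate_space_def vec_eq_iff)
    then show ?thesis by blast
  next
    case False
    define S where "S = {enum i |i v. v \<in> V \<and> v $ i \<noteq> 0}"
    have "S \<subseteq> {..<CARD('n)}" using enum_less by (auto simp: S_def)
    then have fin: "finite S" by (rule finite_subset) simp
    obtain v where "v \<in> V" "v \<noteq> 0" using False vec.subspace_0[OF V(1)] by blast
    then have "S \<noteq> {}" by (auto simp: S_def vec_eq_iff)
    then have M: "Max S \<in> S" using fin by simp
    define k where "k = Suc (Max S)"
    have k: "k \<le> CARD('n)" using M \<open>S \<subseteq> {..<CARD('n)}\<close> by (auto simp: k_def Suc_le_eq)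
    have le: "V \<subseteq> coordinate_space k"
    proof
      fix v assume v: "v \<in> V"
      have "v $ i = 0" if "\<not> enum i < k" for i
      proof (rule ccontr)
        assume "v $ i \<noteq> 0"
        then have "enum i \<in> S" using v by (auto simp: S_def)
        then have "enum i \<le> Max S" using fin by simp
        then show False using that by (simp add: k_def)
      qed
      then show "v \<in> coordinate_space k" by (simp add: coordinate_space_def)
    qed
    have top: "\<exists>u\<in>V. (\<forall>i. enum i = l \<longrightarrow> u $ i \<noteq> 0) \<and> (\<forall>i. l < enum i \<longrightarrow> u $ i = 0)" if "l \<le> Max S" for l
      using that
    proof (induction rule: inc_induct)
      case base
      obtain i0 v where v: "v \<in> V" "v $ i0 \<noteq> 0" "enum i0 = Max S" using M by (auto simp: S_def)
      have "v $ i = 0" if "Max S < enum i" for i using v(1) le that by (auto simp: coordinate_space_def k_def)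
      moreover have "v $ i \<noteq> 0" if "enum i = Max S" for i using that v by (metis enum_eq_iff)
      ultimately show ?case using v(1) by blast
    next
      case (step l)
      then obtain u where u: "u \<in> V" "\<And>i. enum i = Suc l \<Longrightarrow> u $ i \<noteq> 0" "\<And>i. Suc l < enum i \<Longrightarrow> u $ i = 0" by blast
      have sh: "(shift *v u) $ i = u $ j" if "enum j = Suc (enum i)" for i j
      proof -
        have "(shift *v u) $ i = (\<Sum>j'\<in>UNIV. if j' = j then u $ j' else 0)"
          unfolding matrix_vector_mult_def shift_def vec_lambda_beta
          by (intro sum.cong) (auto simp: that[symmetric])
        then show ?thesis by simp
      qed
      have "(shift *v u) $ i \<noteq> 0" if "enum i = l" for i
      proof -
        have "Suc l < CARD('n)" using step(2) k by (simp add: k_def)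
        then obtain j :: 'n where "enum j = Suc l" using enum_surj by blast
        then show ?thesis using sh[of j i] u(2) that by simp
      qed
      moreover have "(shift *v u) $ i = 0" if "l < enum i" for i
      proof (cases "Suc (enum i) < CARD('n)")
        case True
        then obtain j :: 'n where "enum j = Suc (enum i)" using enum_surj by blast
        then show ?thesis using sh[of j i] u(3) that by simp
      next
        case False
        then have "enum j \<noteq> Suc (enum i)" for j :: 'n using enum_less[of j] by auto
        then show ?thesis by (simp add: matrix_vector_mult_def shift_def)
      qed
      moreover have "shift *v u \<in> V" using u(1) V(2) by (auto simp: stabilizes_def)
      ultimately show ?case by blast
    qed
    \<comment> \<open>The coordinates below the top one are cleared with basis vectors already known
      to lie in \<open>V\<close>, so this induction runs upwards, whereas the one for
      \<open>top\<close> runs downwards.\<close>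
    have bv: "axis i 1 \<in> V" if "enum i \<le> Max S" for i
      using that
    proof (induction "enum i" arbitrary: i rule: less_induct)
      case less
      obtain u where u: "u \<in> V" "u $ i \<noteq> 0" "\<And>j. enum i < enum j \<Longrightarrow> u $ j = 0"
        using top[OF less.prems] by blast
      let ?w = "\<Sum>j | enum j < enum i. u $ j *s axis j 1"
      have "?w \<in> V" using less by (intro vec.subspace_sum[OF V(1)] vec.subspace_scale[OF V(1)]) auto
      then have "(1 / u $ i) *s (u - ?w) \<in> V" using u(1) V(1) by (intro vec.subspace_scale vec.subspace_diff)
      moreover have "(1 / u $ i) *s (u - ?w) = axis i 1"
      proof -
        have "?w $ j = (if enum j < enum i then u $ j else 0)" for j
        proof -
          have "?w $ j = (\<Sum>j' | enum j' < enum i. u $ j' * axis j' 1 $ j)" by simp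
          also have "\<dots> = (\<Sum>j' | enum j' < enum i. if j' = j then u $ j' else 0)"
            by (intro sum.cong) (auto simp: axis_def)
          finally show ?thesis by simp
        qed
        moreover have "u $ j = 0" if "\<not> enum j < enum i" "j \<noteq> i" for j
          using that u(3)[of j] by (metis enum_eq_iff linorder_neqE_nat)
        ultimately show ?thesis using u(2) by (auto simp: vec_eq_iff axis_def)
      qed
      ultimately show ?case by simp
    qed
    have "coordinate_space k \<subseteq> V"
    proof
      fix v :: "'k^'n" assume v: "v \<in> coordinate_space k"
      have "v $ i *s axis i 1 \<in> V" for i
      proof (cases "enum i < k")
        case True
        then show ?thesis using bv[of i] by (intro vec.subspace_scale V(1)) (simp add: k_def)
      next
        case False
        then show ?thesis using v vec.subspace_0[OF V(1)] by (simp add: coordinate_space_def)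
      qed
      then have "(\<Sum>i\<in>UNIV. v $ i *s axis i 1) \<in> V" by (intro vec.subspace_sum V(1))
      moreover have "(\<Sum>i\<in>UNIV. v $ i *s axis i 1) = v"
        by (simp add: vec_eq_iff axis_def if_distrib cong: if_cong)
      ultimately show "v \<in> V" by simp
    qed
    then show ?thesis using le k by blast
  qed
  then obtain k where k: "k \<le> CARD('n)" "V = coordinate_space k" by blast
  then have "vec.dim V = k"
    by (simp add: coordinate_space_def dim_substandard_cart[of "{i. enum i < k}", simplified] card_enum_less)
  then show ?thesis using k(2) by simp
qed

lemma basis_vector_in_dim:
  fixes V :: "('k::field^'n::finite) set"
  assumes "vec.subspace V" "stabilizes shift V" "m < vec.dim V"
  shows "basis_vector m \<in> V"
proof -
  have "basis_vector m \<in> (coordinate_space (vec.dim V) :: ('k^'n) set)"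
    using assms(3) by (simp add: coordinate_space_def basis_vector_def)
  then show ?thesis using shift_invariant_subspace[OF assms(1,2)] by simp
qed

lemma dim_bound_if_basis_vector_in:
  fixes V :: "('k::field^'n::finite) set"
  assumes "vec.subspace V" "stabilizes shift V" "basis_vector m \<in> V" "m < CARD('n)"
  shows "m < vec.dim V"
proof -
  have "basis_vector m \<in> (coordinate_space (vec.dim V) :: ('k^'n) set)"
    using assms(3) shift_invariant_subspace[OF assms(1,2)] by simp
  then show ?thesis using assms(4) by (rule basis_vector_in_coordinate_space)
qed

text \<open>With \<open>d\<close> the dimension, \<open>V\<close> contains the basis vector of index
  \<open>d - 1\<close> but not the one of index \<open>d\<close>, so the arrow from
  \<open>d - 1\<close> to \<open>d\<close> must be the missing one.\<close>

lemma no_lower_shift_invariant: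
  fixes V :: "('k::field^'n::finite) set"
  assumes V: "vec.subspace V" "stabilizes shift V" "stabilizes (lower_shift k) V" and dim: "vec.dim V \<in> {1..<CARD('n)}"
  shows "vec.dim V = k"
proof (rule ccontr)
  assume ne: "vec.dim V \<noteq> k"
  let ?d = "vec.dim V"
  have "basis_vector (?d - 1) \<in> V" using dim by (intro basis_vector_in_dim V(1,2)) auto
  then have "lower_shift k *v basis_vector (?d - 1) \<in> V" using V(3) by (auto simp: stabilizes_def)
  then have "basis_vector ?d \<in> V" using ne dim by (simp add: lower_shift_basis_vector)
  then have "?d < ?d" using dim by (intro dim_bound_if_basis_vector_in V(1,2)) auto
  then show False by simp
qed

lemma set_X_witness:
  assumes k: "k \<in> {1..<CARD('n)}" and l: "l \<in> {1..<CARD('n)}"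
  shows "(\<chi> j. (shift, transpose (lower_shift k))) \<in> (set_X l :: (('k::field, 'n::finite) mat_pair ^ 'r::finite) set) \<longleftrightarrow> l = k"
proof
  assume "(\<chi> j. (shift, transpose (lower_shift k))) \<in> (set_X l :: (('k, 'n) mat_pair ^ 'r) set)"
  then obtain V :: "('k^'n) set" where "vec.subspace V" "vec.dim V = l" "stabilizes shift V" "stabilizes (lower_shift k) V"
    unfolding set_X_iff by auto
  then show "l = k" using no_lower_shift_invariant[of V k] l by simp
next
  assume "l = k"
  let ?I = "{i :: 'n. enum i < k}"
  let ?D = "{x :: 'k^'n. \<forall>i. i \<notin> ?I \<longrightarrow> x $ i = 0}"
  have sub: "vec.subspace ?D" by (auto simp: vec.subspace_def)
  have dim: "vec.dim ?D = k" unfolding dim_substandard_cart using k by (intro card_enum_less) simp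
  have "stabilizes shift ?D"
    unfolding stabilizes_coordinates_iff[symmetric] by (auto simp: stabilizes_coordinates_def shift_def)
  moreover have "stabilizes (lower_shift k) ?D"
    unfolding stabilizes_coordinates_iff[symmetric] by (auto simp: stabilizes_coordinates_def lower_shift_def)
  ultimately show "(\<chi> j. (shift, transpose (lower_shift k))) \<in> (set_X l :: (('k, 'n) mat_pair ^ 'r) set)"
    unfolding set_X_iff \<open>l = k\<close> using sub dim by (intro exI[of _ ?D]) simp
qed

text \<open>The tuple of pairs \<open>(0, mat 1)\<close> preserves every subspace, but an
  intertwiner \<open>p\<close> would satisfy \<open>p ** 0 = mat 1 ** p\<close>, so
  \<open>p = 0\<close>.\<close>

lemma set_X_not_subset_C:
  assumes k: "k \<le> CARD('n)" and s: "s \<noteq> 0"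
  shows "\<not> set_X k \<subseteq> (set_C s :: (('k::field, 'n::finite) mat_pair ^ 'r::finite) set)"
proof
  assume sub: "set_X k \<subseteq> (set_C s :: (('k, 'n) mat_pair ^ 'r) set)"
  let ?t = "\<chi> j. (0, mat 1) :: ('k, 'n) mat_pair ^ 'r"
  let ?I = "{i :: 'n. enum i < k}"
  let ?D = "{x :: 'k^'n. \<forall>i. i \<notin> ?I \<longrightarrow> x $ i = 0}"
  have "vec.subspace ?D" by (auto simp: vec.subspace_def)
  moreover have "vec.dim ?D = k" unfolding dim_substandard_cart using k by (intro card_enum_less) simp
  moreover have "stabilizes 0 ?D" "stabilizes (mat 1) ?D" by (auto simp: stabilizes_def)
  ultimately have "?t \<in> set_X k" unfolding set_X_iff by (intro exI[of _ ?D]) (simp add: transpose_mat)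
  then have "?t \<in> set_C s" using sub by blast
  then show False by (auto simp: set_C_def)
qed

section \<open>Irreducible tuples in \<open>set_Y\<close> and \<open>set_Y'\<close>\<close>

text \<open>Conjugation by the identity. The transposed second component is the full lower shift, so
  the action has a raising and a lowering matrix and no invariant member of the flag.\<close>

definition Y_witness :: "('k::field, 'n::finite) mat_pair ^ 'r::finite" where
  "Y_witness = (\<chi> j. (shift, shift))"

lemma Y_witness_in_set_Y: "(Y_witness :: ('a::field, 'b::finite) mat_pair ^ 'r::finite) \<in> set_Y"
proof -
  have inv: "invertible (mat 1 :: 'a^'b^'b)" by (simp add: invertible_det_nz)
  show ?thesis
    unfolding set_Y_def Y_witness_def
    using inv conj_eq_iff[OF inv, of shift shift]
    by (intro CollectI exI[of _ "mat 1"]) (simp add: not_alternating_mat_1 symmetric_matrix_def transpose_mat)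
qed

lemma irreducible_Y_witness: "irreducible_action (tuple_action (Y_witness :: ('k::field, 'n::finite) mat_pair ^ 'r::finite))"
  unfolding irreducible_tuple_action_iff
proof (intro ballI notI)
  fix i assume i: "i \<in> {1..<CARD('n)}" "(Y_witness :: ('k, 'n) mat_pair ^ 'r) \<in> set_X i"
  then obtain V :: "('k^'n) set" where "vec.subspace V" "vec.dim V = i" "stabilizes shift V" "stabilizes (lower_shift 0) V"
    unfolding set_X_iff Y_witness_def by (auto simp: transpose_shift)
  then show False using no_lower_shift_invariant[of V 0] i(1) by simp
qed

text \<open>Block diagonal on the consecutive index pairs \<open>2 l\<close>,
  \<open>2 l + 1\<close>: the first basis vector goes to the second, and the second to minus the
  first. For even size its square is minus the identity.\<close>

definition symplectic :: "'k::field^'n^'n::finite" where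
  "symplectic = (\<chi> i j. if enum i = Suc (enum j) \<and> even (enum j) then 1
     else if enum j = Suc (enum i) \<and> even (enum i) then - 1 else 0)"

lemma alternating_symplectic: "alternating_matrix (symplectic :: 'a::field^'b^'b::finite)"
  by (auto simp: alternating_matrix_iff symplectic_def)

lemma symplectic_basis_vector:
  assumes "even CARD('n)" "m < CARD('n)"
  shows "symplectic *v basis_vector m = (if even m then basis_vector (Suc m) else - basis_vector (m - 1) :: 'k::field^'n::finite)"
proof -
  obtain j :: 'n where j: "enum j = m" using enum_surj assms(2) by blast
  have "symplectic *v axis j 1 = (if even m then basis_vector (Suc m) else - basis_vector (m - 1) :: 'k^'n)"
  proof (cases "even m")
    case True
    then show ?thesis unfolding vec_eq_iff matrix_vector_mult_axis using j by (auto simp: symplectic_def basis_vector_def)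
  next
    case False
    then obtain l where "m = Suc l" "even l" by (cases m) auto
    then show ?thesis unfolding vec_eq_iff matrix_vector_mult_axis using j by (auto simp: symplectic_def basis_vector_def)
  qed
  moreover have "basis_vector m = (axis j 1 :: 'k^'n)" using basis_vector_enum[of j] unfolding j .
  ultimately show ?thesis by (simp only:)
qed

lemma symplectic_square:
  assumes even: "even CARD('n)"
  shows "symplectic ** symplectic = (- mat 1 :: 'k::field^'n^'n::finite)"
proof -
  have "(symplectic ** symplectic) *v axis j 1 = (- mat 1 :: 'k^'n^'n) *v axis j 1" for j :: 'n
  proof -
    have j: "enum j < CARD('n)" by (rule enum_less)
    have "(symplectic ** symplectic) *v basis_vector (enum j) = - (basis_vector (enum j) :: 'k^'n)"
    proof (cases "even (enum j)")
      case True
      then have "Suc (enum j) < CARD('n)" using j even by (metis Suc_lessI even_Suc)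
      then show ?thesis using True j even by (simp add: matrix_vector_mul_assoc[symmetric] symplectic_basis_vector)
    next
      case False
      then obtain l where l: "enum j = Suc l" "even l" by (cases "enum j") auto
      then have "symplectic *v (symplectic *v basis_vector (Suc l)) = symplectic *v (- basis_vector l :: 'k^'n)"
        using j even by (simp add: symplectic_basis_vector)
      also have "\<dots> = - (symplectic *v basis_vector l)" by (rule vec.neg)
      also have "\<dots> = - basis_vector (Suc l)" using l j even by (simp add: symplectic_basis_vector)
      finally show ?thesis using l by (simp add: matrix_vector_mul_assoc)
    qed
    moreover have "(- mat 1 :: 'k^'n^'n) *v v = - v" for v
      using mat_vector_mult[of 1 v] by (simp add: matrix_vector_mult_def vec_eq_iff sum_negf)
    ultimately show ?thesis by (simp add: basis_vector_enum)
  qed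
  then have "(symplectic ** symplectic) $ i $ j = (- mat 1 :: 'k^'n^'n) $ i $ j" for i j :: 'n
    by (metis matrix_vector_mult_axis)
  then show ?thesis by (simp add: vec_eq_iff)
qed

lemma matrix_minus_mult: "(- x) ** y = - (x ** (y :: 'k::field^'n^'m))" "x' ** (- y) = - (x' ** y)"
  by (simp_all add: vec_eq_iff matrix_matrix_mult_def sum_negf)

lemma transpose_minus: "transpose (- x) = - transpose (x :: 'k::field^'n^'m)"
  by (simp add: vec_eq_iff transpose_def)

lemma invertible_symplectic:
  assumes "even CARD('n)"
  shows "invertible (symplectic :: 'k::field^'n^'n::finite)"
proof -
  have "symplectic ** (- symplectic) = (mat 1 :: 'k^'n^'n)" by (simp add: matrix_minus_mult symplectic_square[OF assms])
  then show ?thesis unfolding invertible_right_inverse by blast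
qed

text \<open>For even size the inverse of \<open>symplectic\<close> is \<open>- symplectic\<close>,
  so the second component is the conjugate of \<open>a\<close>. The index \<open>undefined\<close>
  is an arbitrary one carrying the shift; any further index carries the full lower shift.\<close>

definition Y'_witness :: "('k::field, 'n::finite) mat_pair ^ 'r::finite" where
  "Y'_witness = (\<chi> j. let a = (if j = undefined then shift else lower_shift 0) in (a, - (symplectic ** a ** symplectic)))"

lemma Y'_witness_in_set_Y':
  assumes "even CARD('n)"
  shows "(Y'_witness :: ('k::field, 'n::finite) mat_pair ^ 'r::finite) \<in> set_Y'"
proof -
  have "- (symplectic ** a ** symplectic) ** symplectic = symplectic ** a" for a :: "'k^'n^'n"
  proof -
    have "symplectic ** a ** symplectic ** symplectic = symplectic ** a ** (- mat 1)"
      by (simp only: symplectic_square[OF assms, symmetric] matrix_mul_assoc)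
    then show ?thesis by (simp add: matrix_minus_mult)
  qed
  moreover have "invertible (symplectic :: 'k^'n^'n)" by (rule invertible_symplectic[OF assms])
  ultimately show ?thesis
    unfolding set_Y'_def Y'_witness_def
    by (intro CollectI exI[of _ symplectic]) (simp add: conj_eq_iff Let_def alternating_symplectic)
qed

text \<open>With a second index the two shifts leave no flag member invariant. With one index, the
  lower shift conjugated by \<open>symplectic\<close> takes the basis vector of an even index
  \<open>m\<close> to that of \<open>m + 3\<close>, through \<open>m + 1\<close> and
  \<open>m + 2\<close>. This jump needs room, which size 2 does not offer.\<close>

lemma irreducible_Y'_witness:
  assumes even: "even CARD('n)" and size: "\<not> (CARD('n) = 2 \<and> CARD('r) = 1)"
  shows "irreducible_action (tuple_action (Y'_witness :: ('k::field, 'n::finite) mat_pair ^ 'r::finite))"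
  unfolding irreducible_tuple_action_iff
proof (intro ballI notI)
  fix k assume k: "k \<in> {1..<CARD('n)}" "(Y'_witness :: ('k, 'n) mat_pair ^ 'r) \<in> set_X k"
  then obtain V :: "('k^'n) set" where V: "vec.subspace V" "vec.dim V = k"
    and stab: "\<And>j. stabilizes (fst ((Y'_witness :: ('k, 'n) mat_pair ^ 'r) $ j)) V"
      "\<And>j. stabilizes (transpose (snd ((Y'_witness :: ('k, 'n) mat_pair ^ 'r) $ j))) V"
    unfolding set_X_iff by blast
  have sh: "stabilizes shift V" using stab(1)[of undefined] by (simp add: Y'_witness_def Let_def)
  show False
  proof (cases "CARD('r) = 1")
    case False
    have "\<exists>j. j \<noteq> (undefined :: 'r)"
    proof (rule ccontr)
      assume "\<nexists>j. j \<noteq> (undefined :: 'r)"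
      then have "(UNIV :: 'r set) = {undefined}" by auto
      then have "CARD('r) = 1" by (metis card_1_singleton_iff One_nat_def)
      then show False using False by simp
    qed
    then obtain j :: 'r where "j \<noteq> undefined" by blast
    then have "stabilizes (lower_shift 0) V" using stab(1)[of j] by (simp add: Y'_witness_def Let_def)
    then show False using no_lower_shift_invariant[OF V(1) sh] V(2) k(1) by fastforce
  next
    case True
    then have "CARD('n) \<noteq> 2" using size by blast
    have tp: "transpose symplectic = (- symplectic :: 'k^'n^'n)"
      using alternating_symplectic[where 'a='k and 'b='n] unfolding alternating_matrix_def by blast
    have "transpose (- (symplectic ** shift ** symplectic)) = - (symplectic ** lower_shift 0 ** (symplectic :: 'k^'n^'n))"
      by (simp add: transpose_minus matrix_transpose_mul tp matrix_minus_mult transpose_shift matrix_mul_assoc)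
    then have "stabilizes (- (symplectic ** lower_shift 0 ** symplectic)) V"
      using stab(2)[of undefined] by (simp add: Y'_witness_def Let_def)
    then have inV: "(- (symplectic ** lower_shift 0 ** symplectic)) *v v \<in> V" if "v \<in> V" for v
      using that by (auto simp: stabilizes_def)
    have W: "symplectic *v (lower_shift 0 *v (symplectic *v v)) \<in> V" if "v \<in> V" for v
    proof -
      have "(- (symplectic ** lower_shift 0 ** symplectic)) *v v = - (symplectic *v (lower_shift 0 *v (symplectic *v v)))"
        by (simp add: matrix_vector_mul_assoc matrix_mul_assoc) (simp add: matrix_vector_mult_def vec_eq_iff sum_negf)
      then show ?thesis using inV[OF that] vec.subspace_neg[OF V(1)] by fastforce
    qed
    have jump: "m + 3 < k" if m: "even m" "m < k" "m + 3 < CARD('n)" for m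
    proof -
      have "basis_vector m \<in> V" using m V by (intro basis_vector_in_dim sh) auto
      then have "basis_vector (m + 3) \<in> V" using W[of "basis_vector m"] m even
        by (simp add: symplectic_basis_vector lower_shift_basis_vector numeral_3_eq_3)
      then show ?thesis using dim_bound_if_basis_vector_in[OF V(1) sh, of "m + 3"] m(3) V(2) by simp
    qed
    have n: "CARD('n) \<ge> 4"
      using even k(1) \<open>CARD('n) \<noteq> 2\<close> by (auto elim!: evenE)
    \<comment> \<open>Each case takes an even \<open>m\<close> with \<open>m < k\<close>,
      \<open>k \<le> m + 3\<close> and \<open>m + 3 < CARD('n)\<close>, so that \<open>jump\<close>
      contradicts the dimension: \<open>k - 2\<close> for even \<open>k\<close>,
      \<open>k - 1\<close> for odd \<open>k\<close> below \<open>CARD('n) - 1\<close>, and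
      \<open>k - 3\<close> for \<open>k = CARD('n) - 1\<close>.\<close>
    show False
    proof (cases "even k")
      case True
      then have "k + 1 < CARD('n)" "k \<ge> 2" using even k(1) by (auto elim!: evenE)
      then show False using jump[of "k - 2"] True by simp
    next
      case False
      show False
      proof (cases "k + 1 < CARD('n)")
        case True
        moreover have "k + 2 \<noteq> CARD('n)" using even False by (metis even_add even_numeral)
        ultimately have "k + 2 < CARD('n)" by linarith
        then show False using jump[of "k - 1"] False k(1) by simp
      next
        case False
        moreover have "k < CARD('n)" using k(1) by simp
        ultimately have kn: "CARD('n) = k + 1" by linarith
        then have "even (k - 3)" "k - 3 < k" "k - 3 + 3 = k" using even n by auto
        then show False using jump[of "k - 3"] kn by simp
      qed
    qed
  qed
qed

section \<open>Uniqueness of intertwiners and their sign\<close>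

text \<open>By Schur's lemma \<open>matrix_inv p ** q\<close> is a scalar, so \<open>q\<close> is a
  multiple of \<open>p\<close> and has the same behaviour under transposition.\<close>

lemma intertwiner_sign:
  fixes t :: "('k::alg_closed_field, 'n::finite) mat_pair ^ 'r::finite"
  assumes irr: "irreducible_action (tuple_action t)"
    and p: "invertible p" "transpose p = mat s ** p" "\<And>j. p ** fst (t $ j) = snd (t $ j) ** p"
    and t: "t \<in> set_C s'" and s: "s \<noteq> 0" "s' \<noteq> 0"
  shows "s = s'"
proof -
  obtain q where q: "q \<noteq> 0" "transpose q = mat s' ** q" "\<And>j. q ** fst (t $ j) = snd (t $ j) ** q"
    using t unfolding set_C_def by blast
  \<comment> \<open>The action contains the transposed second components too. Transposing the
    intertwining relation and cancelling the scalar \<open>c\<close> shows that \<open>z\<close>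
    intertwines these as well.\<close>
  have transposed: "transpose (fst (t $ j)) ** z = z ** transpose (snd (t $ j))"
    if z: "transpose z = mat c ** z" "z ** fst (t $ j) = snd (t $ j) ** z" and c: "c \<noteq> 0" for z :: "'k^'n^'n" and c j
  proof -
    have "transpose (z ** fst (t $ j)) = transpose (snd (t $ j) ** z)" using z(2) by simp
    then have "mat c ** (transpose (fst (t $ j)) ** z) = mat c ** (z ** transpose (snd (t $ j)))"
      by (simp add: matrix_transpose_mul z(1) mat_commute matrix_mul_assoc[symmetric])
    then show ?thesis using c by (simp add: mat_matrix_mult vec_eq_iff)
  qed
  have inverse: "y ** matrix_inv p = matrix_inv p ** x" if "p ** y = x ** p" for x y
  proof -
    have "y ** matrix_inv p = (matrix_inv p ** p) ** y ** matrix_inv p" using p(1) by (simp add: matrix_inv_mult)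
    also have "\<dots> = matrix_inv p ** (p ** y) ** matrix_inv p" by (simp only: matrix_mul_assoc)
    also have "\<dots> = matrix_inv p ** x ** (p ** matrix_inv p)" unfolding that by (simp only: matrix_mul_assoc)
    finally show ?thesis using p(1) by (simp add: matrix_inv_mult)
  qed
  have "matrix_inv p ** q ** y = y ** (matrix_inv p ** q)" if y: "y \<in> tuple_action t" for y
  proof -
    obtain x where x: "p ** y = x ** p" "q ** y = x ** q"
    proof -
      consider j where "y = fst (t $ j)" | j where "y = transpose (snd (t $ j))" using y unfolding tuple_action_def by blast
      then show thesis
      proof cases
        case (1 j)
        then show thesis using that p(3) q(3) by blast
      next
        case (2 j)
        then show thesis using that transposed[OF p(2,3) s(1)] transposed[OF q(2,3) s(2)] by metis
      qed
    qed
    have "matrix_inv p ** q ** y = matrix_inv p ** x ** q" using x(2) by (simp add: matrix_mul_assoc[symmetric])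
    also have "\<dots> = y ** matrix_inv p ** q" using inverse[OF x(1)] by simp
    finally show ?thesis by (simp add: matrix_mul_assoc)
  qed
  then obtain c where "matrix_inv p ** q = mat c" using schur[OF irr] by metis
  then have "p ** matrix_inv p ** q = p ** mat c" by (metis matrix_mul_assoc)
  then have "q = p ** mat c" using p(1) by (simp add: matrix_inv_mult)
  then have qp: "q = mat c ** p" using mat_commute[of p c "mat 1"] by simp
  then have "transpose q = mat s ** q"
    using mat_commute[of "mat c" s p] by (simp add: matrix_transpose_mul transpose_mat p(2) mat_commute[of _ c "mat 1", simplified] matrix_mul_assoc)
  then have "mat s ** q = mat s' ** q" using q(2) by simp
  then have eq: "s * q $ i $ j = s' * q $ i $ j" for i j unfolding mat_matrix_mult vec_eq_iff vec_lambda_beta by blast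
  obtain i j where "q $ i $ j \<noteq> 0" using q(1) by (auto simp: vec_eq_iff)
  then show ?thesis using eq[of i j] by simp
qed

text \<open>For \<open>n = 2\<close> the alternating matrices form a line containing both \<open>p\<close> and \<open>p a + a\<^sup>t p\<close>, so the symplectic adjoint of \<open>a\<close>
  is a scalar minus \<open>a\<close> and shares its eigenvectors.\<close>

lemma set_Y'_subset_X:
  assumes "CARD('n) = 2" "CARD('r) = 1"
  shows "set_Y' \<subseteq> (set_X 1 :: (('k::alg_closed_field, 'n::finite) mat_pair ^ 'r::finite) set)"
proof
  fix t :: "('k, 'n) mat_pair ^ 'r" assume "t \<in> set_Y'"
  then obtain p where p: "invertible p" "alternating_matrix p" "\<And>j. p ** fst (t $ j) = snd (t $ j) ** p"
    unfolding set_Y'_def using conj_eq_iff by blast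
  obtain i1 i2 :: 'n where n: "UNIV = {i1, i2}" "i1 \<noteq> i2" using assms(1) by (metis card_2_iff)
  obtain j0 :: 'r where r: "UNIV = {j0}" using assms(2) by (metis card_1_singletonE)
  define a where "a = fst (t $ j0)"
  define b where "b = transpose (snd (t $ j0))"
  have tp: "transpose p = - p" using p(2) by (simp add: alternating_matrix_def)
  have "transpose (p ** a) = transpose (snd (t $ j0) ** p)" using p(3) by (simp add: a_def)
  then have pb: "transpose a ** p = p ** b" by (simp add: matrix_transpose_mul tp matrix_minus_mult b_def)
  have diag: "p $ i $ i = 0" and skew: "p $ j $ i = - p $ i $ j" for i j
    using p(2) unfolding alternating_matrix_iff by (auto simp: eq_neg_iff_add_eq_0)
  have p12: "p $ i1 $ i2 \<noteq> 0"
  proof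
    assume "p $ i1 $ i2 = 0"
    then have "p $ i $ j = 0" for i j using n diag[of i1] diag[of i2] skew[of i1 i2] by (metis UNIV_I insertE neg_0_equal_iff_equal singletonD)
    then have "p = 0" by (simp add: vec_eq_iff)
    then show False using invertible_nonzero[OF p(1)] by simp
  qed
  \<comment> \<open>The trace of \<open>a\<close>: comparing the off-diagonal entries of
    \<open>p ** a + transpose a ** p\<close> and \<open>p\<close> yields this factor.\<close>
  define c where "c = a $ i1 $ i1 + a $ i2 $ i2"
  have sum: "sum f UNIV = f i1 + f i2" for f :: "'n \<Rightarrow> 'k" unfolding n(1) using n(2) by simp
  have entry: "(p ** a + transpose a ** p) $ i $ j = c * p $ i $ j" for i j
  proof -
    have "i \<in> {i1, i2}" "j \<in> {i1, i2}" using n(1) by blast+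
    then show ?thesis
      using skew[of i2 i1] by (auto simp: matrix_matrix_mult_def transpose_def sum c_def diag algebra_simps)
  qed
  have "p ** a + p ** b = mat c ** p" unfolding pb[symmetric] mat_matrix_mult vec_eq_iff using entry by simp
  then have "p ** (a + b) = p ** mat c" using mat_commute[of p c "mat 1"] by (simp add: matrix_add_ldistrib)
  then have "matrix_inv p ** p ** (a + b) = matrix_inv p ** p ** mat c" by (simp only: matrix_mul_assoc[symmetric])
  then have ab: "a + b = mat c" using p(1) by (simp add: matrix_inv_mult)
  obtain w \<xi> where w: "w \<noteq> 0" "a *v w = \<xi> *s w"
    using eigenvector_exists[of UNIV a "axis undefined 1"] by (auto simp: stabilizes_def axis_eq_0_iff)
  have "b *v w = (a + b) *v w - a *v w" by (simp add: matrix_vector_mult_add_rdistrib)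
  then have bw: "b *v w = (c - \<xi>) *s w" by (simp add: ab w(2) vec.scale_left_diff_distrib)
  let ?V = "vec.span {w}"
  have stab: "stabilizes m ?V" if "m *v w = d *s w" for m d
    unfolding stabilizes_def vec.span_singleton by (auto simp: vector_scalar_commute that)
  have "vec.dim ?V = 1" using w(1) by simp
  moreover have "j = j0" for j using r by blast
  ultimately show "t \<in> set_X 1"
    unfolding set_X_iff using stab[OF w(2)] stab[OF bw] a_def b_def by (intro exI[of _ ?V]) (metis vec.subspace_span)
qed

section \<open>The irreducible components\<close>

lemma irreducible_not_in_set_X:
  fixes t :: "('k::field, 'n::finite) mat_pair ^ 'r::finite"
  assumes "irreducible_action (tuple_action t)" "i \<in> {1..<CARD('n)}"
  shows "t \<notin> set_X i"
  using assms irreducible_tuple_action_iff by blast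

lemma closure_set_Y_subset_C:
  "tuple_zariski closure_of set_Y \<subseteq> (set_C 1 :: (('k::alg_closed_field, 'n::finite) mat_pair ^ 'r::finite) set)"
  by (rule closure_of_minimal[OF set_Y_subset_C closedin_set_C])

lemma closure_set_Y'_subset_C:
  "tuple_zariski closure_of set_Y' \<subseteq> (set_C (- 1) :: (('k::alg_closed_field, 'n::finite) mat_pair ^ 'r::finite) set)"
  by (rule closure_of_minimal[OF set_Y'_subset_C closedin_set_C])

lemma set_Z_eq:
  "set_Z = (\<Union>i\<in>{1..<CARD('n)}. set_X i) \<union> tuple_zariski closure_of set_Y \<union>
    tuple_zariski closure_of (set_Y' :: (('k::alg_closed_field, 'n::finite) mat_pair ^ 'r::finite) set)"
proof
  have "set_Y \<subseteq> tuple_zariski closure_of (set_Y :: (('k, 'n) mat_pair ^ 'r) set)"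
    "set_Y' \<subseteq> tuple_zariski closure_of (set_Y' :: (('k, 'n) mat_pair ^ 'r) set)"
    by (simp_all add: closure_of_subset)
  then show "set_Z \<subseteq> (\<Union>i\<in>{1..<CARD('n)}. set_X i) \<union> tuple_zariski closure_of set_Y \<union>
      tuple_zariski closure_of (set_Y' :: (('k, 'n) mat_pair ^ 'r) set)"
    using set_Z_decomposition[where 'k='k and 'n='n and 'r='r] by blast
  show "(\<Union>i\<in>{1..<CARD('n)}. set_X i) \<union> tuple_zariski closure_of set_Y \<union>
      tuple_zariski closure_of (set_Y' :: (('k, 'n) mat_pair ^ 'r) set) \<subseteq> set_Z"
    using set_X_subset_Z[where 'k='k and 'n='n and 'r='r] closure_set_Y_subset_C closure_set_Y'_subset_C set_C_subset_Z by blast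
qed

theorem theorem7p1:
  fixes Z Y Y' :: "(('k::alg_closed_field, 'n::finite) mat_pair ^ 'r::finite) set"
    and X :: "nat \<Rightarrow> (('k, 'n) mat_pair ^ 'r) set"
  defines "Z \<equiv> set_Z" and "X \<equiv> set_X"
    and "Y \<equiv> tuple_zariski closure_of set_Y"
    and "Y' \<equiv> tuple_zariski closure_of set_Y'"
  shows "(odd CARD('n) \<or> (CARD('n) = 2 \<and> CARD('r) = 1) \<or> CHAR('k) = 2 \<longrightarrow>
            irreducible_components (subtopology tuple_zariski Z) = X ` {1..<CARD('n)} \<union> {Y} \<and>
            inj_on X {1..<CARD('n)} \<and> Y \<notin> X ` {1..<CARD('n)}) \<and>
         (even CARD('n) \<and> \<not> (CARD('n) = 2 \<and> CARD('r) = 1) \<and> CHAR('k) \<noteq> 2 \<longrightarrow>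
            irreducible_components (subtopology tuple_zariski Z) = X ` {1..<CARD('n)} \<union> {Y, Y'} \<and>
            inj_on X {1..<CARD('n)} \<and> Y \<notin> X ` {1..<CARD('n)} \<and> Y' \<notin> X ` {1..<CARD('n)} \<and> Y \<noteq> Y')"
proof -
  let ?N = "{1..<CARD('n)}"
  have Z: "Z = \<Union>(X ` ?N) \<union> Y \<union> Y'"
    unfolding Z_def X_def Y_def Y'_def by (rule set_Z_eq)
  have YC: "Y \<subseteq> set_C 1" and Y'C: "Y' \<subseteq> set_C (- 1)"
    unfolding Y_def Y'_def by (rule closure_set_Y_subset_C closure_set_Y'_subset_C)+
  have XX: "k = l" if "k \<in> ?N" "l \<in> ?N" "X k \<subseteq> X l" for k l
    using set_X_witness[OF that(1) that(1), where 'k='k and 'r='r] set_X_witness[OF that(1,2), where 'k='k and 'r='r] that(3)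
    unfolding X_def by blast
  then have inj: "inj_on X ?N" by (intro inj_onI) blast
  have XC: "\<not> X k \<subseteq> set_C s" if "k \<in> ?N" "s \<noteq> 0" for k s
    using set_X_not_subset_C[of k s, where 'n='n and 'r='r] that unfolding X_def by simp
  have XY: "\<not> X k \<subseteq> Y" and XY': "\<not> X k \<subseteq> Y'" if "k \<in> ?N" for k
    using XC[OF that, of 1] XC[OF that, of "- 1"] YC Y'C by auto
  have "set_Y \<subseteq> Y" unfolding Y_def by (simp add: closure_of_subset)
  then have wY: "Y_witness \<in> Y" using Y_witness_in_set_Y by blast
  have YX: "\<not> Y \<subseteq> X k" if "k \<in> ?N" for k
    using wY irreducible_not_in_set_X[OF irreducible_Y_witness that] unfolding X_def by blast
  have closedX: "closedin tuple_zariski (X k)" for k unfolding X_def by (rule closedin_set_X)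
  have closedY: "closedin tuple_zariski Y" "closedin tuple_zariski Y'" unfolding Y_def Y'_def by simp_all
  have irrX: "irreducible_space (subtopology tuple_zariski (X k))" if "k \<in> ?N" for k
    unfolding X_def using that by (intro irreducible_set_X) simp
  have irrY: "irreducible_space (subtopology tuple_zariski Y)"
    unfolding Y_def by (rule irreducible_closure_of[OF _ irreducible_set_Y]) simp
  have "irreducible_components (subtopology tuple_zariski Z) = X ` ?N \<union> {Y} \<and> inj_on X ?N \<and> Y \<notin> X ` ?N"
    if small: "odd CARD('n) \<or> (CARD('n) = 2 \<and> CARD('r) = 1) \<or> CHAR('k) = 2"
  proof -
    \<comment> \<open>The characteristic is split off first because the determinant argument for odd
      size says nothing in characteristic 2.\<close>
    have "Y' \<subseteq> \<Union>(X ` ?N) \<union> Y"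
    proof (cases "CHAR('k) = 2")
      case True
      then have "Y' \<subseteq> Y" unfolding Y_def Y'_def
        by (intro closure_of_minimal set_Y'_subset_closure_Y) simp_all
      then show ?thesis by blast
    next
      case char: False
      show ?thesis
      proof (cases "odd CARD('n)")
        case True
        then show ?thesis unfolding Y'_def by (simp add: set_Y'_empty[OF True char])
      next
        case False
        then have size: "CARD('n) = 2" "CARD('r) = 1" using small char by auto
        have "Y' \<subseteq> X 1" unfolding X_def Y'_def
          by (rule closure_of_minimal[OF set_Y'_subset_X[OF size] closedin_set_X])
        moreover have "1 \<in> ?N" using size(1) by simp
        ultimately show ?thesis by blast
      qed
    qed
    then have Z': "Z = \<Union>(X ` ?N \<union> {Y})" using Z by auto
    have "irreducible_components (subtopology tuple_zariski Z) = X ` ?N \<union> {Y}"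
      unfolding Z'
    proof (rule irreducible_components_eq)
      show "S = T" if "S \<in> X ` ?N \<union> {Y}" "T \<in> X ` ?N \<union> {Y}" "S \<subseteq> T" for S T
        using that by (elim UnE imageE insertE emptyE) (metis XX XY YX)+
    qed (use closedX closedY irrX irrY in auto)
    then show ?thesis using inj YX by blast
  qed
  moreover have "irreducible_components (subtopology tuple_zariski Z) = X ` ?N \<union> {Y, Y'} \<and> inj_on X ?N \<and>
      Y \<notin> X ` ?N \<and> Y' \<notin> X ` ?N \<and> Y \<noteq> Y'"
    if even: "even CARD('n)" and size: "\<not> (CARD('n) = 2 \<and> CARD('r) = 1)" and char: "CHAR('k) \<noteq> 2"
  proof -
    let ?w = "Y'_witness :: ('k, 'n) mat_pair ^ 'r"
    note wY' = Y'_witness_in_set_Y'[OF even, where 'k='k and 'r='r]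
    have "set_Y' \<subseteq> Y'" unfolding Y'_def by (simp add: closure_of_subset)
    then have "?w \<in> Y'" using wY' by blast
    have Y'X: "\<not> Y' \<subseteq> X k" if "k \<in> ?N" for k
      using \<open>?w \<in> Y'\<close> irreducible_not_in_set_X[OF irreducible_Y'_witness[OF even size] that] unfolding X_def by blast
    have sign: "(1 :: 'k) \<noteq> - 1" using two_nonzero[OF char] by (metis add.right_inverse one_add_one)
    have "Y_witness \<notin> (set_C (- 1) :: (('k, 'n) mat_pair ^ 'r) set)"
    proof
      assume t: "Y_witness \<in> (set_C (- 1) :: (('k, 'n) mat_pair ^ 'r) set)"
      obtain p :: "'k^'n^'n" where p: "invertible p" "transpose p = p"
        "\<And>j. p ** fst ((Y_witness :: ('k, 'n) mat_pair ^ 'r) $ j) = snd ((Y_witness :: ('k, 'n) mat_pair ^ 'r) $ j) ** p"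
        using Y_witness_in_set_Y[where 'a='k and 'b='n and 'r='r] conj_eq_iff unfolding set_Y_def symmetric_matrix_def by blast
      have "transpose p = mat 1 ** p" using p(2) by simp
      then have "(1 :: 'k) = - 1" using intertwiner_sign[OF irreducible_Y_witness p(1) _ p(3) t] by simp
      then show False using sign by blast
    qed
    then have YY': "\<not> Y \<subseteq> Y'" using wY Y'C by blast
    have "?w \<notin> set_C 1"
    proof
      assume t: "?w \<in> set_C 1"
      obtain p :: "'k^'n^'n" where p: "invertible p" "transpose p = - p" "\<And>j. p ** fst (?w $ j) = snd (?w $ j) ** p"
        using wY' conj_eq_iff unfolding set_Y'_def alternating_matrix_def by blast
      have "transpose p = mat (- 1) ** p" unfolding p(2) mat_matrix_mult by (simp add: vec_eq_iff)
      then have "- 1 = (1 :: 'k)" using intertwiner_sign[OF irreducible_Y'_witness[OF even size] p(1) _ p(3) t] by simp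
      then show False using sign by simp
    qed
    then have Y'Y: "\<not> Y' \<subseteq> Y" using \<open>?w \<in> Y'\<close> YC by blast
    have irrY': "irreducible_space (subtopology tuple_zariski Y')"
      unfolding Y'_def
      by (rule irreducible_closure_of[OF _ irreducible_set_Y'[OF invertible_symplectic[OF even] alternating_symplectic]]) simp
    have Z': "Z = \<Union>(X ` ?N \<union> {Y, Y'})" using Z by auto
    have "irreducible_components (subtopology tuple_zariski Z) = X ` ?N \<union> {Y, Y'}"
      unfolding Z'
    proof (rule irreducible_components_eq)
      show "S = T" if "S \<in> X ` ?N \<union> {Y, Y'}" "T \<in> X ` ?N \<union> {Y, Y'}" "S \<subseteq> T" for S T
        using that by (elim UnE imageE insertE emptyE) (metis XX XY XY' YX Y'X YY' Y'Y)+
    qed (use closedX closedY irrX irrY irrY' in auto)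
    then show ?thesis using inj YX Y'X YY' by blast
  qed
  ultimately show ?thesis by blast
qed

end
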